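(* For any integers $1\le a\le b$ there exists $n_0=n_0(a,b)$ such that for every $n\ge n_0$ there is an $n$-vertex graph $T$, obtained from a complete bipartite graph by adding an edge, with $$\mathrm{ex}(n,K_{a,b},B_{3,1})=\mathcal{N}(K_{a,b},T).$$
   Context: All graphs are finite and simple. A graph is $F$-free if it does not contain $F$ as a (not necessarily induced) subgraph. $\mathcal{N}(H,G)$ denotes the number of unlabeled copies of $H$ in $G$, i.e. the number of (not necessarily induced) subgraphs of $G$ isomorphic to $H$. $\mathrm{ex}(n,H,F)$ is the maximum of $\mathcal{N}(H,G)$ over all $n$-vertex $F$-free graphs $G$. $K_{a,b}$ is the complete bipartite graph with parts of sizes $a$ and $b$. $B_{3,1}$ is the graph consisting of two triangles sharing exactly one vertex. Adding an edge to a complete bipartite graph means adding one new edge between two non-adjacent vertices (hence inside one of its parts). *)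

theory Defs
  imports Main
begin

text \<open>A graph is a pair of a vertex set and a set of edges, each edge being a two-element set of
  vertices. Vertices outside of all edges are allowed.\<close>

type_synonym 'a graph = "'a set \<times> 'a set set"

abbreviation verts :: "'a graph \<Rightarrow> 'a set" where
  "verts G \<equiv> fst G"

abbreviation edges :: "'a graph \<Rightarrow> 'a set set" where
  "edges G \<equiv> snd G"

definition simple_graph :: "'a graph \<Rightarrow> bool" where
  "simple_graph G \<longleftrightarrow> finite (verts G) \<and> (\<forall>e\<in>edges G. e \<subseteq> verts G \<and> card e = 2)"

definition subgraph :: "'a graph \<Rightarrow> 'a graph \<Rightarrow> bool" where
  "subgraph S G \<longleftrightarrow> simple_graph S \<and> verts S \<subseteq> verts G \<and> edges S \<subseteq> edges G"

definition graph_iso :: "'a graph \<Rightarrow> 'b graph \<Rightarrow> bool" where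
  "graph_iso G H \<longleftrightarrow>
     (\<exists>f. bij_betw f (verts G) (verts H) \<and>
          (\<forall>u\<in>verts G. \<forall>v\<in>verts G. {u, v} \<in> edges G \<longleftrightarrow> {f u, f v} \<in> edges H))"

definition copies :: "'a graph \<Rightarrow> 'b graph \<Rightarrow> 'b graph set" where
  "copies H G = {S. subgraph S G \<and> graph_iso S H}"

definition num_copies :: "'a graph \<Rightarrow> 'b graph \<Rightarrow> nat" where
  "num_copies H G = card (copies H G)"

definition free_of :: "'a graph \<Rightarrow> 'b graph \<Rightarrow> bool" where
  "free_of F G \<longleftrightarrow> \<not> (\<exists>S. subgraph S G \<and> graph_iso S F)"

text \<open>Every finite graph is isomorphic to one whose vertices are natural numbers, so the
  generalized Turan number may be computed over those. The set below is finite; it is nonempty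
  as soon as \<open>F\<close> has an edge, because of the edgeless graph.\<close>

definition ex_num :: "nat \<Rightarrow> 'a graph \<Rightarrow> 'b graph \<Rightarrow> nat" where
  "ex_num n H F =
     Max {num_copies H G | G :: nat graph. simple_graph G \<and> card (verts G) = n \<and> free_of F G}"

definition complete_bipartite :: "'a set \<Rightarrow> 'a set \<Rightarrow> 'a graph" where
  "complete_bipartite A B = (A \<union> B, {{x, y} | x y. x \<in> A \<and> y \<in> B})"

definition K :: "nat \<Rightarrow> nat \<Rightarrow> nat graph" where
  "K a b = complete_bipartite {0..<a} {a..<a + b}"

definition B31 :: "nat graph" where
  "B31 = ({0, 1, 2, 3, 4}, {{0, 1}, {0, 2}, {1, 2}, {0, 3}, {0, 4}, {3, 4}})"

text \<open>Both parts of the complete bipartite graph are required to be nonempty.\<close>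

definition complete_bipartite_plus_edge :: "'a graph \<Rightarrow> bool" where
  "complete_bipartite_plus_edge T \<longleftrightarrow>
     (\<exists>A B u v. finite A \<and> finite B \<and> A \<noteq> {} \<and> B \<noteq> {} \<and> A \<inter> B = {} \<and>
        u \<in> A \<union> B \<and> v \<in> A \<union> B \<and> u \<noteq> v \<and> {u, v} \<notin> edges (complete_bipartite A B) \<and>
        T = (A \<union> B, insert {u, v} (edges (complete_bipartite A B))))"

end

theory Submission
  imports Defs Complex_Main "HOL-Combinatorics.Transposition"
begin

text \<open>
  Why the theorem is true. Copies of \<open>K\<^sub>a\<^sub>,\<^sub>b\<close> are counted as bicliques, that is, as
  pairs of vertex sets of sizes \<open>a\<close> and \<open>b\<close> that are completely joined; put \<open>r = a + b\<close>. A
  graph on \<open>n\<close> vertices has at most about \<open>n ^ r\<close> bicliques, a balanced complete bipartite graph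
  has at least \<open>c * n ^ r\<close> of them, and at most \<open>O(n ^ (r - k))\<close> of them contain \<open>k\<close> given
  vertices. Fix a bowtie-free graph \<open>G\<close> with the largest number \<open>m\<close> of bicliques.

  Every vertex of \<open>G\<close> lies in about the average number \<open>r * m / n\<close> of bicliques
  (\<open>extremal_vertex_share\<close>). The reason is symmetrization: a vertex in few bicliques could be
  replaced by a copy of a vertex \<open>v\<close> in many. In a bowtie-free graph the edges inside the
  neighbourhood of \<open>v\<close> are pairwise intersecting, so they are covered by two vertices; when the
  copy of \<open>v\<close> is not joined to these two, it lies in no triangle and creates no bowtie, and the
  loss is of lower order. The same covers show that \<open>O(n)\<close> edges can be deleted from \<open>G\<close> to
  reach a triangle-free graph that has only \<open>O(n ^ (r - 1))\<close> bicliques fewer.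

  For triangle-free graphs, stability is proved by Zykov symmetrization
  (\<open>triangle_free_stability\<close>). Replacing a vertex by a copy of a vertex that is not adjacent to
  it and lies in at least as many bicliques does not decrease the number of bicliques, and the
  process ends with a graph in which nonadjacent vertices are twins, which is complete bipartite.
  Running the process backwards, the last graph is bipartite, and each step changes the
  neighbourhood of one vertex \<open>u\<close> only. As \<open>u\<close> lies in many bicliques, it has large degree, so
  it cannot have neighbours in both parts without creating a triangle; hence it fits into one of
  the parts. The number of bicliques through \<open>u\<close> then forces \<open>u\<close> to be adjacent to almost all of
  the other part (\<open>few_nonneighbours\<close>), because the part sizes of a nearly optimal complete
  bipartite graph are such that no vertex of it lies in noticeably more than the average number of
  bicliques (\<open>bip_growth_le_average\<close>). This last bound does not depend on the earlier steps, so
  errors do not accumulate. Vertices in few bicliques can be replaced with a definite gain; as \<open>m\<close>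
  bounds the total, this happens boundedly often and costs a bounded exceptional set.

  Back in \<open>G\<close>, all vertices, including the exceptional ones, are redistributed over the two parts
  and are adjacent to almost all of the opposite part (\<open>extremal_structure\<close>). Two edges inside the
  same part would have two common neighbours and hence create a bowtie, so each part contains at
  most one edge. If only one part contains an edge, then \<open>G\<close> is contained in a complete bipartite
  graph plus an edge. If \<open>x y\<close> and \<open>u v\<close> are edges inside different parts, then neither \<open>u\<close> nor
  \<open>v\<close> is adjacent to both \<open>x\<close> and \<open>y\<close>, and trading \<open>u v\<close> for missing edges between the parts
  does not decrease the number of bicliques (\<open>two_inner_edges_le\<close>).
\<close>

section \<open>Bicliques\<close>

definition adjacency :: "('v \<Rightarrow> 'v \<Rightarrow> bool) \<Rightarrow> bool" where
  "adjacency E \<longleftrightarrow> symp E \<and> irreflp E"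

lemma adjacency_sym: "adjacency E \<Longrightarrow> E x y \<Longrightarrow> E y x"
  by (auto simp: adjacency_def dest: sympD)

lemma adjacency_irrefl: "adjacency E \<Longrightarrow> \<not> E x x"
  by (auto simp: adjacency_def irreflp_def)

definition blocks :: "nat \<Rightarrow> nat \<Rightarrow> 'v set \<Rightarrow> ('v set \<times> 'v set) set" where
  "blocks a b V = {X. X \<subseteq> V \<and> card X = a} \<times> {Y. Y \<subseteq> V \<and> card Y = b}"

text \<open>A copy of \<open>K\<^sub>a\<^sub>,\<^sub>b\<close> is represented by the ordered pair of its parts, which are disjoint
  because there are no loops. For \<open>a = b\<close> every copy is represented twice.\<close>

definition bicliques ::
  "nat \<Rightarrow> nat \<Rightarrow> 'v set \<Rightarrow> ('v \<Rightarrow> 'v \<Rightarrow> bool) \<Rightarrow> ('v set \<times> 'v set) set" where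
  "bicliques a b V E = {(X, Y) \<in> blocks a b V. \<forall>x\<in>X. \<forall>y\<in>Y. E x y}"

definition bicliques_at ::
  "nat \<Rightarrow> nat \<Rightarrow> 'v set \<Rightarrow> ('v \<Rightarrow> 'v \<Rightarrow> bool) \<Rightarrow> 'v \<Rightarrow> ('v set \<times> 'v set) set" where
  "bicliques_at a b V E v = {(X, Y) \<in> bicliques a b V E. v \<in> X \<union> Y}"

lemma mem_bicliques:
  "(X, Y) \<in> bicliques a b V E \<longleftrightarrow>
     X \<subseteq> V \<and> Y \<subseteq> V \<and> card X = a \<and> card Y = b \<and> (\<forall>x\<in>X. \<forall>y\<in>Y. E x y)"
  by (auto simp: bicliques_def blocks_def)

lemma mem_bicliques_at:
  "(X, Y) \<in> bicliques_at a b V E v \<longleftrightarrow> (X, Y) \<in> bicliques a b V E \<and> v \<in> X \<union> Y"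
  by (auto simp: bicliques_at_def)

lemma finite_blocks: "finite V \<Longrightarrow> finite (blocks a b V)"
  by (auto simp: blocks_def)

lemma finite_blocks_Collect: "finite V \<Longrightarrow> finite {(X, Y). (X, Y) \<in> blocks a b V \<and> P X Y}"
  by (rule finite_subset[OF _ finite_blocks]) auto

lemma finite_bicliques: "finite V \<Longrightarrow> finite (bicliques a b V E)"
  by (rule finite_subset[OF _ finite_blocks]) (auto simp: bicliques_def)

lemma finite_bicliques_at: "finite V \<Longrightarrow> finite (bicliques_at a b V E v)"
  by (rule finite_subset[OF _ finite_bicliques]) (auto simp: bicliques_at_def)

lemma bicliques_at_subset: "bicliques_at a b V E v \<subseteq> bicliques a b V E"
  by (auto simp: bicliques_at_def)

lemma biclique_disjoint:
  assumes "adjacency E" "(X, Y) \<in> bicliques a b V E"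
  shows "X \<inter> Y = {}"
  using assms(2) adjacency_irrefl[OF assms(1)] unfolding mem_bicliques by blast

lemma card_bicliques_mono:
  assumes "finite V" "\<And>x y. x \<in> V \<Longrightarrow> y \<in> V \<Longrightarrow> E x y \<Longrightarrow> F x y"
  shows "card (bicliques a b V E) \<le> card (bicliques a b V F)"
proof (rule card_mono[OF finite_bicliques[OF assms(1)]], safe)
  fix X Y assume "(X, Y) \<in> bicliques a b V E"
  then show "(X, Y) \<in> bicliques a b V F"
    unfolding mem_bicliques using assms(2) by (meson subsetD)
qed

lemma sum_card_bicliques_at:
  assumes "finite V" "adjacency E"
  shows "(\<Sum>v\<in>V. card (bicliques_at a b V E v)) = (a + b) * card (bicliques a b V E)"
proof -
  have "(\<Sum>v\<in>V. card {B \<in> bicliques a b V E. v \<in> fst B \<union> snd B})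
      = (a + b) * card (bicliques a b V E)"
  proof (rule sum_multicount[OF assms(1) finite_bicliques[OF assms(1)]], safe)
    fix X Y assume B: "(X, Y) \<in> bicliques a b V E"
    have "{v \<in> V. v \<in> fst (X, Y) \<union> snd (X, Y)} = X \<union> Y"
      using B by (auto simp: mem_bicliques)
    moreover have "card (X \<union> Y) = a + b"
      using B biclique_disjoint[OF assms(2) B] assms(1)
      by (auto simp: mem_bicliques card_Un_disjoint finite_subset)
    ultimately show "card {v \<in> V. v \<in> fst (X, Y) \<union> snd (X, Y)} = a + b" by simp
  qed
  moreover have "bicliques_at a b V E v = {B \<in> bicliques a b V E. v \<in> fst B \<union> snd B}" for v
    by (auto simp: bicliques_at_def)
  ultimately show ?thesis by simp
qed

text \<open>Each biclique contains \<open>a + b\<close> vertices, so this is averaging over the vertices.\<close>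

lemma ex_vertex_with_average_bicliques:
  assumes "finite V" "V \<noteq> {}" "adjacency E"
  obtains v where "v \<in> V"
    "(a + b) * card (bicliques a b V E) \<le> card V * card (bicliques_at a b V E v)"
proof -
  have "\<exists>v\<in>V. (a + b) * card (bicliques a b V E) \<le> card V * card (bicliques_at a b V E v)"
  proof (rule ccontr)
    assume "\<not> ?thesis"
    then have *: "card V * card (bicliques_at a b V E v) < (a + b) * card (bicliques a b V E)"
      if "v \<in> V" for v using that by auto
    have "card V * (\<Sum>v\<in>V. card (bicliques_at a b V E v))
        = (\<Sum>v\<in>V. card V * card (bicliques_at a b V E v))" by (simp add: sum_distrib_left)
    also have "\<dots> < (\<Sum>v\<in>V. (a + b) * card (bicliques a b V E))"
      by (rule sum_strict_mono) (use assms * in auto)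
    finally show False by (simp add: sum_card_bicliques_at[OF assms(1,3)])
  qed
  then show ?thesis using that by auto
qed

lemma choose_le_power: "(n choose k) \<le> n ^ k"
  by (cases "k \<le> n") (auto simp: binomial_le_pow binomial_eq_0)

lemma card_supersets:
  assumes "finite V" "finite D"
  shows "card {X. X \<subseteq> V \<and> card X = k \<and> D \<subseteq> X} \<le> (if card D \<le> k then card V ^ (k - card D) else 0)"
proof (cases "card D \<le> k")
  case False
  have empty: "{X. X \<subseteq> V \<and> card X = k \<and> D \<subseteq> X} = {}"
  proof (rule equals0I, safe)
    fix X assume "X \<subseteq> V" "D \<subseteq> X" "k = card X"
    then have "card D \<le> card X"
      using finite_subset[OF _ assms(1)] by (intro card_mono) auto
    then show False using False \<open>k = card X\<close> by simp
  qed
  show ?thesis unfolding empty by simp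
next
  case True
  have "card {X. X \<subseteq> V \<and> card X = k \<and> D \<subseteq> X} \<le> card {Y. Y \<subseteq> V \<and> card Y = k - card D}"
  proof (rule card_inj_on_le[where f = "\<lambda>X. X - D"])
    show "inj_on (\<lambda>X. X - D) {X. X \<subseteq> V \<and> card X = k \<and> D \<subseteq> X}"
    proof (rule inj_onI, safe)
      fix X Y x assume "X - D = Y - D" "D \<subseteq> X" "D \<subseteq> Y"
      then have "X = Y" by blast
      then show "x \<in> X \<Longrightarrow> x \<in> Y" "x \<in> Y \<Longrightarrow> x \<in> X" by simp_all
    qed
    show "(\<lambda>X. X - D) ` {X. X \<subseteq> V \<and> card X = k \<and> D \<subseteq> X} \<subseteq> {Y. Y \<subseteq> V \<and> card Y = k - card D}"
      using card_Diff_subset[OF assms(2)] by blast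
  qed (use assms in auto)
  also have "\<dots> \<le> card V ^ (k - card D)"
    using n_subsets[OF assms(1)] choose_le_power by simp
  finally show ?thesis using True by simp
qed

lemma card_blocks_containing:
  assumes "finite V" "finite D" "finite D'"
  shows "card {(X, Y) \<in> blocks a b V. D \<subseteq> X \<and> D' \<subseteq> Y}
     \<le> (if card D \<le> a \<and> card D' \<le> b then card V ^ (a + b - card D - card D') else 0)"
proof -
  have "{(X, Y) \<in> blocks a b V. D \<subseteq> X \<and> D' \<subseteq> Y}
      = {X. X \<subseteq> V \<and> card X = a \<and> D \<subseteq> X} \<times> {Y. Y \<subseteq> V \<and> card Y = b \<and> D' \<subseteq> Y}"
    by (auto simp: blocks_def)
  then have eq: "card {(X, Y) \<in> blocks a b V. D \<subseteq> X \<and> D' \<subseteq> Y}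
      = card {X. X \<subseteq> V \<and> card X = a \<and> D \<subseteq> X} * card {Y. Y \<subseteq> V \<and> card Y = b \<and> D' \<subseteq> Y}"
    by (simp add: card_cartesian_product)
  have "\<dots> \<le> (if card D \<le> a then card V ^ (a - card D) else 0)
      * (if card D' \<le> b then card V ^ (b - card D') else 0)"
    by (rule mult_le_mono[OF card_supersets[OF assms(1,2)] card_supersets[OF assms(1,3)]])
  also have "\<dots> = (if card D \<le> a \<and> card D' \<le> b then card V ^ (a + b - card D - card D') else 0)"
    by (auto simp flip: power_add)
  finally show ?thesis using eq by simp
qed

text \<open>The bounds from here to the end of the section give all error terms: every prescribed vertex
  lowers the exponent of the number of vertices by one.\<close>

lemma card_blocks_through_vertex:
  assumes "finite V" "1 \<le> a" "1 \<le> b"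
  shows "card {(X, Y) \<in> blocks a b V. v \<in> X \<union> Y} \<le> 2 * card V ^ (a + b - 1)"
proof -
  let ?B = "\<lambda>D D'. {(X, Y) \<in> blocks a b V. D \<subseteq> X \<and> D' \<subseteq> Y}"
  have "{(X, Y) \<in> blocks a b V. v \<in> X \<union> Y} \<subseteq> ?B {v} {} \<union> ?B {} {v}" by auto
  then have "card {(X, Y) \<in> blocks a b V. v \<in> X \<union> Y} \<le> card (?B {v} {} \<union> ?B {} {v})"
    by (intro card_mono) (simp_all add: finite_blocks_Collect assms(1))
  also have "\<dots> \<le> card (?B {v} {}) + card (?B {} {v})" by (rule card_Un_le)
  also have "\<dots> \<le> card V ^ (a + b - 1) + card V ^ (a + b - 1)"
    using card_blocks_containing[OF assms(1), of "{v}" "{}" a b]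
      card_blocks_containing[OF assms(1), of "{}" "{v}" a b] assms(2,3) by simp
  finally show ?thesis by simp
qed

lemma card_blocks_through_pair:
  assumes "finite V" "v \<noteq> w"
  shows "card {(X, Y) \<in> blocks a b V. v \<in> X \<union> Y \<and> w \<in> X \<union> Y} \<le> 4 * card V ^ (a + b - 2)"
proof -
  let ?B = "\<lambda>D D'. {(X, Y) \<in> blocks a b V. D \<subseteq> X \<and> D' \<subseteq> Y}"
  have le: "card (?B D D') \<le> card V ^ (a + b - 2)" 
    if "finite D" "finite D'" "card D + card D' = 2" for D D'
  proof -
    have "card V ^ (a + b - card D - card D') = card V ^ (a + b - 2)"
      using that(3) by (simp only: diff_diff_left)
    then show ?thesis
      using card_blocks_containing[OF assms(1) that(1,2), of a b] by (auto split: if_splits)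
  qed
  have "{(X, Y) \<in> blocks a b V. v \<in> X \<union> Y \<and> w \<in> X \<union> Y} \<subseteq>
     (?B {v, w} {} \<union> ?B {v} {w}) \<union> (?B {w} {v} \<union> ?B {} {v, w})" by auto
  then have "card {(X, Y) \<in> blocks a b V. v \<in> X \<union> Y \<and> w \<in> X \<union> Y}
     \<le> card ((?B {v, w} {} \<union> ?B {v} {w}) \<union> (?B {w} {v} \<union> ?B {} {v, w}))"
    by (intro card_mono) (simp_all add: finite_blocks_Collect assms(1))
  also have "\<dots> \<le> (card (?B {v, w} {}) + card (?B {v} {w})) + (card (?B {w} {v}) + card (?B {} {v, w}))"
    by (rule order_trans[OF card_Un_le]) (rule add_mono; rule card_Un_le)
  also have "\<dots> \<le> 4 * card V ^ (a + b - 2)"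
    using le[of "{v, w}" "{}"] le[of "{v}" "{w}"] le[of "{w}" "{v}"] le[of "{}" "{v, w}"] assms(2)
    by simp
  finally show ?thesis .
qed

lemma card_bicliques_meeting:
  assumes "finite V" "1 \<le> a" "1 \<le> b" "finite Z"
  shows "card {(X, Y) \<in> bicliques a b V E. (X \<union> Y) \<inter> Z \<noteq> {}} \<le> 2 * card Z * card V ^ (a + b - 1)"
proof -
  let ?A = "\<lambda>z. {(X, Y) \<in> blocks a b V. z \<in> X \<union> Y}"
  have "{(X, Y) \<in> bicliques a b V E. (X \<union> Y) \<inter> Z \<noteq> {}} \<subseteq> (\<Union>z\<in>Z. ?A z)"
    by (auto simp: bicliques_def)
  then have "card {(X, Y) \<in> bicliques a b V E. (X \<union> Y) \<inter> Z \<noteq> {}} \<le> card (\<Union>z\<in>Z. ?A z)"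
    by (intro card_mono) (simp_all add: finite_blocks_Collect assms(1,4))
  also have "\<dots> \<le> (\<Sum>z\<in>Z. card (?A z))" by (rule card_UN_le[OF assms(4)])
  also have "\<dots> \<le> (\<Sum>z\<in>Z. 2 * card V ^ (a + b - 1))"
    by (rule sum_mono) (rule card_blocks_through_vertex[OF assms(1-3)])
  finally show ?thesis by simp
qed

lemma card_bicliques_at_meeting:
  assumes "finite V" "finite Z" "v \<notin> Z"
  shows "card {(X, Y) \<in> bicliques_at a b V E v. (X \<union> Y) \<inter> Z \<noteq> {}} \<le> 4 * card Z * card V ^ (a + b - 2)"
proof -
  let ?A = "\<lambda>z. {(X, Y) \<in> blocks a b V. v \<in> X \<union> Y \<and> z \<in> X \<union> Y}"
  have "{(X, Y) \<in> bicliques_at a b V E v. (X \<union> Y) \<inter> Z \<noteq> {}} \<subseteq> (\<Union>z\<in>Z. ?A z)"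
    by (auto simp: bicliques_at_def bicliques_def)
  then have "card {(X, Y) \<in> bicliques_at a b V E v. (X \<union> Y) \<inter> Z \<noteq> {}} \<le> card (\<Union>z\<in>Z. ?A z)"
    by (intro card_mono) (simp_all add: finite_blocks_Collect assms(1,2))
  also have "\<dots> \<le> (\<Sum>z\<in>Z. card (?A z))" by (rule card_UN_le[OF assms(2)])
  also have "\<dots> \<le> (\<Sum>z\<in>Z. 4 * card V ^ (a + b - 2))"
    by (rule sum_mono, rule card_blocks_through_pair) (use assms in auto)
  finally show ?thesis by simp
qed

text \<open>A biclique through \<open>v\<close> also contains a neighbour of \<open>v\<close>, since both of its parts are
  nonempty. Hence a vertex in many bicliques has linear degree.\<close>

lemma card_bicliques_at_le_degree:
  assumes "finite V" "adjacency E" "1 \<le> a" "1 \<le> b"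
  shows "card (bicliques_at a b V E v) \<le> 4 * card {w \<in> V. E v w} * card V ^ (a + b - 2)"
proof -
  have "bicliques_at a b V E v = {(X, Y) \<in> bicliques_at a b V E v. (X \<union> Y) \<inter> {w \<in> V. E v w} \<noteq> {}}"
  proof -
    have "(X \<union> Y) \<inter> {w \<in> V. E v w} \<noteq> {}" if B: "(X, Y) \<in> bicliques_at a b V E v" for X Y
    proof -
      have ne: "X \<noteq> {}" "Y \<noteq> {}" using B assms(3,4) by (auto simp: mem_bicliques_at mem_bicliques)
      then obtain x y where xy: "x \<in> X" "y \<in> Y" by auto
      show ?thesis
      proof (cases "v \<in> X")
        case True
        then have "y \<in> (X \<union> Y) \<inter> {w \<in> V. E v w}"
          using B xy by (auto simp: mem_bicliques_at mem_bicliques)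
        then show ?thesis by blast
      next
        case False
        then have "v \<in> Y" using B by (auto simp: mem_bicliques_at)
        then have "E x v" "x \<in> V" using B xy by (auto simp: mem_bicliques_at mem_bicliques)
        then have "x \<in> (X \<union> Y) \<inter> {w \<in> V. E v w}" using xy adjacency_sym[OF assms(2)] by auto
        then show ?thesis by blast
      qed
    qed
    then show ?thesis by blast
  qed
  then have "card (bicliques_at a b V E v)
     = card {(X, Y) \<in> bicliques_at a b V E v. (X \<union> Y) \<inter> {w \<in> V. E v w} \<noteq> {}}" by simp
  also have "\<dots> \<le> 4 * card {w \<in> V. E v w} * card V ^ (a + b - 2)"
    by (rule card_bicliques_at_meeting) (use assms adjacency_irrefl[OF assms(2)] in auto)
  finally show ?thesis .
qed

section \<open>Replacing the neighbourhood of a vertex\<close>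

text \<open>With \<open>W\<close> the neighbourhood of \<open>v\<close> this is the symmetrization step: \<open>u\<close> becomes a twin of
  \<open>v\<close>. In a graph with triangles, \<open>W\<close> is a large independent subset of that neighbourhood.\<close>

definition reattach :: "'v \<Rightarrow> 'v set \<Rightarrow> ('v \<Rightarrow> 'v \<Rightarrow> bool) \<Rightarrow> 'v \<Rightarrow> 'v \<Rightarrow> bool" where
  "reattach u W E = (\<lambda>x y. if x = u then y \<in> W \<and> y \<noteq> u else if y = u then x \<in> W else E x y)"

definition triangle_free :: "('v \<Rightarrow> 'v \<Rightarrow> bool) \<Rightarrow> bool" where
  "triangle_free E \<longleftrightarrow> (\<forall>x y z. E x y \<longrightarrow> E x z \<longrightarrow> \<not> E y z)"

text \<open>The vertex \<open>c\<close> is the centre of two triangles; if the sets \<open>{p, q}\<close> and \<open>{s, t}\<close> were disjoint,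
  these would share exactly one vertex.\<close>

definition bowtie_free :: "('v \<Rightarrow> 'v \<Rightarrow> bool) \<Rightarrow> bool" where
  "bowtie_free E \<longleftrightarrow> (\<forall>c p q s t. E c p \<longrightarrow> E c q \<longrightarrow> E p q \<longrightarrow> E c s \<longrightarrow> E c t \<longrightarrow> E s t \<longrightarrow>
     {p, q} \<inter> {s, t} \<noteq> {})"

lemma triangle_free_imp_bowtie_free: "triangle_free E \<Longrightarrow> bowtie_free E"
  unfolding triangle_free_def bowtie_free_def by meson

lemma adjacency_reattach: "adjacency E \<Longrightarrow> adjacency (reattach u W E)"
  by (auto simp: adjacency_def symp_def irreflp_def reattach_def)

text \<open>If \<open>W\<close> is independent then \<open>u\<close> lies in no triangle afterwards, so no forbidden configuration
  can use \<open>u\<close>.\<close>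

lemma reattach_in_no_triangle:
  assumes "adjacency E" "\<And>x y. x \<in> W \<Longrightarrow> y \<in> W \<Longrightarrow> \<not> E x y"
    "reattach u W E x y" "reattach u W E x z" "reattach u W E y z"
  shows "x \<noteq> u \<and> y \<noteq> u \<and> z \<noteq> u \<and> E x y \<and> E x z \<and> E y z"
  using assms adjacency_sym[OF assms(1)] unfolding reattach_def by (auto split: if_splits)

lemma triangle_free_reattach:
  assumes "adjacency E" "triangle_free E" "\<And>x y. x \<in> W \<Longrightarrow> y \<in> W \<Longrightarrow> \<not> E x y"
  shows "triangle_free (reattach u W E)"
  unfolding triangle_free_def
  using reattach_in_no_triangle[OF assms(1,3)] assms(2) unfolding triangle_free_def by blast

lemma bowtie_free_reattach:
  assumes "adjacency E" "bowtie_free E" "\<And>x y. x \<in> W \<Longrightarrow> y \<in> W \<Longrightarrow> \<not> E x y"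
  shows "bowtie_free (reattach u W E)"
  unfolding bowtie_free_def
proof (intro allI impI)
  fix c p q s t
  assume "reattach u W E c p" "reattach u W E c q" "reattach u W E p q"
    "reattach u W E c s" "reattach u W E c t" "reattach u W E s t"
  then have "E c p \<and> E c q \<and> E p q" "E c s \<and> E c t \<and> E s t"
    using reattach_in_no_triangle[OF assms(1,3)] by blast+
  then show "{p, q} \<inter> {s, t} \<noteq> {}" using assms(2) unfolding bowtie_free_def by blast
qed

text \<open>Bicliques that avoid \<open>u\<close> do not change. A biclique through \<open>v\<close> that avoids \<open>u\<close> turns into one
  through \<open>u\<close> by exchanging \<open>u\<close> and \<open>v\<close>. A biclique through both \<open>u\<close> and \<open>v\<close> contains them on the
  same side when they are not adjacent, and then it survives unchanged, as its other side lies in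
  the neighbourhood of \<open>v\<close>. These two kinds of images differ in whether they contain \<open>v\<close>. The set
  \<open>R\<close> collects the neighbours of \<open>v\<close> that the new \<open>u\<close> may lack.\<close>

lemma card_bicliques_reattach:
  assumes V: "finite V" "u \<in> V" and E: "adjacency E" and uv: "u \<noteq> v"
    and W: "\<And>y. y \<noteq> u \<Longrightarrow> y \<notin> R \<Longrightarrow> E v y \<Longrightarrow> y \<in> W"
  shows "card (bicliques a b V E)
       + card {(X, Y) \<in> bicliques_at a b V E v. (X \<union> Y) \<inter> R = {} \<and> (u \<in> X \<union> Y \<longrightarrow> \<not> E u v)}
     \<le> card (bicliques a b V (reattach u W E)) + card (bicliques_at a b V E u)"
proof -
  let ?E = "reattach u W E"
  let ?A = "{(X, Y) \<in> bicliques_at a b V E v. (X \<union> Y) \<inter> R = {} \<and> (u \<in> X \<union> Y \<longrightarrow> \<not> E u v)}"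
  let ?t = "transpose u v"
  let ?f = "\<lambda>(X, Y). if u \<in> X \<union> Y then (X, Y) else (?t ` X, ?t ` Y)"
  have sym: "E y x" if "E x y" for x y using that adjacency_sym[OF E] by blast
  have t: "?t v = u" "?t u = v" "\<And>x. x \<noteq> u \<Longrightarrow> x \<noteq> v \<Longrightarrow> ?t x = x"
    by (auto simp: transpose_def)
  have t_iff: "v \<in> ?t ` X \<longleftrightarrow> u \<in> X" "u \<in> ?t ` X \<longleftrightarrow> v \<in> X" for X :: "'a set"
    by (metis (no_types, lifting) image_iff t transpose_involutory)+
  have avoid: "bicliques a b V E - bicliques_at a b V E u = bicliques a b V ?E - bicliques_at a b V ?E u"
  proof -
    have "(X, Y) \<in> bicliques a b V E \<longleftrightarrow> (X, Y) \<in> bicliques a b V ?E" if "u \<notin> X" "u \<notin> Y" for X Y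
    proof -
      have "?E x y = E x y" if "x \<in> X" "y \<in> Y" for x y
        using that \<open>u \<notin> X\<close> \<open>u \<notin> Y\<close> by (auto simp: reattach_def)
      then show ?thesis by (auto simp: mem_bicliques)
    qed
    then show ?thesis by (auto simp: bicliques_at_def)
  qed
  have "card ?A \<le> card (bicliques_at a b V ?E u)"
  proof (rule card_inj_on_le[where f = ?f])
    show "finite (bicliques_at a b V ?E u)" by (rule finite_bicliques_at[OF V(1)])
    show "inj_on ?f ?A"
    proof (rule inj_onI)
      fix p q assume p: "p \<in> ?A" and q: "q \<in> ?A" and eq: "?f p = ?f q"
      obtain X Y X' Y' where pq: "p = (X, Y)" "q = (X', Y')" by fastforce
      have v: "v \<in> X \<union> Y" "v \<in> X' \<union> Y'"
        using p q pq by (simp_all add: mem_bicliques_at)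
      have tv: "v \<notin> ?t ` A \<union> ?t ` B" if "u \<notin> A \<union> B" for A B
        using that by (simp add: t_iff)
      have inj: "?t ` A = ?t ` B \<longleftrightarrow> A = B" for A B
        by (rule inj_image_eq_iff[OF inj_transpose])
      have eq': "(if u \<in> X \<union> Y then (X, Y) else (?t ` X, ?t ` Y))
          = (if u \<in> X' \<union> Y' then (X', Y') else (?t ` X', ?t ` Y'))"
        using eq unfolding pq by simp
      have "u \<in> X \<union> Y \<longleftrightarrow> u \<in> X' \<union> Y'"
        using eq' v tv[of X Y] tv[of X' Y'] by (metis prod.inject)
      then show "p = q"
        using eq' unfolding pq by (metis prod.inject inj)
    qed
    show "?f ` ?A \<subseteq> bicliques_at a b V ?E u"
    proof (rule image_subsetI)
      fix p assume p: "p \<in> ?A"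
      obtain X' Y' where pq: "p = (X', Y')" by fastforce
      have B: "(X', Y') \<in> bicliques_at a b V E v" and R: "(X' \<union> Y') \<inter> R = {}"
        and nadj: "u \<in> X' \<union> Y' \<longrightarrow> \<not> E u v"
        using p pq by simp_all
      have B': "X' \<subseteq> V" "Y' \<subseteq> V" "card X' = a" "card Y' = b" "v \<in> X' \<union> Y'"
        "\<And>x y. x \<in> X' \<Longrightarrow> y \<in> Y' \<Longrightarrow> E x y"
        using B by (auto simp: mem_bicliques_at mem_bicliques)
      show "?f p \<in> bicliques_at a b V ?E u"
      proof (cases "u \<in> X' \<union> Y'")
        case True
        have fp: "?f p = (X', Y')" using True pq by simp
        have "?E x y" if xy: "x \<in> X'" "y \<in> Y'" for x y
        proof -
          have "E x y" using B' xy by blast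
          have nr: "x \<notin> R" "y \<notin> R" using R xy by auto
          have ne: "x \<noteq> y" using \<open>E x y\<close> adjacency_irrefl[OF E] by auto
          have "E v y" if "x = u"
            using that nadj True B' xy sym by blast
          moreover have "E v x" if "y = u"
            using that nadj True B' xy sym by blast
          ultimately show ?thesis
            using W nr ne \<open>E x y\<close> unfolding reattach_def by auto
        qed
        then show ?thesis unfolding fp using B' True by (auto simp: mem_bicliques_at mem_bicliques)
      next
        case False
        have fp: "?f p = (?t ` X', ?t ` Y')" using False pq by simp
        have "?E (?t x) (?t y)" if xy: "x \<in> X'" "y \<in> Y'" for x y
        proof -
          have "E x y" using B' xy by blast
          have nr: "x \<notin> R" "y \<notin> R" "x \<noteq> u" "y \<noteq> u" using R xy False by auto
          have ne: "x \<noteq> y" using \<open>E x y\<close> adjacency_irrefl[OF E] by auto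
          show ?thesis
            using W nr ne \<open>E x y\<close> t sym unfolding reattach_def
            by (cases "x = v"; cases "y = v") auto
        qed
        moreover have "?t ` X' \<subseteq> V" "?t ` Y' \<subseteq> V"
          using B' V(2) by (auto simp: transpose_def)
        moreover have "card (?t ` X') = a" "card (?t ` Y') = b"
          using B' by (auto simp: card_image inj_on_subset[OF inj_transpose])
        ultimately show ?thesis unfolding fp
          using B'(5) by (auto simp: mem_bicliques_at mem_bicliques t_iff)
      qed
    qed
  qed
  moreover have "card (bicliques a b V E) = card (bicliques a b V E - bicliques_at a b V E u)
      + card (bicliques_at a b V E u)"
    using card_Diff_subset[OF finite_bicliques_at[OF V(1)] bicliques_at_subset]
      card_mono[OF finite_bicliques[OF V(1)] bicliques_at_subset] by (metis le_add_diff_inverse2)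
  moreover have "card (bicliques a b V ?E) = card (bicliques a b V ?E - bicliques_at a b V ?E u)
      + card (bicliques_at a b V ?E u)"
    using card_Diff_subset[OF finite_bicliques_at[OF V(1)] bicliques_at_subset]
      card_mono[OF finite_bicliques[OF V(1)] bicliques_at_subset] by (metis le_add_diff_inverse2)
  ultimately show ?thesis using avoid by simp
qed

section \<open>Bicliques of a complete bipartite graph\<close>

definition bip_count :: "nat \<Rightarrow> nat \<Rightarrow> nat \<Rightarrow> nat \<Rightarrow> nat" where
  "bip_count a b p q = (p choose a) * (q choose b) + (p choose b) * (q choose a)"

text \<open>The gain in bicliques when a vertex is added to the part of size \<open>p\<close>: a discrete partial
  derivative of \<open>bip_count\<close>.\<close>

definition bip_growth :: "nat \<Rightarrow> nat \<Rightarrow> nat \<Rightarrow> nat \<Rightarrow> nat" where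
  "bip_growth a b p q = (p choose (a - 1)) * (q choose b) + (p choose (b - 1)) * (q choose a)"

lemma bip_count_commute: "bip_count a b p q = bip_count a b q p"
  by (simp add: bip_count_def)

lemma bip_count_mono: "p \<le> p' \<Longrightarrow> q \<le> q' \<Longrightarrow> bip_count a b p q \<le> bip_count a b p' q'"
  unfolding bip_count_def by (intro add_mono mult_le_mono binomial_right_mono)

lemma bip_growth_mono: "p \<le> p' \<Longrightarrow> q \<le> q' \<Longrightarrow> bip_growth a b p q \<le> bip_growth a b p' q'"
  unfolding bip_growth_def by (intro add_mono mult_le_mono binomial_right_mono)

lemma choose_Suc: "1 \<le> k \<Longrightarrow> (Suc n choose k) = (n choose k) + (n choose (k - 1))"
  by (cases k) simp_all

lemma bip_count_Suc:
  assumes "1 \<le> a" "1 \<le> b"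
  shows "bip_count a b (Suc p) q = bip_count a b p q + bip_growth a b p q"
  using assms by (simp add: bip_count_def bip_growth_def choose_Suc algebra_simps)

lemma bip_count_add_ge:
  assumes "1 \<le> a" "1 \<le> b"
  shows "bip_count a b p q + t * bip_growth a b p q \<le> bip_count a b (p + t) q"
proof (induction t)
  case (Suc t)
  then show ?case
    using bip_growth_mono[of p "p + t" q q a b] by (simp add: bip_count_Suc[OF assms])
qed simp

lemma bip_count_add_le:
  assumes "1 \<le> a" "1 \<le> b"
  shows "bip_count a b (p + t) q \<le> bip_count a b p q + t * bip_growth a b (p + t) q"
proof (induction t)
  case (Suc t)
  have "bip_growth a b (p + t) q \<le> bip_growth a b (p + Suc t) q"
    by (rule bip_growth_mono) auto
  then have "t * bip_growth a b (p + t) q + bip_growth a b (p + t) q \<le> Suc t * bip_growth a b (p + Suc t) q"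
    using mult_le_mono2[of "bip_growth a b (p + t) q" "bip_growth a b (p + Suc t) q" "Suc t"] by simp
  then show ?case using Suc by (simp add: bip_count_Suc[OF assms])
qed simp

lemma choose_mult_choose_le:
  "p \<le> n \<Longrightarrow> q \<le> n \<Longrightarrow> (p choose i) * (q choose j) \<le> n ^ (i + j)"
  unfolding power_add
  by (intro mult_le_mono order_trans[OF choose_le_power] power_mono) auto

lemma bip_growth_add_le:
  assumes "1 \<le> a" "1 \<le> b" "p \<le> n" "q + t \<le> n"
  shows "bip_growth a b p (q + t) \<le> bip_growth a b p q + t * (2 * n ^ (a + b - 2))"
  using assms(4)
proof (induction t)
  case (Suc t)
  have e: "(a - 1) + (b - 1) = a + b - 2" "(b - 1) + (a - 1) = a + b - 2" using assms(1,2) by auto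
  have qt: "q + t \<le> n" using Suc.prems by simp
  have "bip_growth a b p (q + Suc t) = bip_growth a b p (q + t)
      + ((p choose (a - 1)) * ((q + t) choose (b - 1)) + (p choose (b - 1)) * ((q + t) choose (a - 1)))"
    using assms(1,2) by (simp add: bip_growth_def choose_Suc algebra_simps)
  moreover have "(p choose (a - 1)) * ((q + t) choose (b - 1)) \<le> n ^ (a + b - 2)"
    by (rule choose_mult_choose_le[OF assms(3) qt, of "a - 1" "b - 1", unfolded e])
  moreover have "(p choose (b - 1)) * ((q + t) choose (a - 1)) \<le> n ^ (a + b - 2)"
    by (rule choose_mult_choose_le[OF assms(3) qt, of "b - 1" "a - 1", unfolded e])
  ultimately show ?case using Suc by simp
qed simp

text \<open>The gain from moving \<open>t\<close> vertices from the second part to the first one is given by the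
  difference of the two partial derivatives, up to a quadratic term in \<open>t\<close>.\<close>

lemma bip_count_move:
  assumes "1 \<le> a" "1 \<le> b" "p + (q + t) \<le> n"
  shows "bip_count a b p (q + t) + t * bip_growth a b p (q + t)
    \<le> bip_count a b (p + t) q + t * bip_growth a b (q + t) p + 2 * t * t * n ^ (a + b - 2)"
proof -
  have "bip_count a b p (q + t) + t * bip_growth a b p (q + t) \<le> bip_count a b (p + t) (q + t)"
    by (rule bip_count_add_ge[OF assms(1,2)])
  also have "\<dots> = bip_count a b (q + t) (p + t)" by (rule bip_count_commute)
  also have "\<dots> \<le> bip_count a b q (p + t) + t * bip_growth a b (q + t) (p + t)"
    by (rule bip_count_add_le[OF assms(1,2)])
  also have "\<dots> \<le> bip_count a b q (p + t) + t * (bip_growth a b (q + t) p + t * (2 * n ^ (a + b - 2)))"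
    by (intro add_mono mult_le_mono order_refl bip_growth_add_le assms) (use assms in auto)
  finally show ?thesis by (simp add: algebra_simps bip_count_commute[of a b q])
qed

lemma times_choose_pred: "1 \<le> k \<Longrightarrow> p * (p choose (k - 1)) = k * (p choose k) + (k - 1) * (p choose (k - 1))"
proof (cases k)
  case (Suc j)
  have "Suc j * (p choose Suc j) = (p - j) * (p choose j)"
    using binomial_absorb_comp[of p j] binomial_absorption[of j p] by (cases p) simp_all
  moreover have "(p - j) * (p choose j) + j * (p choose j) = p * (p choose j)"
    by (cases "j \<le> p") (simp_all add: binomial_eq_0 flip: add_mult_distrib)
  ultimately show ?thesis using Suc by simp
qed simp

text \<open>Up to lower order terms, \<open>bip_count\<close> is homogeneous of degree \<open>a + b\<close> in the part sizes, and
  this is Euler's identity for it.\<close>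

lemma bip_growth_weighted_le:
  assumes "1 \<le> a" "1 \<le> b" "p \<le> n" "q \<le> n"
  shows "p * bip_growth a b p q + q * bip_growth a b q p
    \<le> (a + b) * bip_count a b p q + 2 * (a + b) * n ^ (a + b - 1)"
proof -
  have *: "p * bip_growth a b p q \<le> a * ((p choose a) * (q choose b)) + b * ((p choose b) * (q choose a))
      + (a + b) * n ^ (a + b - 1)" if "p \<le> n" "q \<le> n" for p q
  proof -
    have "p * bip_growth a b p q
      = (p * (p choose (a - 1))) * (q choose b) + (p * (p choose (b - 1))) * (q choose a)"
      by (simp add: bip_growth_def algebra_simps)
    also have "\<dots> = a * ((p choose a) * (q choose b)) + b * ((p choose b) * (q choose a))
       + ((a - 1) * ((p choose (a - 1)) * (q choose b)) + (b - 1) * ((p choose (b - 1)) * (q choose a)))"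
      unfolding times_choose_pred[OF assms(1)] times_choose_pred[OF assms(2)] by (simp add: algebra_simps)
    also have "(a - 1) * ((p choose (a - 1)) * (q choose b)) + (b - 1) * ((p choose (b - 1)) * (q choose a))
       \<le> a * n ^ (a + b - 1) + b * n ^ (a + b - 1)"
      using choose_mult_choose_le[OF that, of "a - 1" b] choose_mult_choose_le[OF that, of "b - 1" a] assms
      by (intro add_mono mult_le_mono) (simp_all add: add.commute)
    finally show ?thesis by (simp add: algebra_simps)
  qed
  show ?thesis
    using *[OF assms(3,4)] *[OF assms(4,3)] by (simp add: bip_count_def algebra_simps)
qed

lemma choose_le_times_power: "1 \<le> k \<Longrightarrow> q \<le> n \<Longrightarrow> (q choose k) \<le> q * n ^ (k - 1)"
proof (cases k)
  case (Suc j)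
  assume "q \<le> n"
  then have "q ^ Suc j \<le> q * n ^ j" by (simp add: power_mono)
  then show ?thesis using order_trans[OF choose_le_power[of q "Suc j"]] Suc by simp
qed simp

lemma bip_count_le:
  assumes "1 \<le> a" "1 \<le> b" "p \<le> n" "q \<le> n"
  shows "bip_count a b p q \<le> 2 * q * n ^ (a + b - 1)"
proof -
  have "(p choose i) * (q choose j) \<le> q * n ^ (a + b - 1)" if "1 \<le> j" "i + j = a + b" for i j
  proof -
    have "(p choose i) * (q choose j) \<le> n ^ i * (q * n ^ (j - 1))"
      using choose_le_power[of p i] power_mono[OF assms(3), of i] choose_le_times_power[OF that(1) assms(4)]
      by (intro mult_le_mono) auto
    also have "\<dots> = q * n ^ (i + (j - 1))" by (simp add: power_add)
    also have "i + (j - 1) = a + b - 1" using that by simp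
    finally show ?thesis .
  qed
  from this[of b a] this[of a b] show ?thesis using assms by (simp add: bip_count_def)
qed

text \<open>At a maximum of \<open>bip_count\<close> on \<open>p + q = n\<close> both partial derivatives agree, and by Euler's
  identity they equal the average. Quantitatively: if the derivative for one part exceeded the
  average by a factor \<open>1 + \<alpha>\<close>, then the other one would be at most about the average, and moving a
  small linear number of vertices between the parts would gain a positive proportion of \<open>n ^ (a + b)\<close>,
  which is more than the distance \<open>C * n ^ (a + b - 1)\<close> to the maximum allows.\<close>

lemma bip_growth_le_average:
  fixes c \<alpha> C :: real
  assumes ab: "1 \<le> a" "1 \<le> b" and pos: "0 < c" "0 < \<alpha>" "0 \<le> C"
  shows "\<exists>n0. \<forall>n\<ge>n0. \<forall>m p q. p + q = n \<longrightarrow>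
    (\<forall>p' q'. p' + q' = n \<longrightarrow> real (bip_count a b p' q') \<le> m) \<longrightarrow>
    c * real n ^ (a + b) \<le> m \<longrightarrow> m - C * real n ^ (a + b - 1) \<le> real (bip_count a b p q) \<longrightarrow>
    real (bip_growth a b p q) \<le> (1 + \<alpha>) * (real (a + b) * m / real n)"
proof -
  define r where "r = real (a + b)"
  define \<beta> where "\<beta> = \<alpha> * r * c"
  define K where "K = 8 * r / c"
  \<comment> \<open>A proportion \<open>\<theta>\<close> of the vertices will be moved: at most \<open>c / 4\<close>, so that the second part has
      enough of them, and small against \<open>\<beta>\<close>, so that the linear gain beats the quadratic loss.\<close>
  define \<theta> where "\<theta> = min (c / 4) (\<beta> / 8)"
  have rpos: "0 < r" using ab by (simp add: r_def)
  have bpos: "0 < \<beta>" using pos rpos by (simp add: \<beta>_def)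
  have tpos: "0 < \<theta>" using bpos pos by (simp add: \<theta>_def)
  obtain n0 :: nat where n0: "max 1 (max (2 * C / c) (max (2 / \<theta>) (max (4 * K / \<beta>) (4 * C / (\<theta> * \<beta>))))) < real n0"
    using reals_Archimedean2 by blast
  show ?thesis
  proof (rule exI[of _ n0], intro allI impI)
    fix n p q :: nat and m :: real
    assume n: "n0 \<le> n" and pq: "p + q = n"
      and max: "\<forall>p' q'. p' + q' = n \<longrightarrow> real (bip_count a b p' q') \<le> m"
      and m: "c * real n ^ (a + b) \<le> m" and near: "m - C * real n ^ (a + b - 1) \<le> real (bip_count a b p q)"
    define N where "N = real n"
    define w where "w = N ^ (a + b - 2)"
    define L where "L = r * m / N"
    define g1 where "g1 = real (bip_growth a b p q)"
    define g2 where "g2 = real (bip_growth a b q p)"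
    have "real n0 \<le> N" using n by (simp add: N_def)
    then have N: "1 < N" "2 * C / c < N" "2 / \<theta> < N" "4 * K / \<beta> < N" "4 * C / (\<theta> * \<beta>) < N"
      using n0 by auto
    have wpos: "0 < w" using N by (simp add: w_def)
    have pw: "real n ^ (a + b) = N * N * w" "real n ^ (a + b - 1) = N * w"
    proof -
      have "a + b = Suc (Suc (a + b - 2))" "a + b - 1 = Suc (a + b - 2)" using ab by auto
      then show "real n ^ (a + b) = N * N * w" "real n ^ (a + b - 1) = N * w"
        unfolding w_def N_def by (metis mult.assoc power_Suc)+
    qed
    have NL: "N * L = r * m" using N by (simp add: L_def)
    have "c * (N * N * w) * r \<le> m * r"
      using m rpos unfolding pw by (intro mult_right_mono) auto
    then have Lge: "r * c * (N * w) \<le> L"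
      using N by (simp add: L_def pos_le_divide_eq algebra_simps)
    have Lpos: "0 < L" using Lge rpos pos wpos N by (smt (verit) mult_pos_pos)
    have bl: "real (bip_count a b p q) \<le> 2 * real q * (N * w)"
      using bip_count_le[OF ab, of p n q] pq unfolding pw[symmetric]
      by (metis le_add1 le_add2 of_nat_le_iff of_nat_mult of_nat_numeral of_nat_power)
    \<comment> \<open>The second part is linear in size, since otherwise there would be too few bicliques.\<close>
    have "C * 2 \<le> c * N" using N(2) pos by (simp add: field_simps)
    then have "C * 2 * (N * w) \<le> c * N * (N * w)" using N wpos by (intro mult_right_mono) auto
    then have "c / 2 * N * (N * w) \<le> 2 * real q * (N * w)"
      using bl near m unfolding pw by (simp add: algebra_simps)
    then have q: "c / 4 * N \<le> real q"
      using wpos N by (simp add: mult_le_cancel_right)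
    have qpos: "0 < real q" using q pos N by (smt (verit) divide_pos_pos mult_pos_pos)
    have euler: "real p * g1 + real q * g2 \<le> r * m + 2 * r * (N * w)"
    proof -
      have "real p * g1 + real q * g2 \<le> r * real (bip_count a b p q) + 2 * r * (N * w)"
        using bip_growth_weighted_le[OF ab, of p n q] pq unfolding g1_def g2_def r_def pw[symmetric]
        by (metis (mono_tags, lifting) le_add1 le_add2 of_nat_add of_nat_le_iff of_nat_mult of_nat_numeral of_nat_power)
      moreover have "r * real (bip_count a b p q) \<le> r * m" using max pq rpos by auto
      ultimately show ?thesis by simp
    qed
    show "real (bip_growth a b p q) \<le> (1 + \<alpha>) * (real (a + b) * m / real n)"
    proof (rule ccontr)
      assume "\<not> ?thesis"
      then have g1: "(1 + \<alpha>) * L < g1" by (simp add: g1_def L_def r_def N_def)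
      have "real p * L \<le> real p * g1"
      proof (rule mult_left_mono)
        have "0 \<le> \<alpha> * L" using pos Lpos by simp
        then show "L \<le> g1" using g1 by (simp add: algebra_simps)
      qed simp
      moreover have "r * m = real p * L + real q * L"
        using NL pq by (simp add: N_def flip: distrib_right) auto
      ultimately have "real q * g2 \<le> real q * L + 2 * r * (N * w)"
        using euler by simp
      moreover have "2 * r * (N * w) \<le> real q * (K * w)"
      proof -
        have "2 * r * (N * w) = (c / 4 * N) * (K * w)" using pos by (simp add: K_def)
        also have "\<dots> \<le> real q * (K * w)"
          using q wpos rpos pos by (intro mult_right_mono) (auto simp: K_def)
        finally show ?thesis .
      qed
      ultimately have "real q * g2 \<le> real q * (L + K * w)" by (simp add: algebra_simps)
      then have g2: "g2 \<le> L + K * w" using qpos by simp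
      have "\<alpha> * (r * c * (N * w)) \<le> \<alpha> * L" using Lge pos by (intro mult_left_mono) auto
      then have diff: "(\<beta> * N - K) * w \<le> g1 - g2"
        using g1 g2 by (simp add: \<beta>_def algebra_simps)
      define t where "t = nat \<lfloor>\<theta> * N\<rfloor>"
      have t: "real t \<le> \<theta> * N" "\<theta> * N - 1 < real t" using tpos N by (auto simp: t_def)
      have "2 \<le> \<theta> * N" using N(3) tpos by (simp add: field_simps)
      then have t2: "\<theta> * N / 2 \<le> real t" using t by simp
      have "\<theta> * N \<le> c / 4 * N" using N by (intro mult_right_mono) (auto simp: \<theta>_def)
      then have "real t \<le> real q" using t q by simp
      then obtain q' where q': "q = q' + t" by (metis add.commute le_Suc_ex of_nat_le_iff)
      have "real (bip_count a b p q) + real t * g1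
          \<le> real (bip_count a b (p + t) q') + real t * g2 + 2 * real t * real t * w"
        using bip_count_move[OF ab, of p q' t n] pq q' unfolding g1_def g2_def w_def N_def
        by (metis (mono_tags, lifting) order_refl of_nat_add of_nat_le_iff of_nat_mult of_nat_numeral of_nat_power)
      moreover have "real (bip_count a b (p + t) q') \<le> m"
        using max pq q' by auto
      ultimately have "real t * (g1 - g2) \<le> C * (N * w) + 2 * real t * real t * w"
        using near unfolding pw by (simp add: algebra_simps)
      moreover have "real t * ((\<beta> * N - K) * w) \<le> real t * (g1 - g2)"
        using diff by (intro mult_left_mono) auto
      ultimately have "(real t * (\<beta> * N - K - 2 * real t)) * w \<le> (C * N) * w"
        by (simp add: algebra_simps)
      then have le: "real t * (\<beta> * N - K - 2 * real t) \<le> C * N" using wpos by simp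
      have "\<theta> * N \<le> \<beta> / 8 * N" using N by (intro mult_right_mono) (auto simp: \<theta>_def)
      moreover have "4 * K \<le> \<beta> * N" using N(4) bpos by (simp add: field_simps)
      ultimately have "\<beta> * N / 2 \<le> \<beta> * N - K - 2 * real t" using t by linarith
      then have "(\<theta> * N / 2) * (\<beta> * N / 2) \<le> real t * (\<beta> * N - K - 2 * real t)"
        using t2 bpos tpos N by (intro mult_mono) auto
      then have "\<theta> * \<beta> * N * N \<le> 4 * C * N" using le by (simp add: algebra_simps)
      then have "\<theta> * \<beta> * N \<le> 4 * C" using N by simp
      moreover have "4 * C < \<theta> * \<beta> * N" using N(5) tpos bpos by (simp add: field_simps)
      ultimately show False by simp
    qed
  qed
qed

definition complete_bip :: "'v set \<Rightarrow> 'v set \<Rightarrow> 'v \<Rightarrow> 'v \<Rightarrow> bool" where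
  "complete_bip P Q x y \<longleftrightarrow> x \<in> P \<and> y \<in> Q \<or> x \<in> Q \<and> y \<in> P"

definition bipartite_on :: "('v \<Rightarrow> 'v \<Rightarrow> bool) \<Rightarrow> 'v set \<Rightarrow> 'v set \<Rightarrow> bool" where
  "bipartite_on E P Q \<longleftrightarrow> P \<inter> Q = {} \<and> (\<forall>x\<in>P. \<forall>y\<in>P. \<not> E x y) \<and> (\<forall>x\<in>Q. \<forall>y\<in>Q. \<not> E x y)"

lemma bipartite_on_commute: "bipartite_on E P Q \<longleftrightarrow> bipartite_on E Q P"
  by (auto simp: bipartite_on_def)

lemma adjacency_complete_bip: "P \<inter> Q = {} \<Longrightarrow> adjacency (complete_bip P Q)"
  by (auto simp: adjacency_def symp_def irreflp_def complete_bip_def)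

lemma triangle_free_complete_bip: "P \<inter> Q = {} \<Longrightarrow> triangle_free (complete_bip P Q)"
  unfolding triangle_free_def complete_bip_def by blast

lemma card_bipartite_blocks:
  assumes "finite P" "finite Q" "P \<inter> Q = {}" "1 \<le> a"
  shows "card ({X. X \<subseteq> P \<and> card X = a} \<times> {Y. Y \<subseteq> Q \<and> card Y = b} \<union>
               {X. X \<subseteq> Q \<and> card X = a} \<times> {Y. Y \<subseteq> P \<and> card Y = b}) = bip_count a b (card P) (card Q)"
proof -
  have "{X. X \<subseteq> P \<and> card X = a} \<inter> {X. X \<subseteq> Q \<and> card X = a} = {}"
  proof (rule equals0I)
    fix X assume "X \<in> {X. X \<subseteq> P \<and> card X = a} \<inter> {X. X \<subseteq> Q \<and> card X = a}"
    then have "X = {}" "card X = a" using assms(3) by blast+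
    then show False using assms(4) by simp
  qed
  then have "({X. X \<subseteq> P \<and> card X = a} \<times> {Y. Y \<subseteq> Q \<and> card Y = b}) \<inter>
      ({X. X \<subseteq> Q \<and> card X = a} \<times> {Y. Y \<subseteq> P \<and> card Y = b}) = {}"
    unfolding Times_Int_Times by simp
  then show ?thesis
    using assms(1,2)
    by (simp add: card_Un_disjoint card_cartesian_product n_subsets bip_count_def)
qed

lemma bip_count_le_card_bicliques:
  assumes "finite V" "P \<subseteq> V" "Q \<subseteq> V" "P \<inter> Q = {}" "1 \<le> a"
  shows "bip_count a b (card P) (card Q) \<le> card (bicliques a b V (complete_bip P Q))"
proof -
  have "finite P" "finite Q" using assms finite_subset by blast+
  from card_bipartite_blocks[OF this assms(4,5), of b]
  have "bip_count a b (card P) (card Q) =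
      card ({X. X \<subseteq> P \<and> card X = a} \<times> {Y. Y \<subseteq> Q \<and> card Y = b} \<union>
            {X. X \<subseteq> Q \<and> card X = a} \<times> {Y. Y \<subseteq> P \<and> card Y = b})" by simp
  also have "\<dots> \<le> card (bicliques a b V (complete_bip P Q))"
  proof (rule card_mono[OF finite_bicliques[OF assms(1)]], rule subsetI)
    fix p
    assume p: "p \<in> {X. X \<subseteq> P \<and> card X = a} \<times> {Y. Y \<subseteq> Q \<and> card Y = b} \<union>
            {X. X \<subseteq> Q \<and> card X = a} \<times> {Y. Y \<subseteq> P \<and> card Y = b}"
    obtain X Y where "p = (X, Y)" by fastforce
    with p assms(2,3) show "p \<in> bicliques a b V (complete_bip P Q)"
      by (simp add: mem_bicliques complete_bip_def) blast
  qed
  finally show ?thesis .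
qed

lemma biclique_in_bipartite:
  assumes "adjacency E" "bipartite_on E P Q" "(X, Y) \<in> bicliques a b V E" "X \<union> Y \<subseteq> P \<union> Q"
    "1 \<le> a" "1 \<le> b"
  shows "X \<subseteq> P \<and> Y \<subseteq> Q \<or> X \<subseteq> Q \<and> Y \<subseteq> P"
proof -
  have E: "E x y" if "x \<in> X" "y \<in> Y" for x y using that assms(3) by (auto simp: mem_bicliques)
  have "X \<noteq> {}" "Y \<noteq> {}" using assms(3,5,6) by (auto simp: mem_bicliques)
  then obtain x0 y0 where xy: "x0 \<in> X" "y0 \<in> Y" by blast
  show ?thesis
  proof (cases "x0 \<in> P")
    case True
    then have "Y \<subseteq> Q" using E xy assms(2,4) unfolding bipartite_on_def by blast
    then have "X \<subseteq> P" using E xy assms(2,4) unfolding bipartite_on_def by blast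
    then show ?thesis using \<open>Y \<subseteq> Q\<close> by blast
  next
    case False
    then have "Y \<subseteq> P" using E xy assms(2,4) unfolding bipartite_on_def by blast
    then have "X \<subseteq> Q" using E xy assms(2,4) unfolding bipartite_on_def by blast
    then show ?thesis using \<open>Y \<subseteq> P\<close> by blast
  qed
qed

text \<open>The set \<open>Z\<close> of vertices outside of the bipartition contributes an error of lower order as long
  as its size is bounded.\<close>

lemma card_bicliques_bipartite_le:
  assumes V: "finite V" and E: "adjacency E" and ab: "1 \<le> a" "1 \<le> b" and Z: "finite Z"
    and PQ: "P \<union> Q = V - Z" "bipartite_on E P Q"
  shows "card (bicliques a b V E)
    \<le> bip_count a b (card P) (card Q) + 2 * card Z * card V ^ (a + b - 1)"
proof -
  let ?Z = "{(X, Y) \<in> bicliques a b V E. (X \<union> Y) \<inter> Z \<noteq> {}}"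
  let ?B = "{X. X \<subseteq> P \<and> card X = a} \<times> {Y. Y \<subseteq> Q \<and> card Y = b} \<union>
            {X. X \<subseteq> Q \<and> card X = a} \<times> {Y. Y \<subseteq> P \<and> card Y = b}"
  have fin: "finite P" "finite Q" using PQ V by (metis finite_Diff finite_Un)+
  have finZ: "finite ?Z" by (rule finite_subset[OF _ finite_bicliques[OF V]]) auto
  have "bicliques a b V E \<subseteq> ?B \<union> ?Z"
  proof
    fix p assume p: "p \<in> bicliques a b V E"
    obtain X Y where XY: "p = (X, Y)" by fastforce
    show "p \<in> ?B \<union> ?Z"
    proof (cases "(X \<union> Y) \<inter> Z = {}")
      case True
      have m: "X \<subseteq> V" "Y \<subseteq> V" "card X = a" "card Y = b" using p XY by (auto simp: mem_bicliques)
      have "X \<union> Y \<subseteq> P \<union> Q" using m True PQ by blast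
      then show ?thesis
        using biclique_in_bipartite[OF E PQ(2), of X Y a b V] p ab m unfolding XY by simp
    next
      case False
      then show ?thesis using p unfolding XY by simp
    qed
  qed
  then have "card (bicliques a b V E) \<le> card (?B \<union> ?Z)"
    by (rule card_mono[rotated]) (use fin finZ in simp)
  also have "\<dots> \<le> card ?B + card ?Z" by (rule card_Un_le)
  also have "\<dots> \<le> bip_count a b (card P) (card Q) + 2 * card Z * card V ^ (a + b - 1)"
    using card_bipartite_blocks[OF fin _ ab(1), of b] PQ(2) card_bicliques_meeting[OF V ab Z]
    unfolding bipartite_on_def by (intro add_mono) simp_all
  finally show ?thesis .
qed

lemma card_subsets_through_vertex_le:
  assumes "finite P"
  shows "card {X. X \<subseteq> P \<and> card X = k \<and> v \<in> X} \<le> (card P choose (k - 1))"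
proof -
  have "card {X. X \<subseteq> P \<and> card X = k \<and> v \<in> X} \<le> card {X. X \<subseteq> P \<and> card X = k - 1}"
  proof (rule card_inj_on_le[where f = "\<lambda>X. X - {v}"])
    show "inj_on (\<lambda>X. X - {v}) {X. X \<subseteq> P \<and> card X = k \<and> v \<in> X}"
    proof (rule inj_onI)
      fix X Y assume "X \<in> {X. X \<subseteq> P \<and> card X = k \<and> v \<in> X}" "Y \<in> {X. X \<subseteq> P \<and> card X = k \<and> v \<in> X}"
        "X - {v} = Y - {v}"
      then show "X = Y" by blast
    qed
    show "(\<lambda>X. X - {v}) ` {X. X \<subseteq> P \<and> card X = k \<and> v \<in> X} \<subseteq> {X. X \<subseteq> P \<and> card X = k - 1}"
      by auto
  qed (use assms in simp)
  then show ?thesis by (simp add: n_subsets[OF assms])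
qed

text \<open>A biclique that contains \<open>v\<close> and avoids \<open>Z\<close> has one side in \<open>P\<close>, containing \<open>v\<close>, and the other
  side among the neighbours of \<open>v\<close> in \<open>Q\<close>.\<close>

lemma card_bicliques_at_bipartite_le:
  assumes V: "finite V" and E: "adjacency E" and ab: "1 \<le> a" "1 \<le> b" and Z: "finite Z"
    and PQ: "P \<union> Q = V - Z" "bipartite_on E P Q" and v: "v \<in> P"
  shows "card (bicliques_at a b V E v)
    \<le> bip_growth a b (card P) (card {w \<in> Q. E v w}) + 4 * card Z * card V ^ (a + b - 2)"
proof -
  let ?N = "{w \<in> Q. E v w}"
  let ?Z = "{(X, Y) \<in> bicliques_at a b V E v. (X \<union> Y) \<inter> Z \<noteq> {}}"
  let ?B1 = "{X. X \<subseteq> P \<and> card X = a \<and> v \<in> X} \<times> {Y. Y \<subseteq> ?N \<and> card Y = b}"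
  let ?B2 = "{X. X \<subseteq> ?N \<and> card X = a} \<times> {Y. Y \<subseteq> P \<and> card Y = b \<and> v \<in> Y}"
  have fin: "finite P" "finite Q" using PQ V by (metis finite_Diff finite_Un)+
  have vQ: "v \<notin> Q" using v PQ(2) by (auto simp: bipartite_on_def)
  have finZ: "finite ?Z" by (rule finite_subset[OF _ finite_bicliques_at[OF V]]) auto
  have "bicliques_at a b V E v \<subseteq> (?B1 \<union> ?B2) \<union> ?Z"
  proof
    fix p assume p: "p \<in> bicliques_at a b V E v"
    obtain X Y where XY: "p = (X, Y)" by fastforce
    show "p \<in> (?B1 \<union> ?B2) \<union> ?Z"
    proof (cases "(X \<union> Y) \<inter> Z = {}")
      case True
      have p': "(X, Y) \<in> bicliques a b V E" "v \<in> X \<union> Y"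
        using p XY by (auto simp: mem_bicliques_at)
      then have m: "X \<subseteq> V" "Y \<subseteq> V" "card X = a" "card Y = b" "\<forall>x\<in>X. \<forall>y\<in>Y. E x y"
        by (auto simp: mem_bicliques)
      have "X \<union> Y \<subseteq> P \<union> Q" using m True PQ by blast
      then consider "X \<subseteq> P \<and> Y \<subseteq> Q" | "X \<subseteq> Q \<and> Y \<subseteq> P"
        using biclique_in_bipartite[OF E PQ(2), of X Y a b V] p' ab by blast
      then show ?thesis
      proof cases
        case 1
        then have "v \<in> X" using p'(2) vQ by blast
        then have "Y \<subseteq> ?N" using 1 m(5) by blast
        then have "p \<in> ?B1" using \<open>v \<in> X\<close> 1 m unfolding XY by simp
        then show ?thesis by (rule UnI1[OF UnI1])
      next
        case 2
        then have "v \<in> Y" using p'(2) vQ by blast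
        then have "X \<subseteq> ?N" using 2 m(5) adjacency_sym[OF E] by blast
        then have "p \<in> ?B2" using \<open>v \<in> Y\<close> 2 m unfolding XY by simp
        then show ?thesis by (rule UnI1[OF UnI2])
      qed
    next
      case False
      then have "p \<in> ?Z" using p unfolding XY by simp
      then show ?thesis by (rule UnI2)
    qed
  qed
  then have "card (bicliques_at a b V E v) \<le> card ((?B1 \<union> ?B2) \<union> ?Z)"
    by (rule card_mono[rotated]) (use fin finZ in simp)
  also have "\<dots> \<le> (card ?B1 + card ?B2) + card ?Z"
    by (rule order_trans[OF card_Un_le]) (simp add: card_Un_le)
  also have "card ?B1 \<le> (card P choose (a - 1)) * (card ?N choose b)"
    using card_subsets_through_vertex_le[OF fin(1), of a v] fin(2)
    by (simp add: card_cartesian_product n_subsets)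
  also have "card ?B2 \<le> (card P choose (b - 1)) * (card ?N choose a)"
    using card_subsets_through_vertex_le[OF fin(1), of b v] fin(2)
    by (simp add: card_cartesian_product n_subsets mult.commute)
  also have "card ?Z \<le> 4 * card Z * card V ^ (a + b - 2)"
    by (rule card_bicliques_at_meeting[OF V Z]) (use v PQ(1) in blast)
  finally show ?thesis by (simp add: bip_growth_def)
qed

lemma choose_proportion_le:
  assumes "1 \<le> j" "k \<le> q"
  shows "q * (k choose j) \<le> k * (q choose j)"
proof -
  obtain i where j: "j = Suc i" using assms(1) by (cases j) auto
  have "j * (q * (k choose j)) = q * (k * ((k - 1) choose i))"
    using binomial_absorption[of i k] by (simp add: j algebra_simps)
  also have "\<dots> \<le> q * (k * ((q - 1) choose i))"
    by (intro mult_le_mono binomial_right_mono order_refl) (use assms in auto)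
  also have "\<dots> = j * (k * (q choose j))"
    using binomial_absorption[of i q] by (simp add: j algebra_simps)
  finally show ?thesis using assms(1) by (simp only: mult_le_cancel1)
qed

text \<open>A vertex that misses a proportion of the opposite part loses at least this proportion of its
  bicliques.\<close>

lemma bip_growth_proportion_le:
  assumes "1 \<le> a" "1 \<le> b" "k \<le> q"
  shows "q * bip_growth a b p k \<le> k * bip_growth a b p q"
proof -
  have "q * bip_growth a b p k
      = (p choose (a - 1)) * (q * (k choose b)) + (p choose (b - 1)) * (q * (k choose a))"
    by (simp add: bip_growth_def algebra_simps)
  also have "\<dots> \<le> (p choose (a - 1)) * (k * (q choose b)) + (p choose (b - 1)) * (k * (q choose a))"
    by (intro add_mono mult_le_mono order_refl choose_proportion_le assms)
  also have "\<dots> = k * bip_growth a b p q" by (simp add: bip_growth_def algebra_simps)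
  finally show ?thesis .
qed

section \<open>Vertices in an average number of bicliques\<close>

text \<open>The average number of bicliques through a vertex, if there are \<open>m\<close> bicliques altogether.\<close>

definition fair_share :: "nat \<Rightarrow> nat \<Rightarrow> nat \<Rightarrow> real \<Rightarrow> real" where
  "fair_share a b n m = real (a + b) * m / real n"

lemma power_split:
  fixes x :: real
  assumes "1 \<le> a" "1 \<le> b"
  shows "x ^ (a + b) = x * x * x ^ (a + b - 2)" "x ^ (a + b - 1) = x * x ^ (a + b - 2)"
proof -
  have "a + b = Suc (Suc (a + b - 2))" "a + b - 1 = Suc (a + b - 2)" using assms by auto
  then show "x ^ (a + b) = x * x * x ^ (a + b - 2)" "x ^ (a + b - 1) = x * x ^ (a + b - 2)"
    by (metis mult.assoc power_Suc)+
qed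

lemma fair_share_ge:
  assumes "1 \<le> a" "1 \<le> b" "0 < c" "c * real n ^ (a + b) \<le> m" "1 \<le> n"
  shows "2 * c * (real n * real n ^ (a + b - 2)) \<le> fair_share a b n m"
proof -
  have "0 \<le> c * real n ^ (a + b)" using assms(3) by simp
  then have "2 * (c * real n ^ (a + b)) \<le> real (a + b) * m"
    using assms by (intro mult_mono) auto
  then have "2 * c * (real n * real n * real n ^ (a + b - 2)) \<le> real (a + b) * m"
    unfolding power_split[OF assms(1,2)] by (simp add: mult.assoc)
  then show ?thesis
    using assms(5) by (simp add: fair_share_def pos_le_divide_eq algebra_simps)
qed

lemma degree_ge_of_fair_share:
  assumes ab: "1 \<le> a" "1 \<le> b" and V: "finite V" "V \<noteq> {}" and E: "adjacency E"
    and m: "0 < c" "c * real (card V) ^ (a + b) \<le> m"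
    and v: "fair_share a b (card V) m / 2 \<le> real (card (bicliques_at a b V E v))"
  shows "c / 4 * real (card V) \<le> real (card {w \<in> V. E v w})"
proof -
  define w where "w = real (card V) ^ (a + b - 2)"
  have n: "1 \<le> card V" using V by (simp add: Suc_le_eq card_gt_0_iff)
  have wpos: "0 < w" using n by (simp add: w_def)
  have "2 * c * (real (card V) * w) \<le> fair_share a b (card V) m"
    unfolding w_def by (rule fair_share_ge[OF ab m n])
  moreover have "real (card (bicliques_at a b V E v)) \<le> real (4 * card {w \<in> V. E v w} * card V ^ (a + b - 2))"
    using card_bicliques_at_le_degree[OF V(1) E ab] by (rule of_nat_mono)
  ultimately have "(c * real (card V)) * w \<le> (4 * real (card {w \<in> V. E v w})) * w"
    using v by (simp add: w_def)
  then show ?thesis using wpos by simp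
qed

text \<open>A vertex \<open>v\<close> of \<open>P\<close> with \<open>k\<close> neighbours in \<open>Q\<close> lies in at most about \<open>k / card Q\<close> times the
  number \<open>bip_growth a b (card P) (card Q)\<close> of bicliques, and that number is at most
  \<open>1 + \<epsilon>\<close> times the average. So if \<open>v\<close> lies in nearly the average number of bicliques, then \<open>k\<close> is
  nearly \<open>card Q\<close>. The bound \<open>3 * \<epsilon> * n\<close> comes from the bicliques through \<open>v\<close> itself and not from
  bounds for other vertices; this is why it can be restored in every step of an induction.\<close>

lemma few_nonneighbours:
  fixes c \<epsilon> C :: real
  assumes ab: "1 \<le> a" "1 \<le> b" and pos: "0 < c" "0 < \<epsilon>" "0 \<le> C"
  shows "\<exists>n0. \<forall>n\<ge>n0. \<forall>V E m Z P Q v. finite V \<longrightarrow> card V = n \<longrightarrow> adjacency E \<longrightarrow>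
    (\<forall>p q. p + q = n \<longrightarrow> real (bip_count a b p q) \<le> m) \<longrightarrow> c * real n ^ (a + b) \<le> m \<longrightarrow>
    m - C * real n ^ (a + b - 1) \<le> real (card (bicliques a b V E)) \<longrightarrow>
    finite Z \<longrightarrow> card Z \<le> s \<longrightarrow> P \<union> Q = V - Z \<longrightarrow> bipartite_on E P Q \<longrightarrow> v \<in> P \<longrightarrow>
    (1 - \<epsilon>) * fair_share a b n m \<le> real (card (bicliques_at a b V E v)) \<longrightarrow>
    real (card {w \<in> Q. \<not> E v w}) \<le> 3 * \<epsilon> * real n"
proof -
  have "0 \<le> C + 2 * real s" using pos by simp
  from bip_growth_le_average[OF ab pos(1,2) this] obtain n1 where
    n1: "\<And>n m p q. n1 \<le> n \<Longrightarrow> p + q = n \<Longrightarrow>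
    (\<forall>p' q'. p' + q' = n \<longrightarrow> real (bip_count a b p' q') \<le> m) \<Longrightarrow>
    c * real n ^ (a + b) \<le> m \<Longrightarrow> m - (C + 2 * real s) * real n ^ (a + b - 1) \<le> real (bip_count a b p q) \<Longrightarrow>
    real (bip_growth a b p q) \<le> (1 + \<epsilon>) * (real (a + b) * m / real n)" by meson
  obtain n0 :: nat where n0: "max 1 (max (real n1) (4 * real s / (c * \<epsilon>))) < real n0"
    using reals_Archimedean2 by blast
  show ?thesis
  proof (rule exI[of _ n0], intro allI impI)
    fix n :: nat and V :: "'a set" and E m Z P Q v
    assume n: "n0 \<le> n" and V: "finite V" "card V = n" and E: "adjacency E"
      and max: "\<forall>p q. p + q = n \<longrightarrow> real (bip_count a b p q) \<le> m" and m: "c * real n ^ (a + b) \<le> m"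
      and near: "m - C * real n ^ (a + b - 1) \<le> real (card (bicliques a b V E))"
      and Z: "finite Z" "card Z \<le> s" and PQ: "P \<union> Q = V - Z" "bipartite_on E P Q" and v: "v \<in> P"
      and share: "(1 - \<epsilon>) * fair_share a b n m \<le> real (card (bicliques_at a b V E v))"
    have "real n0 \<le> real n" using n by simp
    then have N: "1 < real n" "real n1 < real n" "4 * real s / (c * \<epsilon>) < real n" using n0 by auto
    define w where "w = real n ^ (a + b - 2)"
    define L where "L = fair_share a b n m"
    define p where "p = card P"
    define q where "q = card Q"
    define k where "k = card {w \<in> Q. E v w}"
    have wpos: "0 < w" using N by (simp add: w_def)
    have Lge: "2 * c * (real n * w) \<le> L"
      unfolding w_def L_def by (rule fair_share_ge[OF ab pos(1) m]) (use N in simp)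
    have Lpos: "0 < L" using Lge wpos N pos by (smt (verit) mult_pos_pos)
    have fin: "finite P" "finite Q" using PQ V by (metis finite_Diff finite_Un)+
    have "p + q = card (P \<union> Q)"
      using PQ(2) fin by (simp add: p_def q_def card_Un_disjoint bipartite_on_def)
    also have "\<dots> \<le> n" using PQ(1) V card_mono[of V "V - Z"] by auto
    finally have pq: "p + q \<le> n" .
    have kq: "k \<le> q" unfolding k_def q_def by (rule card_mono) (use fin in auto)
    \<comment> \<open>The first part is filled up to size \<open>n - q\<close> to obtain part sizes with sum \<open>n\<close>.\<close>
    have "card (bicliques a b V E) \<le> bip_count a b p q + 2 * s * n ^ (a + b - 1)"
      using card_bicliques_bipartite_le[OF V(1) E ab Z(1) PQ] Z(2) V(2) unfolding p_def q_def
      by (meson add_left_mono mult_le_mono order_refl order_trans)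
    also have "\<dots> \<le> bip_count a b (n - q) q + 2 * s * n ^ (a + b - 1)"
      by (intro add_right_mono bip_count_mono) (use pq in auto)
    finally have "real (card (bicliques a b V E))
        \<le> real (bip_count a b (n - q) q + 2 * s * n ^ (a + b - 1))" by (rule of_nat_mono) 
    then have "m - (C + 2 * real s) * real n ^ (a + b - 1) \<le> real (bip_count a b (n - q) q)"
      using near by (simp add: algebra_simps)
    then have "real (bip_growth a b (n - q) q) \<le> (1 + \<epsilon>) * L"
      unfolding L_def fair_share_def using n1[of n "n - q" q m] pq max m N(2) by simp
    moreover have "bip_growth a b p q \<le> bip_growth a b (n - q) q"
      by (rule bip_growth_mono) (use pq in auto)
    ultimately have g: "real (bip_growth a b p q) \<le> (1 + \<epsilon>) * L" by simp
    have "card (bicliques_at a b V E v) \<le> bip_growth a b p k + 4 * s * n ^ (a + b - 2)"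
      using card_bicliques_at_bipartite_le[OF V(1) E ab Z(1) PQ v] Z(2) V(2) unfolding p_def k_def
      by (meson add_left_mono mult_le_mono order_refl order_trans)
    then have "real (card (bicliques_at a b V E v)) \<le> real (bip_growth a b p k + 4 * s * n ^ (a + b - 2))"
      by (rule of_nat_mono)
    then have at: "(1 - \<epsilon>) * L - 4 * real s * w \<le> real (bip_growth a b p k)"
      using share by (simp add: L_def w_def)
    have "4 * real s \<le> \<epsilon> * (2 * c * real n)"
      using N pos by (simp add: field_simps) 
    then have "4 * real s * w \<le> \<epsilon> * (2 * c * real n) * w" using wpos by (intro mult_right_mono) auto
    also have "\<dots> \<le> \<epsilon> * L" using mult_left_mono[OF Lge, of \<epsilon>] pos by (simp add: mult.assoc)
    finally have "(1 - 2 * \<epsilon>) * L \<le> real (bip_growth a b p k)" using at by (simp add: algebra_simps)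
    then have "real q * ((1 - 2 * \<epsilon>) * L) \<le> real q * real (bip_growth a b p k)"
      by (intro mult_left_mono) auto
    also have "\<dots> \<le> real k * real (bip_growth a b p q)"
      using bip_growth_proportion_le[OF ab kq, of p] by (metis of_nat_le_iff of_nat_mult)
    also have "\<dots> \<le> real k * ((1 + \<epsilon>) * L)" using g by (intro mult_left_mono) auto
    finally have "(real q * (1 - 2 * \<epsilon>)) * L \<le> (real k * (1 + \<epsilon>)) * L" by (simp add: mult.assoc)
    then have "real q * (1 - 2 * \<epsilon>) \<le> real k * (1 + \<epsilon>)" using Lpos by simp
    moreover have "real k * \<epsilon> \<le> real q * \<epsilon>" using kq pos by simp
    moreover have "real q * \<epsilon> \<le> real n * \<epsilon>" using pq pos by simp
    ultimately have "real q - real k \<le> 3 * \<epsilon> * real n" by (simp add: algebra_simps)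
    moreover have "card {w \<in> Q. \<not> E v w} = q - k"
    proof -
      have "{w \<in> Q. \<not> E v w} = Q - {w \<in> Q. E v w}" by auto
      then show ?thesis using fin by (simp add: card_Diff_subset q_def k_def)
    qed
    ultimately show "real (card {w \<in> Q. \<not> E v w}) \<le> 3 * \<epsilon> * real n" using kq by simp
  qed
qed

section \<open>Stability of triangle-free graphs\<close>

text \<open>The number of nonneighbours is bounded absolutely and not as a proportion of the parts, so that
  the property passes to subsets of the parts without loss.\<close>

definition almost_complete :: "real \<Rightarrow> ('v \<Rightarrow> 'v \<Rightarrow> bool) \<Rightarrow> 'v set \<Rightarrow> 'v set \<Rightarrow> bool" where
  "almost_complete d E P Q \<longleftrightarrow>
     (\<forall>v\<in>P. real (card {w \<in> Q. \<not> E v w}) \<le> d) \<and> (\<forall>v\<in>Q. real (card {w \<in> P. \<not> E v w}) \<le> d)"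

lemma almost_complete_mono:
  assumes "almost_complete d E P Q" "finite P" "finite Q" "P' \<subseteq> P" "Q' \<subseteq> Q"
    "\<And>x y. x \<in> P' \<Longrightarrow> y \<in> Q' \<Longrightarrow> E x y \<Longrightarrow> F x y" "\<And>x y. x \<in> Q' \<Longrightarrow> y \<in> P' \<Longrightarrow> E x y \<Longrightarrow> F x y"
  shows "almost_complete d F P' Q'"
  unfolding almost_complete_def
proof safe
  fix v assume v: "v \<in> P'"
  have "card {w \<in> Q'. \<not> F v w} \<le> card {w \<in> Q. \<not> E v w}"
    by (rule card_mono) (use assms v in auto)
  then show "real (card {w \<in> Q'. \<not> F v w}) \<le> d"
    using assms(1,4) v unfolding almost_complete_def by (meson of_nat_mono order_trans subsetD)
next
  fix v assume v: "v \<in> Q'"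
  have "card {w \<in> P'. \<not> F v w} \<le> card {w \<in> P. \<not> E v w}"
    by (rule card_mono) (use assms v in auto)
  then show "real (card {w \<in> P'. \<not> F v w}) \<le> d"
    using assms(1,5) v unfolding almost_complete_def by (meson of_nat_mono order_trans subsetD)
qed

definition twin_pairs :: "'v set \<Rightarrow> ('v \<Rightarrow> 'v \<Rightarrow> bool) \<Rightarrow> ('v \<times> 'v) set" where
  "twin_pairs V E = {(x, y) \<in> V \<times> V. E x = E y}"

lemma reattach_twin:
  assumes E: "adjacency E" and nadj: "\<not> E u v" and y: "E y = E v" "y \<noteq> u"
  shows "reattach u {w. E v w} E u = reattach u {w. E v w} E y"
proof
  fix z
  have "\<not> E v u" using nadj adjacency_sym[OF E] by blast
  moreover have "\<not> E v y" using y adjacency_irrefl[OF E] by metis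
  ultimately show "reattach u {w. E v w} E u z = reattach u {w. E v w} E y z"
    using y by (auto simp: reattach_def)
qed

lemma reattach_twins:
  assumes E: "adjacency E" and xy: "E x = E y" "x \<noteq> u" "y \<noteq> u"
  shows "reattach u {w. E v w} E x = reattach u {w. E v w} E y"
proof
  fix z
  have "E v x = E v y" using xy(1) adjacency_sym[OF E] by metis
  then show "reattach u {w. E v w} E x z = reattach u {w. E v w} E y z"
    using xy by (auto simp: reattach_def)
qed

text \<open>The number of twin pairs breaks ties in the symmetrization process: it increases if a vertex
  moves to a twin class that is at least as large as its own.\<close>

lemma card_twin_pairs_reattach:
  assumes V: "finite V" "u \<in> V" "v \<in> V" and E: "adjacency E" and nadj: "\<not> E u v" and ne: "E u \<noteq> E v"
    and le: "card {y \<in> V. E y = E u} \<le> card {y \<in> V. E y = E v}"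
  shows "card (twin_pairs V E) < card (twin_pairs V (reattach u {w. E v w} E))"
proof -
  let ?A = "{y \<in> V. E y = E u}" and ?B = "{y \<in> V. E y = E v}"
  let ?T = "{(x, y) \<in> (V - {u}) \<times> (V - {u}). E x = E y}"
  have "finite ?T" by (rule finite_subset[of _ "V \<times> V"]) (use V(1) in auto)
  then have fin: "finite ?A" "finite ?B" "finite ?T" using V(1) by simp_all
  have uA: "u \<in> ?A" and uB: "u \<notin> ?B" using V ne by auto
  have "twin_pairs V E \<subseteq> ?T \<union> (({u} \<times> ?A) \<union> ((?A - {u}) \<times> {u}))"
    by (auto simp: twin_pairs_def)
  then have "card (twin_pairs V E) \<le> card (?T \<union> (({u} \<times> ?A) \<union> ((?A - {u}) \<times> {u})))"
    by (rule card_mono[rotated]) (use fin in simp)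
  also have "\<dots> \<le> card ?T + card (({u} \<times> ?A) \<union> ((?A - {u}) \<times> {u}))" by (rule card_Un_le)
  also have "\<dots> \<le> card ?T + (card ({u} \<times> ?A) + card ((?A - {u}) \<times> {u}))"
    by (rule add_left_mono[OF card_Un_le])
  also have "\<dots> = card ?T + (card ?A + (card ?A - 1))"
    using uA fin by (simp add: card_cartesian_product)
  also have "\<dots> < card ?T + (card ?B + card ?B)"
  proof -
    have "0 < card ?A" using uA fin by (metis card_gt_0_iff empty_iff)
    then show ?thesis using le by linarith
  qed
  also have "\<dots> = card ?T + (card ({u} \<times> ?B) + card (?B \<times> {u}))"
    by (simp add: card_cartesian_product)
  also have "\<dots> = card (?T \<union> (({u} \<times> ?B) \<union> (?B \<times> {u})))"
  proof -
    have "({u} \<times> ?B) \<inter> (?B \<times> {u}) = {}" using uB by auto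
    moreover have "?T \<inter> (({u} \<times> ?B) \<union> (?B \<times> {u})) = {}" by auto
    ultimately show ?thesis using fin by (simp add: card_Un_disjoint)
  qed
  also have "\<dots> \<le> card (twin_pairs V (reattach u {w. E v w} E))"
  proof (rule card_mono)
    show "finite (twin_pairs V (reattach u {w. E v w} E))"
      by (rule finite_subset[of _ "V \<times> V"]) (use V in \<open>auto simp: twin_pairs_def\<close>)
    show "?T \<union> (({u} \<times> ?B) \<union> (?B \<times> {u})) \<subseteq> twin_pairs V (reattach u {w. E v w} E)"
    proof (intro Un_least subsetI)
      fix p assume "p \<in> ?T"
      then show "p \<in> twin_pairs V (reattach u {w. E v w} E)"
        using reattach_twins[OF E, of _ _ u v] by (auto simp: twin_pairs_def)
    next
      fix p assume "p \<in> {u} \<times> ?B"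
      then show "p \<in> twin_pairs V (reattach u {w. E v w} E)"
        using reattach_twin[OF E nadj] uB V by (cases p) (auto simp: twin_pairs_def)
    next
      fix p assume "p \<in> ?B \<times> {u}"
      then show "p \<in> twin_pairs V (reattach u {w. E v w} E)"
        using reattach_twin[OF E nadj, THEN sym] uB V by (cases p) (auto simp: twin_pairs_def)
    qed
  qed
  finally show ?thesis .
qed

lemma card_bicliques_clone_nonadjacent:
  assumes "finite V" "u \<in> V" "adjacency E" "u \<noteq> v" "\<not> E u v"
  shows "card (bicliques a b V E) + card (bicliques_at a b V E v)
    \<le> card (bicliques a b V (reattach u {w. E v w} E)) + card (bicliques_at a b V E u)"
proof -
  have "{(X, Y) \<in> bicliques_at a b V E v. (X \<union> Y) \<inter> {} = {} \<and> (u \<in> X \<union> Y \<longrightarrow> \<not> E u v)}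
      = bicliques_at a b V E v" using assms(5) by auto
  then show ?thesis
    using card_bicliques_reattach[OF assms(1-4), of "{}" "{w. E v w}" a b] by simp
qed

text \<open>Without assuming \<open>u\<close> and \<open>v\<close> to be nonadjacent, the error comes from bicliques through \<open>v\<close> that
  also contain \<open>u\<close> or an element of \<open>R\<close>.\<close>

lemma card_bicliques_clone:
  assumes V: "finite V" "u \<in> V" and E: "adjacency E" and uv: "u \<noteq> v" and R: "finite R" "v \<notin> R"
  shows "card (bicliques a b V E) + card (bicliques_at a b V E v)
    \<le> card (bicliques a b V (reattach u ({w. E v w} - R) E)) + card (bicliques_at a b V E u)
      + 4 * (card R + 1) * card V ^ (a + b - 2)"
proof -
  let ?S = "{(X, Y) \<in> bicliques_at a b V E v. (X \<union> Y) \<inter> R = {} \<and> (u \<in> X \<union> Y \<longrightarrow> \<not> E u v)}"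
  let ?M = "{(X, Y) \<in> bicliques_at a b V E v. (X \<union> Y) \<inter> insert u R \<noteq> {}}"
  have fin: "finite ?S" "finite ?M"
    by (rule finite_subset[OF _ finite_bicliques_at[OF V(1)]]; auto)+
  have "bicliques_at a b V E v \<subseteq> ?S \<union> ?M" by auto
  then have "card (bicliques_at a b V E v) \<le> card (?S \<union> ?M)"
    by (rule card_mono[rotated]) (use fin in simp)
  also have "\<dots> \<le> card ?S + card ?M" by (rule card_Un_le)
  also have "card ?M \<le> 4 * card (insert u R) * card V ^ (a + b - 2)"
    by (rule card_bicliques_at_meeting) (use V R uv in auto)
  also have "\<dots> \<le> 4 * (card R + 1) * card V ^ (a + b - 2)"
    using card_insert_le_m1[of "card R + 1" R u] R(1) by (intro mult_le_mono) (auto simp: card_insert_if)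
  finally have "card (bicliques_at a b V E v) \<le> card ?S + 4 * (card R + 1) * card V ^ (a + b - 2)"
    by simp
  moreover have "card (bicliques a b V E) + card ?S
     \<le> card (bicliques a b V (reattach u ({w. E v w} - R) E)) + card (bicliques_at a b V E u)"
    by (rule card_bicliques_reattach[OF V E uv]) auto
  ultimately show ?thesis by linarith
qed

lemma reattach_other: "x \<noteq> u \<Longrightarrow> y \<noteq> u \<Longrightarrow> reattach u W E x y = E x y"
  by (simp add: reattach_def)

lemma bipartite_on_insert:
  assumes E: "adjacency E" and F: "bipartite_on F P Q" "\<And>x y. x \<noteq> u \<Longrightarrow> y \<noteq> u \<Longrightarrow> F x y = E x y"
    and n: "\<forall>x\<in>P - {u}. \<not> E u x"
  shows "bipartite_on E (insert u P) (Q - {u})"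
  unfolding bipartite_on_def
proof (intro conjI ballI)
  show "insert u P \<inter> (Q - {u}) = {}" using F(1) by (auto simp: bipartite_on_def)
next
  fix x y assume xy: "x \<in> insert u P" "y \<in> insert u P"
  show "\<not> E x y"
  proof (cases "x = u \<or> y = u")
    case True
    then show ?thesis using xy n adjacency_irrefl[OF E] adjacency_sym[OF E] by blast
  next
    case False
    then show ?thesis using xy F unfolding bipartite_on_def by blast
  qed
next
  fix x y assume "x \<in> Q - {u}" "y \<in> Q - {u}"
  then show "\<not> E x y" using F unfolding bipartite_on_def by blast
qed

text \<open>Here \<open>F\<close> and \<open>E\<close> differ only in the neighbourhood of \<open>u\<close>. If \<open>u\<close> had a neighbour \<open>x\<close> in \<open>P\<close>
  and a neighbour \<open>y\<close> in \<open>Q\<close>, then its neighbours in \<open>Q\<close> would be nonneighbours of \<open>x\<close> and those in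
  \<open>P\<close> nonneighbours of \<open>y\<close>, so its degree would be small.\<close>

lemma exists_placement:
  assumes V: "finite V" "u \<in> V" and E: "adjacency E" "triangle_free E"
    and F: "\<And>x y. x \<noteq> u \<Longrightarrow> y \<noteq> u \<Longrightarrow> F x y = E x y"
    and Z: "Z \<subseteq> V" "u \<notin> Z" and PQ: "P \<union> Q = V - Z" "bipartite_on F P Q" "almost_complete d F P Q"
    and deg: "2 * d + real (card Z) < real (card {w \<in> V. E u w})"
  obtains P' Q' where "P' \<union> Q' = V - Z" "bipartite_on E P' Q'"
proof -
  have fin: "finite P" "finite Q" "finite Z" using PQ(1) V Z by (metis finite_Diff finite_Un finite_subset)+
  have d: "0 \<le> d"
  proof -
    have "u \<in> P \<union> Q" using PQ(1) V Z by blast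
    then show ?thesis using PQ(3) unfolding almost_complete_def by (meson UnE of_nat_0_le_iff order_trans)
  qed
  have "(\<forall>x\<in>P - {u}. \<not> E u x) \<or> (\<forall>x\<in>Q - {u}. \<not> E u x)"
  proof (rule ccontr)
    assume "\<not> ?thesis"
    then obtain x y where xy: "x \<in> P - {u}" "E u x" "y \<in> Q - {u}" "E u y" by blast
    have "{w \<in> Q - {u}. E u w} \<subseteq> {w \<in> Q. \<not> F x w}"
      using xy E(2) F unfolding triangle_free_def by blast
    then have "card {w \<in> Q - {u}. E u w} \<le> card {w \<in> Q. \<not> F x w}"
      by (rule card_mono[rotated]) (use fin in simp)
    moreover have "real (card {w \<in> Q. \<not> F x w}) \<le> d" using PQ(3) xy by (auto simp: almost_complete_def)
    ultimately have Q: "real (card {w \<in> Q - {u}. E u w}) \<le> d" by linarith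
    have "{w \<in> P - {u}. E u w} \<subseteq> {w \<in> P. \<not> F y w}"
      using xy E(2) F unfolding triangle_free_def by blast
    then have "card {w \<in> P - {u}. E u w} \<le> card {w \<in> P. \<not> F y w}"
      by (rule card_mono[rotated]) (use fin in simp)
    moreover have "real (card {w \<in> P. \<not> F y w}) \<le> d" using PQ(3) xy by (auto simp: almost_complete_def)
    ultimately have P: "real (card {w \<in> P - {u}. E u w}) \<le> d" by linarith
    have "{w \<in> V. E u w} \<subseteq> {w \<in> P - {u}. E u w} \<union> ({w \<in> Q - {u}. E u w} \<union> Z)"
      using PQ(1) adjacency_irrefl[OF E(1)] by blast
    then have "card {w \<in> V. E u w} \<le> card ({w \<in> P - {u}. E u w} \<union> ({w \<in> Q - {u}. E u w} \<union> Z))"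
      by (rule card_mono[rotated]) (use fin in simp)
    also have "\<dots> \<le> card {w \<in> P - {u}. E u w} + (card {w \<in> Q - {u}. E u w} + card Z)"
      by (rule order_trans[OF card_Un_le add_left_mono[OF card_Un_le]])
    finally show False using P Q deg by linarith
  qed
  then show ?thesis
  proof
    assume "\<forall>x\<in>P - {u}. \<not> E u x"
    with E(1) PQ(2) F have "bipartite_on E (insert u P) (Q - {u})"
      by (rule bipartite_on_insert)
    then show ?thesis using that[of "insert u P" "Q - {u}"] PQ(1) V Z by blast
  next
    assume "\<forall>x\<in>Q - {u}. \<not> E u x"
    with E(1) PQ(2)[THEN bipartite_on_commute[THEN iffD1]] F
    have "bipartite_on E (insert u Q) (P - {u})"
      by (rule bipartite_on_insert)
    then show ?thesis
      using that[of "P - {u}" "insert u Q"] PQ(1) V Z bipartite_on_commute by blast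
  qed
qed

lemma bip_count_le_of_triangle_free_bound:
  assumes "finite V" "1 \<le> a"
    and "\<forall>F. adjacency F \<longrightarrow> triangle_free F \<longrightarrow> real (card (bicliques a b V F)) \<le> m"
    and "p + q = card V"
  shows "real (bip_count a b p q) \<le> m"
proof -
  obtain P where P: "P \<subseteq> V" "card P = p"
    using obtain_subset_with_card_n[of p V] assms(4) by auto
  have Q: "card (V - P) = q"
    using P assms(1,4) by (simp add: card_Diff_subset finite_subset)
  have disj: "P \<inter> (V - P) = {}" by auto
  have "bip_count a b p q \<le> card (bicliques a b V (complete_bip P (V - P)))"
    using bip_count_le_card_bicliques[OF assms(1) P(1) Diff_subset disj assms(2), of b] P Q by simp
  also have "real \<dots> \<le> m"
    using assms(3) adjacency_complete_bip[OF disj] triangle_free_complete_bip[OF disj] by blast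
  finally show ?thesis by simp
qed

text \<open>The induction runs along the symmetrization process, from its end to its beginning; the measure
  is the number of bicliques, refined by the number of twin pairs. If a vertex lies in few
  bicliques, it is replaced by a copy of a vertex with the average number and joins the exceptional
  set \<open>Z\<close>; the gain in bicliques pays for one unit of \<open>s\<close>. Otherwise every vertex lies in nearly
  the average number, and two nonadjacent vertices that are not twins are made twins; after undoing
  this step the vertex is placed by \<open>exists_placement\<close>, and then \<open>few_nonneighbours\<close> restores the
  same bound for all vertices. If nonadjacent vertices are always twins, the graph is complete
  bipartite, since it has no triangle.\<close>

lemma triangle_free_stability:
  fixes c \<epsilon> :: real and V :: "'v set"
  assumes ab: "1 \<le> a" "1 \<le> b" and pos: "0 < c" "0 < \<epsilon>" and small: "48 * \<epsilon> \<le> c" "\<epsilon> \<le> 1 / 2"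
  shows "\<exists>n0. \<forall>n\<ge>n0. \<forall>(V :: 'v set) m. finite V \<longrightarrow> card V = n \<longrightarrow>
    (\<forall>F. adjacency F \<longrightarrow> triangle_free F \<longrightarrow> real (card (bicliques a b V F)) \<le> m) \<longrightarrow>
    c * real n ^ (a + b) \<le> m \<longrightarrow>
    (\<forall>E s. adjacency E \<longrightarrow> triangle_free E \<longrightarrow> s \<le> s0 \<longrightarrow>
      m - real s * (\<epsilon> * c * real n ^ (a + b - 1)) \<le> real (card (bicliques a b V E)) \<longrightarrow>
      (\<exists>Z P Q. Z \<subseteq> V \<and> card Z \<le> s \<and> P \<union> Q = V - Z \<and> bipartite_on E P Q
         \<and> almost_complete (3 * \<epsilon> * real n) E P Q))"
proof -
  define C where "C = real s0 * (\<epsilon> * c)"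
  define r where "r = real (a + b)"
  have "0 \<le> C" using pos by (simp add: C_def)
  from few_nonneighbours[OF ab pos this, of s0, where 'a = 'v] obtain n1 where
    fit: "\<And>n V E m Z P Q v. n1 \<le> n \<Longrightarrow> finite (V :: 'v set) \<Longrightarrow> card V = n \<Longrightarrow> adjacency E \<Longrightarrow>
    (\<forall>p q. p + q = n \<longrightarrow> real (bip_count a b p q) \<le> m) \<Longrightarrow> c * real n ^ (a + b) \<le> m \<Longrightarrow>
    m - C * real n ^ (a + b - 1) \<le> real (card (bicliques a b V E)) \<Longrightarrow>
    finite Z \<Longrightarrow> card Z \<le> s0 \<Longrightarrow> P \<union> Q = V - Z \<Longrightarrow> bipartite_on E P Q \<Longrightarrow> v \<in> P \<Longrightarrow>
    (1 - \<epsilon>) * fair_share a b n m \<le> real (card (bicliques_at a b V E v)) \<Longrightarrow>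
    real (card {w \<in> Q. \<not> E v w}) \<le> 3 * \<epsilon> * real n"
    by (elim exE) (rule that, blast)
  obtain n0 :: nat where
    n0: "max 1 (max (real n1) (max (8 * real s0 / c) ((r * C + 4) / (\<epsilon> * c)))) < real n0"
    using reals_Archimedean2 by blast
  show ?thesis
  proof (rule exI[of _ n0], intro allI impI)
    fix n :: nat and V :: "'v set" and m :: real and E :: "'v \<Rightarrow> 'v \<Rightarrow> bool" and s :: nat
    assume n: "n0 \<le> n" and V: "finite V" "card V = n"
      and max: "\<forall>F. adjacency F \<longrightarrow> triangle_free F \<longrightarrow> real (card (bicliques a b V F)) \<le> m"
      and m: "c * real n ^ (a + b) \<le> m"
      and E: "adjacency E" "triangle_free E"
      and s: "s \<le> s0" "m - real s * (\<epsilon> * c * real n ^ (a + b - 1)) \<le> real (card (bicliques a b V E))"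
    have "real n0 \<le> real n" using n by simp
    then have N: "1 < real n" "real n1 < real n" "8 * real s0 / c < real n" "(r * C + 4) / (\<epsilon> * c) < real n"
      using n0 by auto
    have Vne: "V \<noteq> {}" using V N by auto
    define w where "w = real n ^ (a + b - 2)"
    define L where "L = fair_share a b n m"
    have wpos: "0 < w" using N by (simp add: w_def)
    have pw: "real n ^ (a + b - 1) = real n * w" unfolding w_def by (rule power_split(2)[OF ab])
    have Lge: "2 * c * (real n * w) \<le> L"
      unfolding w_def L_def by (rule fair_share_ge[OF ab pos(1) m]) (use N in simp)
    have Lpos: "0 < L" using Lge wpos N pos by (smt (verit) mult_pos_pos)
    have bip: "\<forall>p q. p + q = n \<longrightarrow> real (bip_count a b p q) \<le> m"
      using bip_count_le_of_triangle_free_bound[OF V(1) ab(1) max] V(2) by simp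
    let ?S = "\<lambda>E. card (bicliques a b V E)"
    let ?d = "\<lambda>E v. card (bicliques_at a b V E v)"
    \<comment> \<open>There are at most \<open>n * n\<close> twin pairs, so bicliques outweigh them in this potential.\<close>
    define pot where "pot = (\<lambda>E. ?S E * (n * n + 1) + card (twin_pairs V E))"
    define M where "M = card (blocks a b V) * (n * n + 1) + n * n"
    have tw: "card (twin_pairs V F) \<le> n * n" for F
    proof -
      have "card (twin_pairs V F) \<le> card (V \<times> V)"
        by (rule card_mono) (use V in \<open>auto simp: twin_pairs_def\<close>)
      then show ?thesis using V(2) by (simp add: card_cartesian_product)
    qed
    have potM: "pot F \<le> M" for F
    proof -
      have "?S F \<le> card (blocks a b V)"
        by (rule card_mono[OF finite_blocks[OF V(1)]]) (auto simp: bicliques_def)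
      then show ?thesis unfolding pot_def M_def using tw[of F] by (intro add_mono mult_le_mono) auto
    qed
    have pot_less: "pot E < pot F" if "?S E < ?S F" for E F
    proof -
      have "pot E < Suc (?S E) * (n * n + 1)" using tw[of E] by (simp add: pot_def)
      also have "\<dots> \<le> ?S F * (n * n + 1)" by (rule mult_le_mono1) (use that in simp)
      finally show ?thesis by (simp add: pot_def)
    qed
    have cut: "m - C * real n ^ (a + b - 1) \<le> real (?S E)"
      if "s \<le> s0" "m - real s * (\<epsilon> * c * real n ^ (a + b - 1)) \<le> real (?S E)" for E and s :: nat
    proof -
      have "real s * (\<epsilon> * c * real n ^ (a + b - 1)) \<le> C * real n ^ (a + b - 1)"
        using that(1) pos unfolding C_def mult.assoc by (intro mult_right_mono) auto
      then show ?thesis using that(2) by linarith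
    qed
    show "\<exists>Z P Q. Z \<subseteq> V \<and> card Z \<le> s \<and> P \<union> Q = V - Z \<and> bipartite_on E P Q
         \<and> almost_complete (3 * \<epsilon> * real n) E P Q"
      using E s
    proof (induction "M - pot E" arbitrary: E s rule: less_induct)
      case less
      note E = less.prems(1,2) and s = less.prems(3,4)
      have IH: "\<exists>Z P Q. Z \<subseteq> V \<and> card Z \<le> t \<and> P \<union> Q = V - Z \<and> bipartite_on F P Q
         \<and> almost_complete (3 * \<epsilon> * real n) F P Q"
        if "pot E < pot F" "adjacency F" "triangle_free F" "t \<le> s0"
          "m - real t * (\<epsilon> * c * real n ^ (a + b - 1)) \<le> real (?S F)" for F t
        by (rule less.hyps[OF _ that(2-5)]) (use that(1) potM[of F] in linarith)
      have near: "m - C * real n ^ (a + b - 1) \<le> real (?S E)" by (rule cut[OF s])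
      have clone: "adjacency (reattach u {w. E v w} E)" "triangle_free (reattach u {w. E v w} E)" for u v
      proof -
        show "adjacency (reattach u {w. E v w} E)" by (rule adjacency_reattach[OF E(1)])
        show "triangle_free (reattach u {w. E v w} E)"
          by (rule triangle_free_reattach[OF E]) (use E(2) in \<open>unfold triangle_free_def, blast\<close>)
      qed
      consider (low) u where "u \<in> V" "real (?d E u) < (1 - \<epsilon>) * L"
        | (nontwins) u v where "u \<in> V" "v \<in> V" "\<not> E u v" "E u \<noteq> E v"
            "\<forall>x\<in>V. (1 - \<epsilon>) * L \<le> real (?d E x)"
        | (multipartite) "\<forall>u\<in>V. \<forall>v\<in>V. \<not> E u v \<longrightarrow> E u = E v"
        using not_le by blast
      then show ?case
      proof cases
        case low
        obtain v where v: "v \<in> V" "(a + b) * ?S E \<le> n * ?d E v"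
          using ex_vertex_with_average_bicliques[OF V(1) Vne E(1), of a b] V(2) by blast
        have "r * real (?S E) \<le> real n * real (?d E v)"
          using v(2) unfolding r_def by (metis of_nat_le_iff of_nat_mult)
        moreover have "r * (m - C * (real n * w)) \<le> r * real (?S E)"
          using near ab unfolding pw by (intro mult_left_mono) (auto simp: r_def)
        moreover have "r * m = real n * L" using N by (simp add: L_def fair_share_def r_def)
        ultimately have "real n * (L - r * C * w) \<le> real n * real (?d E v)"
          by (simp add: algebra_simps)
        then have dv: "L - r * C * w \<le> real (?d E v)" using N by simp
        have "r * C + 4 \<le> \<epsilon> * c * real n" using N(4) pos by (simp add: field_simps)
        then have "(r * C + 4) * w \<le> \<epsilon> * c * real n * w" using wpos by (intro mult_right_mono) auto
        moreover have "2 * (\<epsilon> * c * real n * w) \<le> \<epsilon> * L"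
          using mult_left_mono[OF Lge, of \<epsilon>] pos by (simp add: algebra_simps)
        ultimately have gain: "\<epsilon> * c * real n * w \<le> real (?d E v) - real (?d E u) - 4 * w"
          using dv low(2) by (simp add: algebra_simps)
        have gpos: "0 < \<epsilon> * c * real n * w" using pos N wpos by simp
        have uv: "u \<noteq> v" using gain gpos wpos by auto
        let ?F = "reattach u {w. E v w} E"
        have "?S E + ?d E v \<le> ?S ?F + ?d E u + 4 * n ^ (a + b - 2)"
          using card_bicliques_clone[OF V(1) low(1) E(1) uv, of "{}" a b] V(2) by simp
        then have "real (?S E + ?d E v) \<le> real (?S ?F + ?d E u + 4 * n ^ (a + b - 2))"
          by (rule of_nat_mono)
        then have up: "real (?S E) + \<epsilon> * c * real n * w \<le> real (?S ?F)"
          using gain by (simp add: w_def)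
        show ?thesis
        proof (cases s)
          case 0
          then have "m \<le> real (?S E)" using s(2) by simp
          moreover have "real (?S ?F) \<le> m" using max clone by blast
          ultimately show ?thesis using up gpos by linarith
        next
          case (Suc t)
          have "\<exists>Z P Q. Z \<subseteq> V \<and> card Z \<le> t \<and> P \<union> Q = V - Z \<and> bipartite_on ?F P Q
             \<and> almost_complete (3 * \<epsilon> * real n) ?F P Q"
          proof (rule IH[OF _ clone])
            show "pot E < pot ?F" by (rule pot_less) (use up gpos in linarith)
            show "t \<le> s0" using Suc s(1) by simp
            show "m - real t * (\<epsilon> * c * real n ^ (a + b - 1)) \<le> real (?S ?F)"
              using s(2) up unfolding Suc pw by (simp add: algebra_simps)
          qed
          then obtain Z P Q where Z: "Z \<subseteq> V" "card Z \<le> t" and PQ: "P \<union> Q = V - Z"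
            "bipartite_on ?F P Q" "almost_complete (3 * \<epsilon> * real n) ?F P Q" by blast
          have fin: "finite P" "finite Q" "finite Z"
            using PQ(1) V Z by (metis finite_Diff finite_Un finite_subset)+
          have "bipartite_on E (P - {u}) (Q - {u})"
            using PQ(2) reattach_other[of _ u _ "{w. E v w}" E] unfolding bipartite_on_def by blast
          moreover have "almost_complete (3 * \<epsilon> * real n) E (P - {u}) (Q - {u})"
            by (rule almost_complete_mono[OF PQ(3) fin(1,2)]) (auto simp: reattach_other)
          moreover have "card (insert u Z) \<le> s" using Z Suc fin by (simp add: card_insert_if)
          moreover have "insert u Z \<subseteq> V" using Z low by simp
          moreover have "(P - {u}) \<union> (Q - {u}) = V - insert u Z" using PQ(1) by blast
          ultimately show ?thesis by blast
        qed
      next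
        case nontwins
        have "\<exists>u v. u \<in> V \<and> v \<in> V \<and> \<not> E u v \<and> E u \<noteq> E v \<and> ?S E \<le> ?S (reattach u {w. E v w} E)
          \<and> pot E < pot (reattach u {w. E v w} E)"
        proof -
          have *: "?S E \<le> ?S (reattach u {w. E v w} E) \<and> pot E < pot (reattach u {w. E v w} E)"
            if uv: "u \<in> V" "v \<in> V" "\<not> E u v" "E u \<noteq> E v" and d: "?d E u \<le> ?d E v"
              and tie: "?d E u = ?d E v \<longrightarrow> card {y \<in> V. E y = E u} \<le> card {y \<in> V. E y = E v}" for u v
          proof -
            have "u \<noteq> v" using uv by auto
            then have S: "?S E + ?d E v \<le> ?S (reattach u {w. E v w} E) + ?d E u"
              using card_bicliques_clone_nonadjacent[OF V(1) uv(1) E(1) _ uv(3), of a b] by blast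
            then have le: "?S E \<le> ?S (reattach u {w. E v w} E)" using d by linarith
            moreover have "pot E < pot (reattach u {w. E v w} E)"
            proof (cases "?S E < ?S (reattach u {w. E v w} E)")
              case True
              then show ?thesis by (rule pot_less)
            next
              case False
              then have eq: "?S (reattach u {w. E v w} E) = ?S E" using le by simp
              then have "?d E u = ?d E v" using S d by simp
              then show ?thesis
                using card_twin_pairs_reattach[OF V(1) uv(1,2) E(1) uv(3,4)] tie eq
                by (simp add: pot_def)
            qed
            ultimately show ?thesis by blast
          qed
          have sym: "\<not> E v u" using nontwins(3) adjacency_sym[OF E(1)] by blast
          consider "?d E u < ?d E v" | "?d E v < ?d E u"
            | "?d E u = ?d E v" "card {y \<in> V. E y = E u} \<le> card {y \<in> V. E y = E v}"
            | "?d E u = ?d E v" "card {y \<in> V. E y = E v} \<le> card {y \<in> V. E y = E u}" by linarith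
          then have "?S E \<le> ?S (reattach u {w. E v w} E) \<and> pot E < pot (reattach u {w. E v w} E)
            \<or> ?S E \<le> ?S (reattach v {w. E u w} E) \<and> pot E < pot (reattach v {w. E u w} E)"
          proof cases
            case 1
            then show ?thesis using *[OF nontwins(1-4)] by simp
          next
            case 2
            then show ?thesis using *[OF nontwins(2,1) sym nontwins(4)[symmetric]] by simp
          next
            case 3
            then show ?thesis using *[OF nontwins(1-4)] by simp
          next
            case 4
            then show ?thesis using *[OF nontwins(2,1) sym nontwins(4)[symmetric]] by simp
          qed
          then show ?thesis using nontwins(1-3) nontwins(4) nontwins(4)[symmetric] sym by blast
        qed
        then obtain u v where uv: "u \<in> V" "v \<in> V" "?S E \<le> ?S (reattach u {w. E v w} E)"
          "pot E < pot (reattach u {w. E v w} E)" by blast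
        let ?F = "reattach u {w. E v w} E"
        have "m - real s * (\<epsilon> * c * real n ^ (a + b - 1)) \<le> real (?S ?F)" using s(2) uv(3) by linarith
        from IH[OF uv(4) clone s(1) this] obtain Z P Q where Z: "Z \<subseteq> V" "card Z \<le> s"
          and PQ: "P \<union> Q = V - Z" "bipartite_on ?F P Q" "almost_complete (3 * \<epsilon> * real n) ?F P Q" by blast
        have finZ: "finite Z" using Z V finite_subset by blast
        show ?thesis
        proof (cases "u \<in> Z")
          case True
          then have u: "u \<notin> P" "u \<notin> Q" using PQ(1) by blast+
          have fin: "finite P" "finite Q" using PQ(1) V by (metis finite_Diff finite_Un)+
          have "bipartite_on E P Q"
            using PQ(2) u reattach_other[of _ u _ "{w. E v w}" E] unfolding bipartite_on_def by metis
          moreover have "almost_complete (3 * \<epsilon> * real n) E P Q"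
            by (rule almost_complete_mono[OF PQ(3) fin]) (use u in \<open>auto simp: reattach_def split: if_splits\<close>)
          ultimately show ?thesis using Z PQ(1) by blast
        next
          case False
          have "c / 4 * real n \<le> real (card {w \<in> V. E u w})"
          proof -
            have "1 / 2 * L \<le> (1 - \<epsilon>) * L" using small Lpos by (intro mult_right_mono) auto
            also have "\<dots> \<le> real (?d E u)" using nontwins(5) uv(1) by blast
            finally show ?thesis
              using degree_ge_of_fair_share[OF ab V(1) Vne E(1) pos(1), of m u] m unfolding V(2) L_def by simp
          qed
          moreover have "2 * (3 * \<epsilon> * real n) \<le> c / 8 * real n"
            using mult_right_mono[OF small(1), of "real n"] by simp
          moreover have "real (card Z) < c / 8 * real n"
          proof -
            have "real s0 < c / 8 * real n" using N(3) pos by (simp add: field_simps)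
            then show ?thesis using Z(2) s(1) by linarith
          qed
          ultimately have deg: "2 * (3 * \<epsilon> * real n) + real (card Z) < real (card {w \<in> V. E u w})" by linarith
          obtain P' Q' where PQ': "P' \<union> Q' = V - Z" "bipartite_on E P' Q'"
            by (rule exists_placement[OF V(1) uv(1) E _ Z(1) False PQ deg]) (simp_all add: reattach_other)
          have Zs: "card Z \<le> s0" using Z(2) s(1) by simp
          have "n1 \<le> n" using N(2) by simp
          have fit': "real (card {w \<in> B. \<not> E x w}) \<le> 3 * \<epsilon> * real n"
            if "A \<union> B = V - Z" "bipartite_on E A B" "x \<in> A" for A B x
            by (rule fit[OF \<open>n1 \<le> n\<close> V E(1) bip m near finZ Zs that])
               (use nontwins(5) that in \<open>auto simp: L_def\<close>)
          have "almost_complete (3 * \<epsilon> * real n) E P' Q'"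
            unfolding almost_complete_def
            using fit'[OF PQ'] fit'[of Q' P'] PQ' bipartite_on_commute[of E P' Q'] by (simp add: Un_commute)
          then show ?thesis using Z PQ' by blast
        qed
      next
        case multipartite
        obtain v where v: "v \<in> V" using Vne by blast
        let ?Q = "{w \<in> V. E v w}"
        have row: "E x = E v" if "x \<in> V - ?Q" for x
          using multipartite that v by (metis (no_types, lifting) DiffD1 DiffD2 mem_Collect_eq)
        have "bipartite_on E (V - ?Q) ?Q"
          unfolding bipartite_on_def
        proof (intro conjI ballI)
          fix x y assume "x \<in> V - ?Q" "y \<in> V - ?Q"
          then show "\<not> E x y" using row[of x] by auto
        next
          fix x y assume "x \<in> ?Q" "y \<in> ?Q"
          then show "\<not> E x y" using E(2) unfolding triangle_free_def by blast
        qed auto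
        moreover have "almost_complete (3 * \<epsilon> * real n) E (V - ?Q) ?Q"
          unfolding almost_complete_def
        proof (intro conjI ballI)
          fix x assume "x \<in> V - ?Q"
          then have none: "{w \<in> ?Q. \<not> E x w} = {}" using row[of x] by auto
          show "real (card {w \<in> ?Q. \<not> E x w}) \<le> 3 * \<epsilon> * real n"
            unfolding none using pos by simp
        next
          fix x assume "x \<in> ?Q"
          then have none: "{w \<in> V - ?Q. \<not> E x w} = {}"
            using row adjacency_sym[OF E(1)] by (smt (verit) Collect_empty_eq mem_Collect_eq)
          show "real (card {w \<in> V - ?Q. \<not> E x w}) \<le> 3 * \<epsilon> * real n"
            unfolding none using pos by simp
        qed
        moreover have "(V - ?Q) \<union> ?Q = V - {}" by auto
        ultimately show ?thesis by (intro exI[of _ "{}"] exI[of _ "V - ?Q"] exI[of _ ?Q]) simp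
      qed
    qed
  qed
qed

section \<open>Extremal bowtie-free graphs\<close>

lemma bowtie_freeD:
  "bowtie_free E \<Longrightarrow> E c p \<Longrightarrow> E c q \<Longrightarrow> E p q \<Longrightarrow> E c s \<Longrightarrow> E c t \<Longrightarrow> E s t \<Longrightarrow>
     p = s \<or> p = t \<or> q = s \<or> q = t"
  unfolding bowtie_free_def by blast

text \<open>Two disjoint edges inside the neighbourhood of \<open>v\<close> would form a bowtie, so the ends of any one
  edge meet all of them.\<close>

lemma bowtie_free_link_cover:
  assumes "adjacency E" "bowtie_free E"
  obtains R where "finite R" "card R \<le> 2" "v \<notin> R"
    "\<And>x y. E v x \<Longrightarrow> E v y \<Longrightarrow> E x y \<Longrightarrow> x \<in> R \<or> y \<in> R"
proof (cases "\<exists>p q. E v p \<and> E v q \<and> E p q")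
  case True
  then obtain p q where pq: "E v p" "E v q" "E p q" by blast
  have "card {p, q} \<le> 2" by (simp add: card_insert_if)
  moreover have "v \<notin> {p, q}" using pq adjacency_irrefl[OF assms(1)] by auto
  ultimately show ?thesis
    using that[of "{p, q}"] bowtie_freeD[OF assms(2) pq] by blast
next
  case False
  then show ?thesis using that[of "{}"] by auto
qed

text \<open>Otherwise \<open>u\<close> could be replaced by a copy of a vertex \<open>v\<close> with at least the average number of
  bicliques, omitting the at most two vertices that cover the edges in the neighbourhood of \<open>v\<close>.\<close>

lemma extremal_vertex_share:
  assumes V: "finite V" "V \<noteq> {}" "u \<in> V" and E: "adjacency E" "bowtie_free E"
    and max: "\<And>F. adjacency F \<Longrightarrow> bowtie_free F \<Longrightarrow>
      card (bicliques a b V F) \<le> card (bicliques a b V E)"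
  shows "fair_share a b (card V) (real (card (bicliques a b V E))) - 12 * real (card V) ^ (a + b - 2)
    \<le> real (card (bicliques_at a b V E u))"
proof -
  have n: "0 < card V" using V by (simp add: card_gt_0_iff)
  obtain v where v: "v \<in> V"
    "(a + b) * card (bicliques a b V E) \<le> card V * card (bicliques_at a b V E v)"
    using ex_vertex_with_average_bicliques[OF V(1,2) E(1), of a b] by blast
  have "real (a + b) * real (card (bicliques a b V E))
      \<le> real (card V) * real (card (bicliques_at a b V E v))"
    using v(2) by (metis of_nat_le_iff of_nat_mult)
  then have share: "fair_share a b (card V) (real (card (bicliques a b V E)))
      \<le> real (card (bicliques_at a b V E v))"
    using n by (simp add: fair_share_def pos_divide_le_eq mult.commute)
  have "card (bicliques_at a b V E v) \<le> card (bicliques_at a b V E u) + 12 * card V ^ (a + b - 2)"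
  proof (cases "u = v")
    case False
    obtain R where R: "finite R" "card R \<le> 2" "v \<notin> R"
      "\<And>x y. E v x \<Longrightarrow> E v y \<Longrightarrow> E x y \<Longrightarrow> x \<in> R \<or> y \<in> R"
      using bowtie_free_link_cover[OF E] by blast
    let ?F = "reattach u ({w. E v w} - R) E"
    have "card (bicliques a b V ?F) \<le> card (bicliques a b V E)"
    proof (rule max)
      show "adjacency ?F" by (rule adjacency_reattach[OF E(1)])
      show "bowtie_free ?F" by (rule bowtie_free_reattach[OF E]) (use R(4) in blast)
    qed
    moreover have "4 * (card R + 1) * card V ^ (a + b - 2) \<le> 12 * card V ^ (a + b - 2)"
      using R(2) by (intro mult_le_mono1) simp
    ultimately show ?thesis
      using card_bicliques_clone[OF V(1,3) E(1) False R(1,3), of a b] by linarith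
  qed simp
  then have "real (card (bicliques_at a b V E v))
      \<le> real (card (bicliques_at a b V E u) + 12 * card V ^ (a + b - 2))" by (rule of_nat_mono)
  then show ?thesis using share by simp
qed

text \<open>For every vertex, the at most two edges to the vertices that cover its link are deleted. These
  are at most \<open>2 * card V\<close> edges, each in few bicliques.\<close>

lemma bowtie_free_large_triangle_free_subgraph:
  assumes V: "finite V" and E: "adjacency E" "bowtie_free E" and ab: "1 \<le> a" "1 \<le> b"
  obtains F where "adjacency F" "triangle_free F" "\<And>x y. F x y \<Longrightarrow> E x y"
    "card (bicliques a b V E) \<le> card (bicliques a b V F) + 8 * card V ^ (a + b - 1)"
proof -
  have "\<exists>R. finite R \<and> card R \<le> 2 \<and> v \<notin> R \<and> (\<forall>x y. E v x \<longrightarrow> E v y \<longrightarrow> E x y \<longrightarrow> x \<in> R \<or> y \<in> R)" for v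
    using bowtie_free_link_cover[OF E, of v] by metis
  then obtain R where R: "\<And>v. finite (R v)" "\<And>v. card (R v) \<le> 2" "\<And>v. v \<notin> R v"
    "\<And>v x y. E v x \<Longrightarrow> E v y \<Longrightarrow> E x y \<Longrightarrow> x \<in> R v \<or> y \<in> R v" by metis
  define F where "F = (\<lambda>x y. E x y \<and> y \<notin> R x \<and> x \<notin> R y)"
  have adjF: "adjacency F"
    using adjacency_sym[OF E(1)] adjacency_irrefl[OF E(1)]
    unfolding F_def adjacency_def symp_def irreflp_def by blast
  have tri: "triangle_free F"
    unfolding triangle_free_def F_def using R(4) by blast
  let ?M = "\<lambda>v. {(X, Y) \<in> bicliques_at a b V E v. (X \<union> Y) \<inter> R v \<noteq> {}}"
  have finM: "finite (?M v)" for v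
    by (rule finite_subset[OF _ finite_bicliques_at[OF V]]) auto
  have "bicliques a b V E \<subseteq> bicliques a b V F \<union> (\<Union>v\<in>V. ?M v)"
  proof
    fix p assume p: "p \<in> bicliques a b V E"
    obtain X Y where XY: "p = (X, Y)" by fastforce
    have B: "X \<subseteq> V" "Y \<subseteq> V" "card X = a" "card Y = b" "\<And>x y. x \<in> X \<Longrightarrow> y \<in> Y \<Longrightarrow> E x y"
      using p unfolding XY by (auto simp: mem_bicliques)
    show "p \<in> bicliques a b V F \<union> (\<Union>v\<in>V. ?M v)"
    proof (cases "\<exists>x\<in>X. \<exists>y\<in>Y. y \<in> R x \<or> x \<in> R y")
      case True
      then obtain x y where xy: "x \<in> X" "y \<in> Y" "y \<in> R x \<or> x \<in> R y" by blast
      then have "p \<in> ?M x \<or> p \<in> ?M y"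
        using p unfolding XY by (auto simp: mem_bicliques_at)
      then show ?thesis using xy(1,2) B(1,2) by blast
    next
      case False
      then have "p \<in> bicliques a b V F"
        using B unfolding XY mem_bicliques F_def by blast
      then show ?thesis by blast
    qed
  qed
  then have "card (bicliques a b V E) \<le> card (bicliques a b V F \<union> (\<Union>v\<in>V. ?M v))"
    by (rule card_mono[rotated]) (use finM V finite_bicliques[OF V] in simp)
  also have "\<dots> \<le> card (bicliques a b V F) + card (\<Union>v\<in>V. ?M v)" by (rule card_Un_le)
  also have "card (\<Union>v\<in>V. ?M v) \<le> (\<Sum>v\<in>V. card (?M v))" by (rule card_UN_le[OF V])
  also have "\<dots> \<le> (\<Sum>v\<in>V. 8 * card V ^ (a + b - 2))"
  proof (rule sum_mono)
    fix v
    have "card (?M v) \<le> 4 * card (R v) * card V ^ (a + b - 2)"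
      by (rule card_bicliques_at_meeting[OF V R(1,3)])
    also have "\<dots> \<le> 8 * card V ^ (a + b - 2)" using R(2)[of v] by (intro mult_le_mono1) simp
    finally show "card (?M v) \<le> 8 * card V ^ (a + b - 2)" .
  qed
  also have "\<dots> = 8 * card V ^ (a + b - 1)"
  proof -
    have "a + b - 1 = Suc (a + b - 2)" using ab by simp
    then show ?thesis by simp
  qed
  finally show ?thesis using that[OF adjF tri] by (simp add: F_def)
qed

lemma common_neighbours:
  assumes "finite P" "finite D" "\<And>y. y \<in> D \<Longrightarrow> real (card {w \<in> P. \<not> E y w}) \<le> d"
  shows "real (card P) - real (card D) * d \<le> real (card {w \<in> P. \<forall>y\<in>D. E y w})"
proof -
  let ?C = "{w \<in> P. \<forall>y\<in>D. E y w}"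
  have "P \<subseteq> ?C \<union> (\<Union>y\<in>D. {w \<in> P. \<not> E y w})" by blast
  then have "card P \<le> card (?C \<union> (\<Union>y\<in>D. {w \<in> P. \<not> E y w}))"
    by (rule card_mono[rotated]) (use assms in simp)
  also have "\<dots> \<le> card ?C + card (\<Union>y\<in>D. {w \<in> P. \<not> E y w})" by (rule card_Un_le)
  also have "\<dots> \<le> card ?C + (\<Sum>y\<in>D. card {w \<in> P. \<not> E y w})"
    by (rule add_left_mono[OF card_UN_le[OF assms(2)]])
  finally have "real (card P) \<le> real (card ?C + (\<Sum>y\<in>D. card {w \<in> P. \<not> E y w}))"
    by (rule of_nat_mono)
  also have "\<dots> = real (card ?C) + (\<Sum>y\<in>D. real (card {w \<in> P. \<not> E y w}))" by simp
  also have "\<dots> \<le> real (card ?C) + (\<Sum>y\<in>D. d)"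
    by (intro add_left_mono sum_mono assms(3))
  finally show ?thesis by simp
qed

lemma card_ge_2_obtain:
  assumes "1 < card A"
  obtains x y where "x \<in> A" "y \<in> A" "x \<noteq> y"
  using assms by (metis One_nat_def card.empty card_1_singleton_iff card_le_Suc0_iff_eq card_ge_0_finite
      less_le_not_le linorder_not_le order_less_trans zero_less_one)

text \<open>The ends of two such edges have at least two common neighbours in \<open>P\<close>. Disjoint edges form a
  bowtie with one common neighbour of all their ends; edges that share one
  vertex form a bowtie centred there with two common neighbours.\<close>

lemma at_most_one_edge:
  assumes E: "adjacency E" "bowtie_free E" and "finite P"
    and few: "\<And>y. y \<in> Q \<Longrightarrow> real (card {w \<in> P. \<not> E y w}) \<le> d" and P: "4 * d + 1 < real (card P)" "0 \<le> d"
    and e: "x \<in> Q" "y \<in> Q" "E x y" "x' \<in> Q" "y' \<in> Q" "E x' y'"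
  shows "{x, y} = {x', y'}"
proof (rule ccontr)
  assume ne: "{x, y} \<noteq> {x', y'}"
  let ?D = "{x, y, x', y'}"
  have "real (card ?D) * d \<le> 4 * d"
    using P(2) by (intro mult_right_mono) (auto simp: card_insert_if)
  moreover have "real (card P) - real (card ?D) * d \<le> real (card {w \<in> P. \<forall>y\<in>?D. E y w})"
    by (rule common_neighbours[OF assms(3)]) (use few e in auto)
  ultimately have "1 < card {w \<in> P. \<forall>y\<in>?D. E y w}" using P(1) by linarith
  then obtain p p' where p: "p \<in> {w \<in> P. \<forall>y\<in>?D. E y w}" "p' \<in> {w \<in> P. \<forall>y\<in>?D. E y w}" "p \<noteq> p'"
    by (rule card_ge_2_obtain)
  have p1: "E x p" "E y p" "E x' p" "E y' p" "E p x" "E p y" "E p x'" "E p y'"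
    using p(1) adjacency_sym[OF E(1)] by auto
  have p2: "E x p'" "E y p'" "E x' p'" "E y' p'" using p(2) by auto
  have e': "E y x" "E y' x'" using e adjacency_sym[OF E(1)] by blast+
  have irr: "p' \<noteq> x" "p' \<noteq> y" "p \<noteq> x'" "p \<noteq> y'" "x \<noteq> y" "x' \<noteq> y'"
    using p1 p2 e adjacency_irrefl[OF E(1)] by auto
  have share: False if "E z s" "E z t" "s \<noteq> t" "E z p" "E z p'" "E s p" "E t p'" "s \<noteq> p'" "t \<noteq> p" for z s t
    using bowtie_freeD[OF E(2) that(1,4,6) that(2,5,7)] that p(3) by blast
  have "x = x' \<or> x = y' \<or> y = x' \<or> y = y'"
    using bowtie_freeD[OF E(2) p1(5,6) e(3) p1(7,8) e(6)] by blast
  then consider "x = x'" "y \<noteq> y'" | "x = y'" "y \<noteq> x'" | "y = x'" "x \<noteq> y'" | "y = y'" "x \<noteq> x'"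
    using ne by auto
  then show False
  proof cases
    case 1 then show ?thesis using share[of x y y'] e p1 p2 irr by simp
  next
    case 2 then show ?thesis using share[of x y x'] e e' p1 p2 irr by simp
  next
    case 3 then show ?thesis using share[of y x y'] e e' p1 p2 irr by simp
  next
    case 4 then show ?thesis using share[of y x x'] e e' p1 p2 irr by simp
  qed
qed

text \<open>Two neighbours of \<open>v\<close> in \<open>P\<close> could be matched to different neighbours of \<open>v\<close> in \<open>Q\<close>, which gives
  a bowtie centred at \<open>v\<close>.\<close>

lemma neighbours_on_one_side:
  assumes E: "adjacency E" "bowtie_free E" and fin: "finite P" "finite Q" and disj: "P \<inter> Q = {}"
    and few: "\<And>y. y \<in> P \<Longrightarrow> real (card {w \<in> Q. \<not> E y w}) \<le> d"
    and large: "d + 1 < real (card {w \<in> Q. E v w})"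
  shows "card {w \<in> P. E v w} \<le> 1"
proof (rule ccontr)
  assume "\<not> ?thesis"
  then have "1 < card {w \<in> P. E v w}" by simp
  then obtain x x' where x: "x \<in> {w \<in> P. E v w}" "x' \<in> {w \<in> P. E v w}" "x \<noteq> x'"
    by (rule card_ge_2_obtain)
  have nb: "\<exists>w. w \<noteq> z \<and> w \<in> Q \<and> E v w \<and> E y w" if y: "y \<in> P" for y z
  proof (rule ccontr)
    assume "\<not> ?thesis"
    then have "{w \<in> Q. E v w} \<subseteq> insert z {w \<in> Q. \<not> E y w}" by blast
    then have "card {w \<in> Q. E v w} \<le> card (insert z {w \<in> Q. \<not> E y w})"
      by (rule card_mono[rotated]) (use fin in simp)
    also have "\<dots> \<le> Suc (card {w \<in> Q. \<not> E y w})" by (rule card_insert_le_m1) (simp_all)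
    finally show False using few[OF y] large by linarith
  qed
  obtain y where y: "y \<in> Q" "E v y" "E x y" using nb[of x undefined] x by blast
  obtain y' where y': "y' \<noteq> y" "y' \<in> Q" "E v y'" "E x' y'" using nb[of x' y] x by blast
  have "E v x" "E v x'" "x \<in> P" "x' \<in> P" using x by auto
  then show False
    using bowtie_freeD[OF E(2) _ y(2,3) _ y'(3,4)] x(3) y'(1,2) y(1) disj by blast
qed

definition inner_ends :: "('v \<Rightarrow> 'v \<Rightarrow> bool) \<Rightarrow> 'v set \<Rightarrow> 'v set" where
  "inner_ends E P = {x \<in> P. \<exists>y\<in>P. E x y}"

lemma card_inner_ends_le:
  assumes "\<And>x y x' y'. x \<in> P \<Longrightarrow> y \<in> P \<Longrightarrow> E x y \<Longrightarrow> x' \<in> P \<Longrightarrow> y' \<in> P \<Longrightarrow> E x' y' \<Longrightarrow> {x, y} = {x', y'}"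
  shows "finite (inner_ends E P) \<and> card (inner_ends E P) \<le> 2"
proof (cases "inner_ends E P = {}")
  case False
  then obtain x y where xy: "x \<in> P" "y \<in> P" "E x y" by (auto simp: inner_ends_def)
  have sub: "inner_ends E P \<subseteq> {x, y}"
  proof
    fix z assume "z \<in> inner_ends E P"
    then obtain t where "z \<in> P" "t \<in> P" "E z t" by (auto simp: inner_ends_def)
    then show "z \<in> {x, y}" using assms[OF xy] by blast
  qed
  have "card (inner_ends E P) \<le> card {x, y}" by (rule card_mono[OF _ sub]) simp
  also have "\<dots> \<le> 2" by (simp add: card_insert_if)
  finally show ?thesis using finite_subset[OF sub] by simp
qed simp

text \<open>An arbitrary vertex \<open>v\<close> outside of \<open>B\<close> with at most one neighbour in \<open>A\<close> is moved into \<open>A\<close>. To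
  make the rest bipartite, the exceptional set is enlarged by the ends of the at most two edges
  inside the parts and by that neighbour of \<open>v\<close>: at most five further vertices.\<close>

lemma nonneighbours_after_refit:
  assumes V: "finite V" and E: "adjacency E" and Z: "finite Z" "card Z \<le> s"
    and AB: "A \<union> B = V - Z" "A \<inter> B = {}"
    and ends: "finite (inner_ends E A)" "card (inner_ends E A) \<le> 2"
      "finite (inner_ends E B)" "card (inner_ends E B) \<le> 2"
    and v: "v \<in> V" "v \<notin> B" "card {w \<in> A. E v w} \<le> 1"
    and fit: "\<And>Z' P Q. finite Z' \<Longrightarrow> card Z' \<le> s + 5 \<Longrightarrow> P \<union> Q = V - Z' \<Longrightarrow> bipartite_on E P Q \<Longrightarrow>
      v \<in> P \<Longrightarrow> real (card {w \<in> Q. \<not> E v w}) \<le> d"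
  shows "real (card {w \<in> B \<union> Z. w \<noteq> v \<and> \<not> E v w}) \<le> d + real s + 5"
proof -
  let ?J = "{w \<in> A. E v w}"
  let ?Z = "(Z \<union> (inner_ends E A \<union> (inner_ends E B \<union> ?J))) - {v}"
  let ?P = "insert v (A - ?Z)" and ?Q = "B - ?Z"
  have fin: "finite A" "finite B" using AB V by (metis finite_Diff finite_Un)+
  have finZ: "finite ?Z" using Z ends fin by simp
  have "card ?Z \<le> card (Z \<union> (inner_ends E A \<union> (inner_ends E B \<union> ?J)))"
    by (rule card_Diff1_le)
  also have "\<dots> \<le> card Z + card (inner_ends E A \<union> (inner_ends E B \<union> ?J))" by (rule card_Un_le)
  also have "\<dots> \<le> card Z + (card (inner_ends E A) + card (inner_ends E B \<union> ?J))"
    by (rule add_left_mono[OF card_Un_le])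
  also have "\<dots> \<le> card Z + (card (inner_ends E A) + (card (inner_ends E B) + card ?J))"
    by (intro add_left_mono card_Un_le)
  also have "\<dots> \<le> s + 5" using Z(2) ends(2,4) v(3) by linarith
  finally have cZ: "card ?Z \<le> s + 5" .
  have part: "?P \<union> ?Q = V - ?Z" 
  proof
    show "?P \<union> ?Q \<subseteq> V - ?Z" using AB(1) v(1) by blast
    show "V - ?Z \<subseteq> ?P \<union> ?Q"
    proof
      fix x assume x: "x \<in> V - ?Z"
      show "x \<in> ?P \<union> ?Q"
      proof (cases "x = v")
        case False
        then have "x \<notin> Z" using x by blast
        then have "x \<in> A \<union> B" using AB(1) x by blast
        then show ?thesis using x by blast
      qed simp
    qed
  qed
  have bip: "bipartite_on E ?P ?Q"
    unfolding bipartite_on_def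
  proof (intro conjI ballI)
    show "?P \<inter> ?Q = {}" using AB(2) v(2) by blast
  next
    fix x y assume xy: "x \<in> ?P" "y \<in> ?P"
    show "\<not> E x y"
    proof (cases "x = v \<or> y = v")
      case True
      then show ?thesis
        using xy adjacency_irrefl[OF E] adjacency_sym[OF E] by blast
    next
      case False
      then have "x \<in> A" "y \<in> A" "x \<notin> inner_ends E A" using xy by blast+
      then show ?thesis by (auto simp: inner_ends_def)
    qed
  next
    fix x y assume "x \<in> ?Q" "y \<in> ?Q"
    then have "x \<in> B" "y \<in> B" "x \<notin> inner_ends E B" using v(2) by blast+
    then show "\<not> E x y" by (auto simp: inner_ends_def)
  qed
  have "{w \<in> B \<union> Z. w \<noteq> v \<and> \<not> E v w} \<subseteq> {w \<in> ?Q. \<not> E v w} \<union> ?Z" by blast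
  then have "card {w \<in> B \<union> Z. w \<noteq> v \<and> \<not> E v w} \<le> card ({w \<in> ?Q. \<not> E v w} \<union> ?Z)"
    by (rule card_mono[rotated]) (use fin finZ in simp)
  also have "\<dots> \<le> card {w \<in> ?Q. \<not> E v w} + card ?Z" by (rule card_Un_le)
  finally have "card {w \<in> B \<union> Z. w \<noteq> v \<and> \<not> E v w} \<le> card {w \<in> ?Q. \<not> E v w} + (s + 5)"
    using cZ by linarith
  then have "real (card {w \<in> B \<union> Z. w \<noteq> v \<and> \<not> E v w}) \<le> real (card {w \<in> ?Q. \<not> E v w} + (s + 5))"
    by (rule of_nat_mono)
  moreover have "real (card {w \<in> ?Q. \<not> E v w}) \<le> d"
    by (rule fit[OF finZ cZ part bip]) simp
  ultimately show ?thesis by simp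
qed

text \<open>Stability is applied to a large triangle-free subgraph. In the original graph, each vertex,
  exceptional or not, has at most one neighbour in one of the parts by \<open>neighbours_on_one_side\<close>, as
  its degree is linear, and so it can be assigned to that part; its number of bicliques bounds its
  nonneighbours in the other one.\<close>

lemma extremal_structure:
  fixes c :: real
  assumes ab: "1 \<le> a" "1 \<le> b" and c: "0 < c" "c \<le> 1"
  shows "\<exists>n0. \<forall>n\<ge>n0. \<forall>(V :: 'v set) E. finite V \<longrightarrow> card V = n \<longrightarrow> adjacency E \<longrightarrow> bowtie_free E \<longrightarrow>
    (\<forall>F. adjacency F \<longrightarrow> bowtie_free F \<longrightarrow> card (bicliques a b V F) \<le> card (bicliques a b V E)) \<longrightarrow>
    c * real n ^ (a + b) \<le> real (card (bicliques a b V E)) \<longrightarrow>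
    (\<exists>P Q d. P \<union> Q = V \<and> P \<inter> Q = {} \<and> 0 \<le> d \<and> almost_complete d E P Q
       \<and> 4 * d + 4 < real (card P) \<and> 4 * d + 4 < real (card Q))"
proof -
  \<comment> \<open>Degrees and parts have size at least about \<open>c / 4 * n\<close>, and four times the number \<open>3 * \<epsilon> * n\<close> of
      nonneighbours has to be smaller than that. The bound \<open>s\<close> on the exceptional set is chosen such
      that the bicliques lost in the triangle-free subgraph are paid for.\<close>
  define \<epsilon> where "\<epsilon> = c / 128"
  define s where "s = nat \<lceil>8 / (\<epsilon> * c)\<rceil>"
  have eps: "0 < \<epsilon>" "48 * \<epsilon> \<le> c" "\<epsilon> \<le> 1 / 2" using c by (auto simp: \<epsilon>_def)
  have "8 / (\<epsilon> * c) \<le> real s" using eps c by (simp add: s_def)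
  then have s8: "8 \<le> real s * (\<epsilon> * c)" using eps c by (simp add: field_simps)
  obtain n1 where stab: "\<forall>n\<ge>n1. \<forall>(V :: 'v set) m. finite V \<longrightarrow> card V = n \<longrightarrow>
    (\<forall>F. adjacency F \<longrightarrow> triangle_free F \<longrightarrow> real (card (bicliques a b V F)) \<le> m) \<longrightarrow>
    c * real n ^ (a + b) \<le> m \<longrightarrow>
    (\<forall>E t. adjacency E \<longrightarrow> triangle_free E \<longrightarrow> t \<le> s \<longrightarrow>
      m - real t * (\<epsilon> * c * real n ^ (a + b - 1)) \<le> real (card (bicliques a b V E)) \<longrightarrow>
      (\<exists>Z P Q. Z \<subseteq> V \<and> card Z \<le> t \<and> P \<union> Q = V - Z \<and> bipartite_on E P Q
         \<and> almost_complete (3 * \<epsilon> * real n) E P Q))"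
    using triangle_free_stability[OF ab c(1) eps, of s, where 'v = 'v] by (rule exE)
  have zero: "0 \<le> (0 :: real)" by simp
  obtain n2 where fit: "\<And>n V E m Z P Q v. n2 \<le> n \<Longrightarrow> finite (V :: 'v set) \<Longrightarrow> card V = n \<Longrightarrow> adjacency E \<Longrightarrow>
    (\<forall>p q. p + q = n \<longrightarrow> real (bip_count a b p q) \<le> m) \<Longrightarrow> c * real n ^ (a + b) \<le> m \<Longrightarrow>
    m - 0 * real n ^ (a + b - 1) \<le> real (card (bicliques a b V E)) \<Longrightarrow>
    finite Z \<Longrightarrow> card Z \<le> s + 5 \<Longrightarrow> P \<union> Q = V - Z \<Longrightarrow> bipartite_on E P Q \<Longrightarrow> v \<in> P \<Longrightarrow>
    (1 - \<epsilon>) * fair_share a b n m \<le> real (card (bicliques_at a b V E v)) \<Longrightarrow>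
    real (card {w \<in> Q. \<not> E v w}) \<le> 3 * \<epsilon> * real n"
    using few_nonneighbours[OF ab c(1) eps(1) zero, of "s + 5", where 'a = 'v]
    by (elim exE) (rule that, blast)
  obtain n0 :: nat where
    n0: "max 1 (max (real n1) (max (real n2) (max (6 / (c * \<epsilon>)) (100 * (real s + 10) / c)))) < real n0"
    using reals_Archimedean2 by blast
  show ?thesis
  proof (rule exI[of _ n0], intro allI impI)
    fix n :: nat and V :: "'v set" and E
    assume n: "n0 \<le> n" and V: "finite V" "card V = n" and E: "adjacency E" "bowtie_free E"
      and max: "\<forall>F. adjacency F \<longrightarrow> bowtie_free F \<longrightarrow> card (bicliques a b V F) \<le> card (bicliques a b V E)"
      and many: "c * real n ^ (a + b) \<le> real (card (bicliques a b V E))"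
    have "real n0 \<le> real n" using n by simp
    then have N: "1 < real n" "n1 \<le> n" "n2 \<le> n" "6 / (c * \<epsilon>) < real n" "100 * (real s + 10) / c < real n"
      using n0 by auto
    have cn: "100 * real s + 1000 < c * real n" using N(5) c by (simp add: field_simps)
    have Vne: "V \<noteq> {}" using V N by auto
    define w where "w = real n ^ (a + b - 2)"
    define m where "m = real (card (bicliques a b V E))"
    define L where "L = fair_share a b n m"
    define d where "d = 3 * \<epsilon> * real n"
    have dcn: "d = 3 / 128 * (c * real n)" by (simp add: d_def \<epsilon>_def)
    have d0: "0 \<le> d" using eps by (simp add: d_def)
    have wpos: "0 < w" using N by (simp add: w_def)
    have pw: "real n ^ (a + b - 1) = real n * w" "real n ^ (a + b) = real n * real n * w"
      unfolding w_def by (rule power_split[OF ab])+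
    have m: "c * real n ^ (a + b) \<le> m" using many by (simp add: m_def)
    have Lge: "2 * c * (real n * w) \<le> L"
      unfolding w_def L_def by (rule fair_share_ge[OF ab c(1) m]) (use N in simp)
    have Lpos: "0 < L" using Lge wpos N c by (smt (verit) mult_pos_pos)
    have maxT: "\<forall>F. adjacency F \<longrightarrow> triangle_free F \<longrightarrow> real (card (bicliques a b V F)) \<le> m"
      using max triangle_free_imp_bowtie_free by (auto simp: m_def)
    have bip: "\<forall>p q. p + q = n \<longrightarrow> real (bip_count a b p q) \<le> m"
      using bip_count_le_of_triangle_free_bound[OF V(1) ab(1) maxT] V(2) by simp
    have share: "(1 - \<epsilon>) * L \<le> real (card (bicliques_at a b V E u))" if "u \<in> V" for u
    proof -
      have "L - 12 * w \<le> real (card (bicliques_at a b V E u))"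
        using extremal_vertex_share[OF V(1) Vne that E, of a b] max
        unfolding L_def w_def m_def V(2) by blast
      moreover have "12 * w \<le> \<epsilon> * L"
      proof -
        have "6 \<le> c * \<epsilon> * real n" using N(4) c eps by (simp add: field_simps)
        then have "6 * (2 * w) \<le> c * \<epsilon> * real n * (2 * w)" using wpos by (intro mult_right_mono) auto
        also have "\<dots> \<le> \<epsilon> * L" using mult_left_mono[OF Lge, of \<epsilon>] eps by (simp add: algebra_simps)
        finally show ?thesis by simp
      qed
      ultimately show ?thesis by (simp add: algebra_simps)
    qed
    have degree: "c / 4 * real n \<le> real (card {w \<in> V. E v w})" if "v \<in> V" for v
    proof -
      have "1 / 2 * L \<le> (1 - \<epsilon>) * L" using eps Lpos by (intro mult_right_mono) auto
      also have "\<dots> \<le> real (card (bicliques_at a b V E v))" using share[OF that] .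
      finally show ?thesis
        using degree_ge_of_fair_share[OF ab V(1) Vne E(1) c(1), of m v] m unfolding V(2) L_def by simp
    qed
    obtain F where F: "adjacency F" "triangle_free F" "\<And>x y. F x y \<Longrightarrow> E x y"
      "card (bicliques a b V E) \<le> card (bicliques a b V F) + 8 * card V ^ (a + b - 1)"
      using bowtie_free_large_triangle_free_subgraph[OF V(1) E ab] by blast
    have "m \<le> real (card (bicliques a b V F) + 8 * card V ^ (a + b - 1))"
      unfolding m_def using F(4) by (rule of_nat_mono)
    then have mF: "m \<le> real (card (bicliques a b V F)) + 8 * (real n * w)"
      by (simp add: V(2) flip: pw(1))
    have "8 * (real n * w) \<le> real s * (\<epsilon> * c) * (real n * w)"
      using s8 wpos N by (intro mult_right_mono) auto
    then have "m - real s * (\<epsilon> * c * real n ^ (a + b - 1)) \<le> real (card (bicliques a b V F))"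
      using mF unfolding pw by (simp add: algebra_simps)
    from stab[rule_format, OF N(2) V maxT[rule_format] m F(1,2) order_refl this] obtain Z P Q where Z: "Z \<subseteq> V" "card Z \<le> s"
      and PQ: "P \<union> Q = V - Z" "bipartite_on F P Q" "almost_complete d F P Q"
      unfolding d_def by blast
    have finZ: "finite Z" using Z V finite_subset by blast
    have fin: "finite P" "finite Q" using PQ(1) V by (metis finite_Diff finite_Un)+
    have disj: "P \<inter> Q = {}" using PQ(2) by (simp add: bipartite_on_def)
    have PV: "P \<subseteq> V" "Q \<subseteq> V" using PQ(1) by blast+
    \<comment> \<open>Both parts are linear in size, since otherwise there would be too few bicliques.\<close>
    have size: "c / 2 * real n - 4 - real s \<le> real (card B)"
      if "A \<union> B = V - Z" "bipartite_on F A B" for A B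
    proof -
      have AB: "card A \<le> n" "card B \<le> n"
        using that(1) V card_mono[OF V(1), of A] card_mono[OF V(1), of B] by blast+
      have "card (bicliques a b V F) \<le> bip_count a b (card A) (card B) + 2 * card Z * n ^ (a + b - 1)"
        using card_bicliques_bipartite_le[OF V(1) F(1) ab finZ that] V(2) by simp
      also have "\<dots> \<le> 2 * card B * n ^ (a + b - 1) + 2 * s * n ^ (a + b - 1)"
        by (intro add_mono bip_count_le[OF ab AB] mult_le_mono order_refl Z(2))
      finally have "real (card (bicliques a b V F)) \<le> real (2 * card B * n ^ (a + b - 1) + 2 * s * n ^ (a + b - 1))"
        by (rule of_nat_mono)
      then have "real (card (bicliques a b V F)) \<le> (2 * real (card B) + 2 * real s) * real n ^ (a + b - 1)"
        by (simp add: algebra_simps)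
      then have "real (card (bicliques a b V F)) \<le> (2 * real (card B) + 2 * real s) * (real n * w)"
        unfolding pw(1) .
      then have "(c * real n) * (real n * w) \<le> (2 * real (card B) + 2 * real s + 8) * (real n * w)"
        using mF m unfolding pw by (simp add: algebra_simps)
      then have "c * real n \<le> 2 * real (card B) + 2 * real s + 8"
        using wpos N by (simp add: mult_le_cancel_right)
      then show ?thesis by simp
    qed
    have sizeQ: "c / 2 * real n - 4 - real s \<le> real (card Q)" by (rule size[OF PQ(1,2)])
    have sizeP: "c / 2 * real n - 4 - real s \<le> real (card P)"
      by (rule size[of Q P]) (use PQ(1,2) bipartite_on_commute in \<open>blast, blast\<close>)
    have ac: "almost_complete d E P Q"
      by (rule almost_complete_mono[OF PQ(3) fin]) (use F(3) in auto)
    have acP: "real (card {w \<in> Q. \<not> E y w}) \<le> d" if "y \<in> P" for y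
      using ac that by (simp add: almost_complete_def)
    have acQ: "real (card {w \<in> P. \<not> E y w}) \<le> d" if "y \<in> Q" for y
      using ac that by (simp add: almost_complete_def)
    have large: "4 * d + 1 < real (card P)" "4 * d + 1 < real (card Q)"
      using sizeP sizeQ cn dcn by linarith+
    have "finite (inner_ends E P) \<and> card (inner_ends E P) \<le> 2"
      by (rule card_inner_ends_le) (rule at_most_one_edge[OF E fin(2) acP large(2) d0])
    then have endsP: "finite (inner_ends E P)" "card (inner_ends E P) \<le> 2" by blast+
    have "finite (inner_ends E Q) \<and> card (inner_ends E Q) \<le> 2"
      by (rule card_inner_ends_le) (rule at_most_one_edge[OF E fin(1) acQ large(1) d0])
    then have endsQ: "finite (inner_ends E Q)" "card (inner_ends E Q) \<le> 2" by blast+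
    have one_side: "card {w \<in> P. E v w} \<le> 1 \<or> card {w \<in> Q. E v w} \<le> 1" if "v \<in> V" for v
    proof -
      have "{w \<in> V. E v w} \<subseteq> {w \<in> P. E v w} \<union> ({w \<in> Q. E v w} \<union> Z)" using PQ(1) by blast
      then have "card {w \<in> V. E v w} \<le> card ({w \<in> P. E v w} \<union> ({w \<in> Q. E v w} \<union> Z))"
        by (rule card_mono[rotated]) (use fin finZ in simp)
      also have "\<dots> \<le> card {w \<in> P. E v w} + (card {w \<in> Q. E v w} + card Z)"
        by (rule order_trans[OF card_Un_le add_left_mono[OF card_Un_le]])
      finally have "card {w \<in> V. E v w} \<le> card {w \<in> P. E v w} + (card {w \<in> Q. E v w} + card Z)" .
      then have "c / 4 * real n \<le> real (card {w \<in> P. E v w}) + real (card {w \<in> Q. E v w}) + real s"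
        using degree[OF that] Z(2) by linarith
      then have "d + 1 < real (card {w \<in> Q. E v w}) \<or> d + 1 < real (card {w \<in> P. E v w})"
        using cn dcn by linarith
      then show ?thesis
        using neighbours_on_one_side[OF E fin disj acP] neighbours_on_one_side[OF E fin(2,1) _ acQ] disj
        by blast
    qed
    have degQ: "1 < card {w \<in> Q. E v w}" if "v \<in> P" for v
    proof -
      have "card Q = card {w \<in> Q. E v w} + card {w \<in> Q. \<not> E v w}"
        using card_Int_Diff[OF fin(2), of "{w. E v w}"] by (simp add: Int_def set_diff_eq)
      then show ?thesis using acP[OF that] large(2) d0 by linarith
    qed
    have degP: "1 < card {w \<in> P. E v w}" if "v \<in> Q" for v
    proof -
      have "card P = card {w \<in> P. E v w} + card {w \<in> P. \<not> E v w}"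
        using card_Int_Diff[OF fin(1), of "{w. E v w}"] by (simp add: Int_def set_diff_eq)
      then show ?thesis using acQ[OF that] large(1) d0 by linarith
    qed
    \<comment> \<open>The new parts extend \<open>P\<close> and \<open>Q\<close> by the exceptional vertices.\<close>
    define A where "A = {v \<in> V. card {w \<in> P. E v w} \<le> 1}"
    define B where "B = V - A"
    have PA: "P \<subseteq> A"
    proof
      fix v assume "v \<in> P"
      then show "v \<in> A" using one_side[of v] degQ[of v] PV unfolding A_def by auto
    qed
    have QB: "Q \<subseteq> B"
    proof
      fix v assume "v \<in> Q"
      then show "v \<in> B" using degP[of v] PV unfolding A_def B_def by auto
    qed
    have fit': "real (card {w \<in> Q'. \<not> E v w}) \<le> d"
      if "v \<in> V" "finite Z'" "card Z' \<le> s + 5" "P' \<union> Q' = V - Z'" "bipartite_on E P' Q'" "v \<in> P'" for v Z' P' Q'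
      unfolding d_def
      by (rule fit[OF N(3) V E(1) bip m _ that(2-6)])
         (use share[OF that(1)] in \<open>auto simp: m_def L_def\<close>)
    have AB: "A \<union> B = V" "A \<inter> B = {}" by (auto simp: A_def B_def)
    have finAB: "finite A" "finite B" using AB(1) V(1) by (metis finite_Un)+
    have "real (card {w \<in> B. \<not> E v w}) \<le> d + real s + 5" if "v \<in> A" for v
    proof -
      have v: "v \<in> V" "v \<notin> B" "card {w \<in> P. E v w} \<le> 1" using that by (auto simp: A_def B_def)
      have "v \<notin> Q" using QB v(2) by blast
      have "{w \<in> B. \<not> E v w} \<subseteq> {w \<in> Q \<union> Z. w \<noteq> v \<and> \<not> E v w}"
        using v(2) PA PQ(1) AB by blast
      then have "card {w \<in> B. \<not> E v w} \<le> card {w \<in> Q \<union> Z. w \<noteq> v \<and> \<not> E v w}"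
        by (rule card_mono[rotated]) (use fin finZ in simp)
      moreover have "real (card {w \<in> Q \<union> Z. w \<noteq> v \<and> \<not> E v w}) \<le> d + real s + 5"
        by (rule nonneighbours_after_refit[OF V(1) E(1) finZ Z(2) PQ(1) disj endsP endsQ v(1) \<open>v \<notin> Q\<close> v(3)])
           (rule fit'[OF v(1)])
      ultimately show ?thesis by linarith
    qed
    moreover have "real (card {w \<in> A. \<not> E v w}) \<le> d + real s + 5" if "v \<in> B" for v
    proof -
      have v: "v \<in> V" "v \<notin> A" "card {w \<in> Q. E v w} \<le> 1"
        using that one_side[of v] by (auto simp: A_def B_def)
      have "v \<notin> P" using PA v(2) by blast
      have QP: "Q \<union> P = V - Z" "Q \<inter> P = {}" using PQ(1) disj by blast+
      have "{w \<in> A. \<not> E v w} \<subseteq> {w \<in> P \<union> Z. w \<noteq> v \<and> \<not> E v w}"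
        using v(2) QB PQ(1) AB by blast
      then have "card {w \<in> A. \<not> E v w} \<le> card {w \<in> P \<union> Z. w \<noteq> v \<and> \<not> E v w}"
        by (rule card_mono[rotated]) (use fin finZ in simp)
      moreover have "real (card {w \<in> P \<union> Z. w \<noteq> v \<and> \<not> E v w}) \<le> d + real s + 5"
        by (rule nonneighbours_after_refit[OF V(1) E(1) finZ Z(2) QP endsQ endsP v(1) \<open>v \<notin> P\<close> v(3)])
           (rule fit'[OF v(1)])
      ultimately show ?thesis by linarith
    qed
    ultimately have "almost_complete (d + real s + 5) E A B" by (simp add: almost_complete_def)
    moreover have "4 * (d + real s + 5) + 4 < real (card A)"
    proof -
      have "real (card P) \<le> real (card A)" by (rule of_nat_mono[OF card_mono[OF finAB(1) PA]])
      moreover have "c / 2 * real n = 1 / 2 * (c * real n)" by simp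
      moreover have "0 \<le> real s" by simp
      ultimately show ?thesis using sizeP cn dcn by argo
    qed
    moreover have "4 * (d + real s + 5) + 4 < real (card B)"
    proof -
      have "real (card Q) \<le> real (card B)" by (rule of_nat_mono[OF card_mono[OF finAB(2) QB]])
      moreover have "c / 2 * real n = 1 / 2 * (c * real n)" by simp
      moreover have "0 \<le> real s" by simp
      ultimately show ?thesis using sizeQ cn dcn by argo
    qed
    moreover have "0 \<le> d + real s + 5" using d0 by simp
    ultimately show "\<exists>P Q d. P \<union> Q = V \<and> P \<inter> Q = {} \<and> 0 \<le> d \<and> almost_complete d E P Q
       \<and> 4 * d + 4 < real (card P) \<and> 4 * d + 4 < real (card Q)" using AB by blast
  qed
qed

section \<open>Comparison with a complete bipartite graph plus an edge\<close>

definition plus_edge :: "'v set \<Rightarrow> 'v set \<Rightarrow> 'v \<Rightarrow> 'v \<Rightarrow> 'v \<Rightarrow> 'v \<Rightarrow> bool" where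
  "plus_edge P Q u v x y \<longleftrightarrow> complete_bip P Q x y \<or> x = u \<and> y = v \<or> x = v \<and> y = u"

text \<open>All triangles contain the added edge, so two of them never share exactly one vertex.\<close>

lemma bowtie_free_plus_edge:
  assumes "P \<inter> Q = {}" "u \<in> P" "v \<in> P" "u \<noteq> v"
  shows "bowtie_free (plus_edge P Q u v)"
proof -
  have tri: "{u, v} \<subseteq> {x, y, z}"
    if "plus_edge P Q u v x y" "plus_edge P Q u v x z" "plus_edge P Q u v y z" for x y z
    using that assms unfolding plus_edge_def complete_bip_def by blast
  show ?thesis
    unfolding bowtie_free_def
  proof (intro allI impI)
    fix c p q s t
    assume 1: "plus_edge P Q u v c p" "plus_edge P Q u v c q" "plus_edge P Q u v p q"
      and 2: "plus_edge P Q u v c s" "plus_edge P Q u v c t" "plus_edge P Q u v s t"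
    obtain w where w: "w \<in> {u, v}" "w \<noteq> c" using assms(4) by auto
    have "w \<in> {c, p, q}" by (rule subsetD[OF tri[OF 1] w(1)])
    moreover have "w \<in> {c, s, t}" by (rule subsetD[OF tri[OF 2] w(1)])
    ultimately show "{p, q} \<inter> {s, t} \<noteq> {}" using w(2) by auto
  qed
qed

lemma card_bicliques_star:
  assumes "finite V"
  shows "card (bicliques 1 b V E) = (\<Sum>z\<in>V. card {y \<in> V. E z y} choose b)"
proof -
  have "bij_betw (\<lambda>(z, Y). ({z}, Y)) (SIGMA z:V. {Y. Y \<subseteq> {y \<in> V. E z y} \<and> card Y = b}) (bicliques 1 b V E)"
    unfolding bij_betw_def
  proof
    show "inj_on (\<lambda>(z, Y). ({z}, Y)) (SIGMA z:V. {Y. Y \<subseteq> {y \<in> V. E z y} \<and> card Y = b})"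
      by (auto simp: inj_on_def)
    show "(\<lambda>(z, Y). ({z}, Y)) ` (SIGMA z:V. {Y. Y \<subseteq> {y \<in> V. E z y} \<and> card Y = b}) = bicliques 1 b V E"
    proof
      show "(\<lambda>(z, Y). ({z}, Y)) ` (SIGMA z:V. {Y. Y \<subseteq> {y \<in> V. E z y} \<and> card Y = b}) \<subseteq> bicliques 1 b V E"
        by (auto simp: mem_bicliques)
      show "bicliques 1 b V E \<subseteq> (\<lambda>(z, Y). ({z}, Y)) ` (SIGMA z:V. {Y. Y \<subseteq> {y \<in> V. E z y} \<and> card Y = b})"
      proof
        fix p assume p: "p \<in> bicliques 1 b V E"
        obtain X Y where XY: "p = (X, Y)" by fastforce
        have B: "X \<subseteq> V" "Y \<subseteq> V" "card X = 1" "card Y = b" "\<forall>x\<in>X. \<forall>y\<in>Y. E x y"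
          using p unfolding XY mem_bicliques by blast+
        obtain z where z: "X = {z}" using B(3) card_1_singletonE by blast
        have "(z, Y) \<in> (SIGMA z:V. {Y. Y \<subseteq> {y \<in> V. E z y} \<and> card Y = b})"
          using B z by auto
        then show "p \<in> (\<lambda>(z, Y). ({z}, Y)) ` (SIGMA z:V. {Y. Y \<subseteq> {y \<in> V. E z y} \<and> card Y = b})"
          unfolding XY z by (rule image_eqI[rotated]) simp
      qed
    qed
  qed
  then have "card (bicliques 1 b V E) = card (SIGMA z:V. {Y. Y \<subseteq> {y \<in> V. E z y} \<and> card Y = b})"
    by (rule bij_betw_same_card[symmetric])
  also have "\<dots> = (\<Sum>z\<in>V. card {Y. Y \<subseteq> {y \<in> V. E z y} \<and> card Y = b})"
    using assms by (intro card_SigmaI) auto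
  also have "\<dots> = (\<Sum>z\<in>V. card {y \<in> V. E z y} choose b)"
    using assms by (simp add: n_subsets)
  finally show ?thesis .
qed

lemma card_le_of_card_Diff_le:
  assumes "finite A" "finite B" "card (A - B) \<le> card (B - A)"
  shows "card A \<le> card B"
  using card_Int_Diff[OF assms(1), of B] card_Int_Diff[OF assms(2), of A] assms(3)
  by (simp add: Int_commute)

text \<open>Compare with the graph that keeps only the edge \<open>x y\<close> and has all edges between the parts. For
  \<open>a = 1\<close> the count depends on the degrees only, and these do not decrease: \<open>u\<close> and \<open>v\<close> lose each
  other but gain a missing neighbour in \<open>P\<close>. For \<open>a \<ge> 2\<close> a biclique that uses the edge \<open>u v\<close> must also
  use \<open>x y\<close>, so it is a four-cycle and \<open>a = b = 2\<close>; the four-cycle with sides \<open>{u, v}\<close> and \<open>{x, y}\<close>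
  replaces it.\<close>

lemma two_inner_edges_le:
  assumes V: "finite V" "P \<union> Q = V" "P \<inter> Q = {}" and E: "adjacency E" and ab: "1 \<le> a" "a \<le> b"
    and e: "x \<in> P" "y \<in> P" "E x y" "u \<in> Q" "v \<in> Q" "E u v"
    and uniqueP: "\<And>s t. s \<in> P \<Longrightarrow> t \<in> P \<Longrightarrow> E s t \<Longrightarrow> {s, t} = {x, y}"
    and uniqueQ: "\<And>s t. s \<in> Q \<Longrightarrow> t \<in> Q \<Longrightarrow> E s t \<Longrightarrow> {s, t} = {u, v}"
    and missing: "\<not> E u x" "\<not> (E v x \<and> E v y)"
  shows "card (bicliques a b V E) \<le> card (bicliques a b V (plus_edge P Q x y))"
proof -
  let ?F = "plus_edge P Q x y"
  have ne: "x \<noteq> y" "u \<noteq> v" using e adjacency_irrefl[OF E] by auto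
  have sym: "E t s" if "E s t" for s t using that by (rule adjacency_sym[OF E])
  have EF: "?F s t" if st: "s \<in> V" "t \<in> V" "E s t" "{s, t} \<noteq> {u, v}" for s t
  proof -
    consider "s \<in> P" "t \<in> P" | "s \<in> Q" "t \<in> Q" | "s \<in> P" "t \<in> Q" | "s \<in> Q" "t \<in> P"
      using st(1,2) V(2) by blast
    then show ?thesis
    proof cases
      case 1
      then show ?thesis using uniqueP[OF 1 st(3)] unfolding plus_edge_def by (auto simp: doubleton_eq_iff)
    next
      case 2
      then show ?thesis using uniqueQ[OF 2 st(3)] st(4) by blast
    qed (simp_all add: plus_edge_def complete_bip_def)
  qed
  have fin: "finite P" "finite Q" using V by (metis finite_Un)+
  show ?thesis
  proof (cases "a = 1")
    case True
    have "card {w \<in> V. E z w} \<le> card {w \<in> V. ?F z w}" if z: "z \<in> V" for z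
    proof (cases "z = u \<or> z = v")
      case False
      then have "{w \<in> V. E z w} \<subseteq> {w \<in> V. ?F z w}" using EF[OF z] by (auto simp: doubleton_eq_iff)
      then show ?thesis by (rule card_mono[rotated]) (use V in simp)
    next
      case True
      then have "z \<in> Q" using e by blast
      have "\<exists>t\<in>P. \<not> E z t" using True missing e by blast
      then obtain t where t: "t \<in> P" "\<not> E z t" by blast
      let ?z = "if z = u then v else u"
      have sub: "{w \<in> V. E z w} \<subseteq> insert ?z (P - {t})"
      proof
        fix w assume w: "w \<in> {w \<in> V. E z w}"
        show "w \<in> insert ?z (P - {t})"
        proof (cases "w \<in> P")
          case True
          then show ?thesis using w t by blast
        next
          case False
          then have "{z, w} = {u, v}" using w V(2) uniqueQ[OF \<open>z \<in> Q\<close>, of w] by blast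
          then show ?thesis using ne by (auto simp: doubleton_eq_iff)
        qed
      qed
      have "card {w \<in> V. E z w} \<le> card (insert ?z (P - {t}))"
        by (rule card_mono[OF _ sub]) (use fin in simp)
      also have "\<dots> \<le> Suc (card (P - {t}))" by (rule card_insert_le_m1) simp_all
      also have "\<dots> = card P" by (rule card_Suc_Diff1[OF fin(1) t(1)])
      also have "\<dots> \<le> card {w \<in> V. ?F z w}"
        by (rule card_mono) (use V \<open>z \<in> Q\<close> in \<open>auto simp: plus_edge_def complete_bip_def\<close>)
      finally show ?thesis .
    qed
    then show ?thesis
      unfolding True card_bicliques_star[OF V(1)] by (intro sum_mono binomial_right_mono)
  next
    case False
    then have a2: "2 \<le> a" "2 \<le> b" using ab by auto
    \<comment> \<open>As \<open>u\<close> is not adjacent to \<open>x\<close>, these are the only bicliques that can use the edge \<open>u v\<close>.\<close>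
    let ?N = "{({u, x}, {v, y}), ({v, y}, {u, x})}"
    have key: "X = {u, x} \<and> Y = {v, y}"
      if B: "X \<subseteq> V" "Y \<subseteq> V" "card X \<ge> 2" "card Y \<ge> 2" "\<And>s t. s \<in> X \<Longrightarrow> t \<in> Y \<Longrightarrow> E s t" "u \<in> X" "v \<in> Y" for X Y
    proof -
      have XP: "X - {u} \<subseteq> P"
      proof
        fix s assume s: "s \<in> X - {u}"
        then have "E s v" "s \<noteq> v" using B(5,7) adjacency_irrefl[OF E] by blast+
        then show "s \<in> P" using uniqueQ[of s v] s B(1) V(2) e(5) by (auto simp: doubleton_eq_iff)
      qed
      have YP: "Y - {v} \<subseteq> P"
      proof
        fix s assume s: "s \<in> Y - {v}"
        then have "E u s" "s \<noteq> u" using B(5,6) adjacency_irrefl[OF E] by blast+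
        then show "s \<in> P" using uniqueQ[of u s] s B(2) V(2) e(4) by (auto simp: doubleton_eq_iff)
      qed
      have pair: "s = x \<and> t = y" if st: "s \<in> X - {u}" "t \<in> Y - {v}" for s t
      proof -
        have "{s, t} = {x, y}" using uniqueP[of s t] st XP YP B(5) by blast
        moreover have "t \<noteq> x" using st(2) B(5,6) missing(1) by blast
        ultimately show ?thesis by (auto simp: doubleton_eq_iff)
      qed
      have "X - {u} \<noteq> {}" "Y - {v} \<noteq> {}"
        using B(3,4) by (auto simp: subset_singleton_iff)
      then obtain s t where st: "s \<in> X - {u}" "t \<in> Y - {v}" by blast
      then have "X - {u} = {x}" "Y - {v} = {y}" using pair by blast+
      then show ?thesis using B(6,7) by blast
    qed
    have sub: "bicliques a b V E - bicliques a b V ?F \<subseteq> {p \<in> ?N. card (fst p) = a \<and> card (snd p) = b}"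
    proof
      fix p assume p: "p \<in> bicliques a b V E - bicliques a b V ?F"
      obtain X Y where XY: "p = (X, Y)" by fastforce
      have B: "X \<subseteq> V" "Y \<subseteq> V" "card X = a" "card Y = b" "\<And>s t. s \<in> X \<Longrightarrow> t \<in> Y \<Longrightarrow> E s t"
        using p unfolding XY by (auto simp: mem_bicliques)
      have "(X, Y) \<notin> bicliques a b V ?F" using p unfolding XY by blast
      then obtain s t where st: "s \<in> X" "t \<in> Y" "\<not> ?F s t" using B unfolding mem_bicliques by blast
      then have "{s, t} = {u, v}" using EF[of s t] B by blast
      then consider "u \<in> X" "v \<in> Y" | "u \<in> Y" "v \<in> X" using st by (auto simp: doubleton_eq_iff)
      then have "p \<in> ?N"
      proof cases
        case 1
        then show ?thesis using key[OF B(1,2) _ _ B(5)] B(3,4) a2 XY by simp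
      next
        case 2
        have "Y = {u, x} \<and> X = {v, y}"
          by (rule key[OF B(2,1)]) (use B(3,4) a2 sym[OF B(5)] 2 in auto)
        then show ?thesis using XY by simp
      qed
      then show "p \<in> {p \<in> ?N. card (fst p) = a \<and> card (snd p) = b}" using B(3,4) XY by simp
    qed
    show ?thesis
    proof (cases "a = 2 \<and> b = 2")
      case True
      have "card (bicliques a b V E - bicliques a b V ?F) \<le> card ?N"
        by (rule card_mono) (use sub in auto)
      also have "\<dots> \<le> Suc (Suc 0)" by (rule order_trans[OF card_insert_le_m1[of 2]]) simp_all
      also have "Suc (Suc 0) = card {({u, v}, {x, y}), ({x, y}, {u, v})}"
      proof -
        have "({u, v}, {x, y}) \<noteq> ({x, y}, {u, v})"
          using e V(3) by (metis Pair_inject disjoint_iff insertCI insertE singletonD)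
        from card_2_iff[THEN iffD2, of "{({u, v}, {x, y}), ({x, y}, {u, v})}"] this show ?thesis by auto
      qed
      also have "\<dots> \<le> card (bicliques a b V ?F - bicliques a b V E)"
      proof (rule card_mono)
        show "finite (bicliques a b V ?F - bicliques a b V E)" using finite_bicliques[OF V(1)] by blast
        have xu: "\<not> E x u" using missing(1) sym by blast
        have cards: "card {u, v} = 2" "card {x, y} = 2" using ne by simp_all
        have inV: "{u, v} \<subseteq> V" "{x, y} \<subseteq> V" using e V(2) by blast+
        have F: "\<forall>s\<in>{u, v}. \<forall>t\<in>{x, y}. ?F s t" "\<forall>s\<in>{x, y}. \<forall>t\<in>{u, v}. ?F s t"
          using e by (simp_all add: plus_edge_def complete_bip_def)
        have "({u, v}, {x, y}) \<in> bicliques a b V ?F" "({x, y}, {u, v}) \<in> bicliques a b V ?F"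
          unfolding mem_bicliques using True cards inV F by blast+
        moreover have "({u, v}, {x, y}) \<notin> bicliques a b V E" "({x, y}, {u, v}) \<notin> bicliques a b V E"
          unfolding mem_bicliques using missing(1) xu by blast+
        ultimately show "{({u, v}, {x, y}), ({x, y}, {u, v})} \<subseteq> bicliques a b V ?F - bicliques a b V E"
          by simp
      qed
      finally show ?thesis
        by (rule card_le_of_card_Diff_le[OF finite_bicliques[OF V(1)] finite_bicliques[OF V(1)]])
    next
      case False
      have "u \<noteq> x" "v \<noteq> y" using e V(3) by blast+
      then have "card {u, x} = 2" "card {v, y} = 2" by simp_all
      then have none: "{p \<in> ?N. card (fst p) = a \<and> card (snd p) = b} = {}" using False by auto
      have "bicliques a b V E \<subseteq> bicliques a b V ?F" using sub unfolding none by blast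
      then show ?thesis by (rule card_mono[OF finite_bicliques[OF V(1)]])
    qed
  qed
qed

text \<open>If both parts contain an edge, say \<open>x y\<close> and \<open>u v\<close>, then \<open>u\<close> is not adjacent to both \<open>x\<close> and
  \<open>y\<close>: the triangle \<open>u x y\<close> and the triangle of \<open>u v\<close> with a common neighbour in \<open>P\<close> other than
  \<open>x\<close> and \<open>y\<close> would form a bowtie. The same holds for \<open>v\<close>.\<close>

lemma le_plus_edge:
  assumes V: "finite V" "P \<union> Q = V" "P \<inter> Q = {}" and E: "adjacency E" "bowtie_free E"
    and ab: "1 \<le> a" "a \<le> b" and d: "0 \<le> d" "almost_complete d E P Q"
    and large: "4 * d + 4 < real (card P)" "4 * d + 4 < real (card Q)"
  obtains A B u v where "A \<union> B = V" "A \<inter> B = {}" "B \<noteq> {}" "u \<in> A" "v \<in> A" "u \<noteq> v"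
    "card (bicliques a b V E) \<le> card (bicliques a b V (plus_edge A B u v))"
proof -
  have fin: "finite P" "finite Q" using V by (metis finite_Un)+
  have few: "\<And>y. y \<in> Q \<Longrightarrow> real (card {w \<in> P. \<not> E y w}) \<le> d" "\<And>y. y \<in> P \<Longrightarrow> real (card {w \<in> Q. \<not> E y w}) \<le> d"
    using d(2) by (simp_all add: almost_complete_def)
  have large': "4 * d + 1 < real (card P)" "4 * d + 1 < real (card Q)" using large by linarith+
  note uQ = at_most_one_edge[OF E fin(1) few(1) large'(1) d(1)]
  note uP = at_most_one_edge[OF E fin(2) few(2) large'(2) d(1)]
  have one: "\<exists>u\<in>A. \<exists>v\<in>A. u \<noteq> v \<and> card (bicliques a b V E) \<le> card (bicliques a b V (plus_edge A B u v))"
    if AB: "A \<union> B = V" "1 < card A" and none: "\<And>x y. x \<in> B \<Longrightarrow> y \<in> B \<Longrightarrow> \<not> E x y"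
      and unique: "\<And>x y x' y'. x \<in> A \<Longrightarrow> y \<in> A \<Longrightarrow> E x y \<Longrightarrow> x' \<in> A \<Longrightarrow> y' \<in> A \<Longrightarrow> E x' y' \<Longrightarrow> {x, y} = {x', y'}"
    for A B
  proof -
    obtain u v where uv: "u \<in> A" "v \<in> A" "u \<noteq> v" "\<And>s t. s \<in> A \<Longrightarrow> t \<in> A \<Longrightarrow> E s t \<Longrightarrow> {s, t} = {u, v}"
    proof (cases "\<exists>u\<in>A. \<exists>v\<in>A. E u v")
      case True
      then obtain u v where uv: "u \<in> A" "v \<in> A" "E u v" by blast
      then have "u \<noteq> v" using adjacency_irrefl[OF E(1)] by auto
      then show ?thesis using that[of u v] unique[OF _ _ _ uv] uv by blast
    next
      case False
      obtain u v where "u \<in> A" "v \<in> A" "u \<noteq> v" by (rule card_ge_2_obtain[OF AB(2)])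
      then show ?thesis using that[of u v] False by blast
    qed
    have "plus_edge A B u v s t" if "s \<in> V" "t \<in> V" "E s t" for s t
    proof (cases "s \<in> A \<and> t \<in> A")
      case True
      then show ?thesis using uv(4)[of s t] that unfolding plus_edge_def by (auto simp: doubleton_eq_iff)
    next
      case False
      then show ?thesis using that AB(1) none unfolding plus_edge_def complete_bip_def by blast
    qed
    then show ?thesis using card_bicliques_mono[OF V(1), of E] uv by blast
  qed
  have big: "1 < card P" "1 < card Q" using large d(1) by linarith+
  then have nonempty: "P \<noteq> {}" "Q \<noteq> {}" by auto
  consider "\<forall>x\<in>Q. \<forall>y\<in>Q. \<not> E x y" | "\<forall>x\<in>P. \<forall>y\<in>P. \<not> E x y"
    | x y u v where "x \<in> P" "y \<in> P" "E x y" "u \<in> Q" "v \<in> Q" "E u v" by blast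
  then show ?thesis
  proof cases
    case 1
    have "\<exists>u\<in>P. \<exists>v\<in>P. u \<noteq> v \<and> card (bicliques a b V E) \<le> card (bicliques a b V (plus_edge P Q u v))"
      by (rule one[OF V(2) big(1)]) (use 1 in blast, rule uP)
    then show ?thesis using that[OF V(2,3) nonempty(2)] by blast
  next
    case 2
    have QP: "Q \<union> P = V" "Q \<inter> P = {}" using V by blast+
    have "\<exists>u\<in>Q. \<exists>v\<in>Q. u \<noteq> v \<and> card (bicliques a b V E) \<le> card (bicliques a b V (plus_edge Q P u v))"
      by (rule one[OF QP(1) big(2)]) (use 2 in blast, rule uQ)
    then show ?thesis using that[OF QP nonempty(1)] by blast
  next
    case 3
    have "real (card P) - real (card {u, v}) * d \<le> real (card {w \<in> P. \<forall>y\<in>{u, v}. E y w})"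
      by (rule common_neighbours[OF fin(1)]) (use few(1) 3 in auto)
    moreover have "real (card {u, v}) * d \<le> 2 * d" using d(1) by (intro mult_right_mono) (auto simp: card_insert_if)
    ultimately have "2 < card {w \<in> P. \<forall>y\<in>{u, v}. E y w}" using large(1) d(1) by linarith
    moreover have "card {x, y} \<le> 2" by (simp add: card_insert_if)
    moreover have "card {w \<in> P. \<forall>y\<in>{u, v}. E y w} \<le> card {x, y}"
      if "{w \<in> P. \<forall>y\<in>{u, v}. E y w} \<subseteq> {x, y}" by (rule card_mono[OF _ that]) simp
    ultimately have "\<not> {w \<in> P. \<forall>y\<in>{u, v}. E y w} \<subseteq> {x, y}" by linarith
    then obtain p where p: "p \<in> P" "E u p" "E v p" "p \<noteq> x" "p \<noteq> y" by blast
    have "E v u" using 3 adjacency_sym[OF E(1)] by blast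
    have dis: "x \<noteq> u" "x \<noteq> v" "y \<noteq> u" "y \<noteq> v" using 3 V(3) by blast+
    have mu: "\<not> (E u x \<and> E u y)"
      using bowtie_freeD[OF E(2) _ _ 3(3) 3(6) p(2,3)] dis p by blast
    have mv: "\<not> (E v x \<and> E v y)"
      using bowtie_freeD[OF E(2) _ _ 3(3) \<open>E v u\<close> p(3,2)] dis p by blast
    have ne: "x \<noteq> y" using 3 adjacency_irrefl[OF E(1)] by auto
    have unP: "{s, t} = {x, y}" if "s \<in> P" "t \<in> P" "E s t" for s t
      by (rule uP) (use that 3 in auto)
    have unQ: "{s, t} = {u, v}" if "s \<in> Q" "t \<in> Q" "E s t" for s t
      by (rule uQ) (use that 3 in auto)
    show ?thesis
    proof (cases "E u x")
      case False
      have "card (bicliques a b V E) \<le> card (bicliques a b V (plus_edge P Q x y))"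
        by (rule two_inner_edges_le[OF V E(1) ab 3 _ _ False mv]) (rule unP unQ; assumption)+
      then show ?thesis using that[OF V(2,3) nonempty(2) 3(1,2) ne] by blast
    next
      case True
      have "E y x" using 3(3) adjacency_sym[OF E(1)] by blast
      have "\<not> E u y" using mu True by blast
      have "card (bicliques a b V E) \<le> card (bicliques a b V (plus_edge P Q y x))"
        by (rule two_inner_edges_le[OF V E(1) ab 3(2,1) \<open>E y x\<close> 3(4-6) _ _ \<open>\<not> E u y\<close>])
           (use unP mv in \<open>auto simp: insert_commute unQ\<close>)
      then show ?thesis using that[OF V(2,3) nonempty(2) 3(2,1) ne[symmetric]] by blast
    qed
  qed
qed

section \<open>Graphs as adjacency relations\<close>

definition graph_adj :: "'v graph \<Rightarrow> 'v \<Rightarrow> 'v \<Rightarrow> bool" where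
  "graph_adj G x y \<longleftrightarrow> {x, y} \<in> edges G"

definition graph_of :: "'v set \<Rightarrow> ('v \<Rightarrow> 'v \<Rightarrow> bool) \<Rightarrow> 'v graph" where
  "graph_of V E = (V, {{x, y} | x y. x \<in> V \<and> y \<in> V \<and> E x y})"

lemma adjacency_graph_adj:
  assumes "simple_graph G"
  shows "adjacency (graph_adj G)"
proof -
  have "\<not> graph_adj G x x" for x using assms by (auto simp: simple_graph_def graph_adj_def)
  moreover have "graph_adj G y x" if "graph_adj G x y" for x y
    using that by (simp add: graph_adj_def insert_commute)
  ultimately show ?thesis unfolding adjacency_def symp_def irreflp_def by blast
qed

lemma graph_adj_verts:
  assumes "simple_graph G" "graph_adj G x y"
  shows "x \<in> verts G" "y \<in> verts G"
  using assms by (auto simp: simple_graph_def graph_adj_def)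

lemma simple_graph_edgeE:
  assumes "simple_graph G" "e \<in> edges G"
  obtains x y where "e = {x, y}" "x \<in> verts G" "y \<in> verts G" "x \<noteq> y"
  using assms unfolding simple_graph_def by (metis card_2_iff insert_subset)

lemma graph_adj_graph_of:
  assumes "adjacency E"
  shows "graph_adj (graph_of V E) x y \<longleftrightarrow> x \<in> V \<and> y \<in> V \<and> E x y"
  using adjacency_sym[OF assms] by (auto simp: graph_adj_def graph_of_def doubleton_eq_iff)

lemma simple_graph_graph_of:
  assumes "finite V" "adjacency E"
  shows "simple_graph (graph_of V E)"
proof -
  have "x \<noteq> y" if "E x y" for x y using that adjacency_irrefl[OF assms(2)] by auto
  then show ?thesis using assms(1) by (auto simp: simple_graph_def graph_of_def card_insert_if)
qed

lemma edges_complete_bipartite_iff: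
  "{x, y} \<in> edges (complete_bipartite A B) \<longleftrightarrow> complete_bip A B x y"
  by (auto simp: complete_bipartite_def complete_bip_def doubleton_eq_iff)

lemma simple_complete_bipartite:
  assumes "finite A" "finite B" "A \<inter> B = {}"
  shows "simple_graph (complete_bipartite A B)"
proof -
  have "x \<noteq> y" if "x \<in> A" "y \<in> B" for x y using that assms(3) by blast
  then show ?thesis using assms(1,2) by (auto simp: simple_graph_def complete_bipartite_def card_insert_if)
qed

lemma graph_iso_complete_bipartite:
  assumes "finite A" "finite B" "A \<inter> B = {}" "finite A'" "finite B'" "A' \<inter> B' = {}"
    "card A = card A'" "card B = card B'"
  shows "graph_iso (complete_bipartite A B) (complete_bipartite A' B')"
proof -
  obtain f where f: "bij_betw f A A'" using finite_same_card_bij[OF assms(1,4,7)] by blast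
  obtain g where g: "bij_betw g B B'" using finite_same_card_bij[OF assms(2,5,8)] by blast
  define h where "h = (\<lambda>x. if x \<in> A then f x else g x)"
  have hA: "bij_betw h A A'" by (rule bij_betw_cong[THEN iffD1, OF _ f]) (simp add: h_def)
  have hB: "bij_betw h B B'"
    by (rule bij_betw_cong[THEN iffD1, OF _ g]) (use assms(3) in \<open>auto simp: h_def\<close>)
  have h: "bij_betw h (A \<union> B) (A' \<union> B')" by (rule bij_betw_combine[OF hA hB assms(6)])
  have mem: "h x \<in> A' \<longleftrightarrow> x \<in> A" "h x \<in> B' \<longleftrightarrow> x \<in> B" if "x \<in> A \<union> B" for x
    using that bij_betwE[OF hA] bij_betwE[OF hB] assms(3,6) by blast+
  show ?thesis
    unfolding graph_iso_def edges_complete_bipartite_iff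
  proof (intro exI[of _ h] conjI ballI)
    show "bij_betw h (verts (complete_bipartite A B)) (verts (complete_bipartite A' B'))"
      using h by (simp add: complete_bipartite_def)
    fix x y assume "x \<in> verts (complete_bipartite A B)" "y \<in> verts (complete_bipartite A B)"
    then show "complete_bip A B x y \<longleftrightarrow> complete_bip A' B' (h x) (h y)"
      using mem by (simp add: complete_bipartite_def complete_bip_def)
  qed
qed

lemma complete_bipartite_of_graph_iso:
  assumes S: "simple_graph S" and iso: "graph_iso S (complete_bipartite A' B')" and disj: "A' \<inter> B' = {}"
  obtains A B where "S = complete_bipartite A B" "card A = card A'" "card B = card B'"
proof -
  obtain f where f: "bij_betw f (verts S) (A' \<union> B')"
    and e: "\<And>x y. x \<in> verts S \<Longrightarrow> y \<in> verts S \<Longrightarrow> {x, y} \<in> edges S \<longleftrightarrow> complete_bip A' B' (f x) (f y)"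
    using iso unfolding graph_iso_def edges_complete_bipartite_iff
    by (auto simp: complete_bipartite_def)
  define A where "A = {x \<in> verts S. f x \<in> A'}"
  define B where "B = {x \<in> verts S. f x \<in> B'}"
  have img: "f ` verts S = A' \<union> B'" and inj: "inj_on f (verts S)" using f by (auto simp: bij_betw_def)
  have AB: "verts S = A \<union> B" using img by (auto simp: A_def B_def)
  have "f ` A = A'" using img by (auto simp: A_def)
  then have "card A = card A'" using card_image[OF inj_on_subset[OF inj, of A]] by (auto simp: A_def)
  moreover have "f ` B = B'" using img by (auto simp: B_def)
  then have "card B = card B'" using card_image[OF inj_on_subset[OF inj, of B]] by (auto simp: B_def)
  moreover have "S = complete_bipartite A B"
  proof -
    have iff: "{x, y} \<in> edges S \<longleftrightarrow> {x, y} \<in> edges (complete_bipartite A B)"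
      if "x \<in> verts S" "y \<in> verts S" for x y
      unfolding e[OF that] edges_complete_bipartite_iff using that by (simp add: complete_bip_def A_def B_def)
    have "edges S = edges (complete_bipartite A B)"
    proof (intro set_eqI iffI)
      fix d assume "d \<in> edges S"
      then show "d \<in> edges (complete_bipartite A B)"
        using iff by (metis simple_graph_edgeE[OF S])
    next
      fix d assume d: "d \<in> edges (complete_bipartite A B)"
      then obtain x y where "d = {x, y}" "x \<in> A" "y \<in> B" by (auto simp: complete_bipartite_def)
      then show "d \<in> edges S" using iff[of x y] d AB by blast
    qed
    then show ?thesis using AB by (intro prod_eqI) (simp_all add: complete_bipartite_def)
  qed
  ultimately show ?thesis using that by blast
qed

lemma complete_bipartite_eq_iff:
  assumes "A \<inter> B = {}" "A' \<inter> B' = {}" "A \<noteq> {}" "B \<noteq> {}" "A' \<noteq> {}" "B' \<noteq> {}"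
  shows "complete_bipartite A B = complete_bipartite A' B' \<longleftrightarrow> A = A' \<and> B = B' \<or> A = B' \<and> B = A'"
proof
  assume eq: "complete_bipartite A B = complete_bipartite A' B'"
  have un: "A \<union> B = A' \<union> B'" using eq by (simp add: complete_bipartite_def)
  have adj: "complete_bip A B x y \<longleftrightarrow> complete_bip A' B' x y" for x y
    unfolding edges_complete_bipartite_iff[symmetric] eq ..
  obtain x y where xy: "x \<in> A'" "y \<in> B'" using assms by blast
  show "A = A' \<and> B = B' \<or> A = B' \<and> B = A'"
  proof (cases "x \<in> A")
    case True
    have "B = {z. complete_bip A B x z}" using True assms(1) by (auto simp: complete_bip_def)
    also have "\<dots> = B'" unfolding adj using xy assms(2) by (auto simp: complete_bip_def)
    finally show ?thesis using un assms(1,2) by blast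
  next
    case False
    then have "x \<in> B" using un xy by blast
    then have "A = {z. complete_bip A B x z}" using False by (auto simp: complete_bip_def)
    also have "\<dots> = B'" unfolding adj using xy assms(2) by (auto simp: complete_bip_def)
    finally show ?thesis using un assms(1,2) by blast
  qed
next
  assume "A = A' \<and> B = B' \<or> A = B' \<and> B = A'"
  then show "complete_bipartite A B = complete_bipartite A' B'"
    by (auto simp: complete_bipartite_def insert_commute)
qed

lemma copies_eq_image_bicliques:
  assumes G: "simple_graph G"
  shows "copies (K a b) G = (\<lambda>(X, Y). complete_bipartite X Y) ` bicliques a b (verts G) (graph_adj G)"
proof
  have finG: "finite (verts G)" using G by (simp add: simple_graph_def)
  show "copies (K a b) G \<subseteq> (\<lambda>(X, Y). complete_bipartite X Y) ` bicliques a b (verts G) (graph_adj G)"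
  proof
    fix S assume "S \<in> copies (K a b) G"
    then have S: "subgraph S G" "graph_iso S (K a b)" by (auto simp: copies_def)
    have simp: "simple_graph S" "verts S \<subseteq> verts G" "edges S \<subseteq> edges G"
      using S(1) by (auto simp: subgraph_def)
    have "{0..<a} \<inter> {a..<a + b} = {}" by auto
    then obtain X Y where XY: "S = complete_bipartite X Y" "card X = card {0..<a}" "card Y = card {a..<a + b}"
      using complete_bipartite_of_graph_iso[OF simp(1) S(2)[unfolded K_def]] by blast
    have "\<forall>x\<in>X. \<forall>y\<in>Y. graph_adj G x y"
      using simp(3) XY(1) by (auto simp: complete_bipartite_def graph_adj_def)
    then have "(X, Y) \<in> bicliques a b (verts G) (graph_adj G)"
      using XY simp(2) by (auto simp: mem_bicliques complete_bipartite_def)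
    then show "S \<in> (\<lambda>(X, Y). complete_bipartite X Y) ` bicliques a b (verts G) (graph_adj G)"
      using XY(1) by (intro image_eqI[of _ _ "(X, Y)"]) simp_all
  qed
  show "(\<lambda>(X, Y). complete_bipartite X Y) ` bicliques a b (verts G) (graph_adj G) \<subseteq> copies (K a b) G"
  proof (rule image_subsetI)
    fix p assume p: "p \<in> bicliques a b (verts G) (graph_adj G)"
    obtain X Y where XY: "p = (X, Y)" by fastforce
    have B: "X \<subseteq> verts G" "Y \<subseteq> verts G" "card X = a" "card Y = b" "\<forall>x\<in>X. \<forall>y\<in>Y. graph_adj G x y"
      using p unfolding XY mem_bicliques by blast+
    have disj: "X \<inter> Y = {}" using biclique_disjoint[OF adjacency_graph_adj[OF G]] p XY by blast
    have fin: "finite X" "finite Y" using B finG finite_subset by blast+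
    have "simple_graph (complete_bipartite X Y)" by (rule simple_complete_bipartite[OF fin disj])
    moreover have "verts (complete_bipartite X Y) \<subseteq> verts G" "edges (complete_bipartite X Y) \<subseteq> edges G"
      using B by (auto simp: complete_bipartite_def graph_adj_def)
    moreover have "graph_iso (complete_bipartite X Y) (K a b)"
      unfolding K_def by (rule graph_iso_complete_bipartite) (use fin disj B in auto)
    ultimately show "(\<lambda>(X, Y). complete_bipartite X Y) p \<in> copies (K a b) G"
      unfolding XY copies_def subgraph_def by simp
  qed
qed

text \<open>A connected bipartite graph determines its parts up to exchanging them, and the exchange gives
  another biclique of the same type only if \<open>a = b\<close>.\<close>

lemma num_copies_eq_bicliques:
  assumes G: "simple_graph G" and ab: "1 \<le> a" "1 \<le> b"
  shows "(if a = b then 2 else 1) * num_copies (K a b) G = card (bicliques a b (verts G) (graph_adj G))"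
proof -
  let ?B = "bicliques a b (verts G) (graph_adj G)"
  let ?f = "\<lambda>(X, Y). complete_bipartite X Y"
  have adj: "adjacency (graph_adj G)" by (rule adjacency_graph_adj[OF G])
  have finB: "finite ?B" by (rule finite_bicliques) (use G in \<open>simp add: simple_graph_def\<close>)
  have ne: "X \<noteq> {}" "Y \<noteq> {}" if "(X, Y) \<in> ?B" for X Y
    using that ab by (auto simp: mem_bicliques)
  have fibre: "card {p \<in> ?B. ?f p = S} = (if a = b then 2 else 1)" if S: "S \<in> ?f ` ?B" for S
  proof -
    obtain X Y where XY: "(X, Y) \<in> ?B" "S = complete_bipartite X Y" using S by auto
    have disj: "X \<inter> Y = {}" by (rule biclique_disjoint[OF adj XY(1)])
    have XneY: "X \<noteq> Y" using disj ne[OF XY(1)] by blast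
    have eq: "?f (X', Y') = S \<longleftrightarrow> X' = X \<and> Y' = Y \<or> X' = Y \<and> Y' = X" if "(X', Y') \<in> ?B" for X' Y'
      using complete_bipartite_eq_iff[OF biclique_disjoint[OF adj that] disj ne[OF that] ne[OF XY(1)]]
      unfolding XY(2) by simp
    show ?thesis
    proof (cases "a = b")
      case True
      have "(Y, X) \<in> ?B" using XY(1) True adjacency_sym[OF adj] by (auto simp: mem_bicliques)
      then have "p \<in> {p \<in> ?B. ?f p = S} \<longleftrightarrow> p \<in> {(X, Y), (Y, X)}" for p
        using eq[of "fst p" "snd p"] XY(1) by (cases p) auto
      then have "{p \<in> ?B. ?f p = S} = {(X, Y), (Y, X)}" by (intro set_eqI)
      then show ?thesis using True XneY by simp
    next
      case False
      have "(Y, X) \<notin> ?B" using XY(1) False by (auto simp: mem_bicliques)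
      then have "p \<in> {p \<in> ?B. ?f p = S} \<longleftrightarrow> p \<in> {(X, Y)}" for p
        using eq[of "fst p" "snd p"] XY(1) by (cases p) auto
      then have "{p \<in> ?B. ?f p = S} = {(X, Y)}" by (intro set_eqI)
      then show ?thesis using False by simp
    qed
  qed
  have "(\<Sum>p\<in>?B. card {S \<in> ?f ` ?B. ?f p = S}) = (if a = b then 2 else 1) * card (?f ` ?B)"
    by (rule sum_multicount[OF finB finite_imageI[OF finB]]) (use fibre in blast)
  moreover have "card {S \<in> ?f ` ?B. ?f p = S} = 1" if "p \<in> ?B" for p
  proof -
    have "?f p \<in> ?f ` ?B" by (rule imageI[OF that])
    then have single: "{S. S \<in> ?f ` ?B \<and> ?f p = S} = {?f p}" by auto
    show ?thesis unfolding single by (rule is_singletonI[unfolded is_singleton_altdef])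
  qed
  ultimately show ?thesis
    unfolding num_copies_def copies_eq_image_bicliques[OF G] by simp
qed

lemma free_of_B31_iff:
  assumes G: "simple_graph G"
  shows "free_of B31 G \<longleftrightarrow> bowtie_free (graph_adj G)"
proof
  assume free: "free_of B31 G"
  show "bowtie_free (graph_adj G)"
    unfolding bowtie_free_def
  proof (intro allI impI notI)
    fix c p q s t
    assume e: "graph_adj G c p" "graph_adj G c q" "graph_adj G p q"
      "graph_adj G c s" "graph_adj G c t" "graph_adj G s t" and disj: "{p, q} \<inter> {s, t} = {}"
    have irr: "\<not> graph_adj G x x" for x using adjacency_irrefl[OF adjacency_graph_adj[OF G]] .
    have ne: "c \<noteq> p" "c \<noteq> q" "p \<noteq> q" "c \<noteq> s" "c \<noteq> t" "s \<noteq> t" using e irr by auto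
    have ne': "p \<noteq> s" "p \<noteq> t" "q \<noteq> s" "q \<noteq> t" using disj by auto
    define S where "S = ({c, p, q, s, t}, {{c, p}, {c, q}, {p, q}, {c, s}, {c, t}, {s, t}})"
    define f :: "'a \<Rightarrow> nat" where
      "f = (\<lambda>x. if x = c then 0 else if x = p then 1 else if x = q then 2 else if x = s then 3 else 4)"
    have f: "f c = 0" "f p = 1" "f q = 2" "f s = 3" "f t = 4" using ne ne' by (auto simp: f_def)
    have "simple_graph S" using ne by (simp add: S_def simple_graph_def)
    moreover have "verts S \<subseteq> verts G" using graph_adj_verts[OF G] e by (auto simp: S_def)
    moreover have "edges S \<subseteq> edges G" using e by (simp add: S_def graph_adj_def)
    moreover have "graph_iso S B31"
      unfolding graph_iso_def
    proof (intro exI[of _ f] conjI)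
      show "bij_betw f (verts S) (verts B31)"
        unfolding bij_betw_def S_def B31_def using f ne ne' by (simp add: inj_on_def)
      show "\<forall>u\<in>verts S. \<forall>v\<in>verts S. ({u, v} \<in> edges S) = ({f u, f v} \<in> edges B31)"
        unfolding S_def B31_def using f ne ne' ne[symmetric] ne'[symmetric] by (simp add: doubleton_eq_iff)
    qed
    ultimately show False using free unfolding free_of_def subgraph_def by blast
  qed
next
  assume bf: "bowtie_free (graph_adj G)"
  show "free_of B31 G"
    unfolding free_of_def
  proof
    assume "\<exists>S. subgraph S G \<and> graph_iso S B31"
    then obtain S f where S: "subgraph S G" "bij_betw f (verts S) (verts B31)"
      and e: "\<And>u v. u \<in> verts S \<Longrightarrow> v \<in> verts S \<Longrightarrow> {u, v} \<in> edges S \<longleftrightarrow> {f u, f v} \<in> edges B31"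
      unfolding graph_iso_def by blast
    define g where "g = inv_into (verts S) f"
    have img: "f ` verts S = {0, 1, 2, 3, 4}" using S(2) by (simp add: bij_betw_def B31_def)
    have g: "g i \<in> verts S" "f (g i) = i" if "i \<in> {0, 1, 2, 3, 4}" for i
      using that img unfolding g_def by (metis inv_into_into, metis f_inv_into_f)
    have adj: "graph_adj G (g i) (g j)" if "i \<in> {0, 1, 2, 3, 4}" "j \<in> {0, 1, 2, 3, 4}" "{i, j} \<in> edges B31" for i j
    proof -
      have "{g i, g j} \<in> edges S" using e[OF g(1)[OF that(1)] g(1)[OF that(2)]] g(2) that by simp
      then show ?thesis using S(1) by (auto simp: subgraph_def graph_adj_def)
    qed
    have "g 1 = g 3 \<or> g 1 = g 4 \<or> g 2 = g 3 \<or> g 2 = g 4"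
      by (rule bowtie_freeD[OF bf, of "g 0"]; rule adj) (simp_all add: B31_def)
    then show False using g(2)[of 1] g(2)[of 2] g(2)[of 3] g(2)[of 4] by auto
  qed
qed

section \<open>The extremal number\<close>

text \<open>Only the order of magnitude matters, so the estimate \<open>(n choose k) \<ge> (n / k) ^ k\<close> suffices.\<close>

lemma many_bicliques_in_balanced:
  assumes ab: "1 \<le> a" "1 \<le> b" and V: "finite V" and large: "2 + 3 * (a + b) \<le> card V"
  obtains P Q where "P \<inter> Q = {}"
    "1 / (real (3 * a) ^ a * real (3 * b) ^ b) * real (card V) ^ (a + b)
      \<le> real (card (bicliques a b V (complete_bip P Q)))"
proof -
  define p where "p = card V div 2"
  have p: "card V \<le> 3 * p" "a \<le> p" "b \<le> p" using large by (auto simp: p_def)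
  have root: "(real (card V) / real (3 * k)) ^ k \<le> real (q choose k)" if "1 \<le> k" "k \<le> p" "p \<le> q" for k q
  proof -
    have "real (card V) \<le> 3 * real p" using p(1) by linarith
    then have "real (card V) / real (3 * k) \<le> real p / real k" using that by (simp add: field_simps)
    then have "(real (card V) / real (3 * k)) ^ k \<le> (real p / real k) ^ k" by (rule power_mono) simp
    also have "\<dots> \<le> real (p choose k)" by (rule binomial_ge_n_over_k_pow_k[OF that(2)])
    also have "\<dots> \<le> real (q choose k)" by (rule of_nat_mono[OF binomial_right_mono[OF that(3)]])
    finally show ?thesis .
  qed
  obtain P where P: "P \<subseteq> V" "card P = p"
    using obtain_subset_with_card_n[of p V] by (auto simp: p_def)
  have Q: "card (V - P) = card V - p" using P V by (simp add: card_Diff_subset finite_subset)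
  have "p \<le> card V - p" by (simp add: p_def)
  then have "(real (card V) / real (3 * a)) ^ a * (real (card V) / real (3 * b)) ^ b
      \<le> real (p choose a) * real ((card V - p) choose b)"
    using root[OF ab(1) p(2) order_refl] root[OF ab(2) p(3)] by (intro mult_mono) auto
  also have "\<dots> = real ((p choose a) * ((card V - p) choose b))" by simp
  also have "\<dots> \<le> real (bip_count a b (card P) (card (V - P)))"
    unfolding P(2) Q by (rule of_nat_mono) (simp add: bip_count_def)
  also have "\<dots> \<le> real (card (bicliques a b V (complete_bip P (V - P))))"
    by (rule of_nat_mono[OF bip_count_le_card_bicliques]) (use V P ab in auto)
  finally have "1 / (real (3 * a) ^ a * real (3 * b) ^ b) * real (card V) ^ (a + b)
      \<le> real (card (bicliques a b V (complete_bip P (V - P))))"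
    by (simp add: power_divide power_add)
  then show ?thesis using that[of P "V - P"] by blast
qed

theorem theorem1p4:
  fixes a b :: nat
  assumes "1 \<le> a" and "a \<le> b"
  shows "\<exists>n0. \<forall>n\<ge>n0. \<exists>T :: nat graph.
           complete_bipartite_plus_edge T \<and> card (verts T) = n \<and>
           ex_num n (K a b) B31 = num_copies (K a b) T"
proof -
  have ab: "1 \<le> a" "1 \<le> b" using assms by auto
  define c where "c = 1 / (real (3 * a) ^ a * real (3 * b) ^ b)"
  define \<mu> where "\<mu> = (if a = b then 2 else 1 :: nat)"
  have "1 \<le> real (3 * k) ^ k" if "1 \<le> k" for k using that by (intro one_le_power) simp
  then have "1 * 1 \<le> real (3 * a) ^ a * real (3 * b) ^ b" using ab by (intro mult_mono) auto
  then have c: "0 < c" "c \<le> 1" by (simp_all add: c_def)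
  have mu: "0 < \<mu>" by (simp add: \<mu>_def)
  have count: "\<mu> * num_copies (K a b) G = card (bicliques a b (verts G) (graph_adj G))"
    if "simple_graph G" for G :: "nat graph"
    unfolding \<mu>_def by (rule num_copies_eq_bicliques[OF that ab])
  obtain n1 where extremal: "\<forall>n\<ge>n1. \<forall>(V :: nat set) E. finite V \<longrightarrow> card V = n \<longrightarrow> adjacency E \<longrightarrow> bowtie_free E \<longrightarrow>
    (\<forall>F. adjacency F \<longrightarrow> bowtie_free F \<longrightarrow> card (bicliques a b V F) \<le> card (bicliques a b V E)) \<longrightarrow>
    c * real n ^ (a + b) \<le> real (card (bicliques a b V E)) \<longrightarrow>
    (\<exists>P Q d. P \<union> Q = V \<and> P \<inter> Q = {} \<and> 0 \<le> d \<and> almost_complete d E P Q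
       \<and> 4 * d + 4 < real (card P) \<and> 4 * d + 4 < real (card Q))"
    using extremal_structure[OF ab c] by (rule exE)
  show ?thesis
  proof (rule exI[of _ "max n1 (2 + 3 * (a + b))"], intro allI impI)
    fix n assume n: "max n1 (2 + 3 * (a + b)) \<le> n"
    let ?M = "{num_copies (K a b) G | G :: nat graph. simple_graph G \<and> card (verts G) = n \<and> free_of B31 G}"
    have bounded: "num_copies (K a b) G \<le> n ^ (a + b)" if "simple_graph G" "card (verts G) = n" for G :: "nat graph"
    proof -
      have fin: "finite (verts G)" using that by (simp add: simple_graph_def)
      have "num_copies (K a b) G \<le> \<mu> * num_copies (K a b) G" using mu by simp
      also have "\<dots> \<le> card {(X, Y) \<in> blocks a b (verts G). {} \<subseteq> X \<and> {} \<subseteq> Y}"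
        unfolding count[OF that(1)]
        by (rule card_mono[OF finite_blocks_Collect[OF fin]]) (auto simp: bicliques_def)
      also have "\<dots> \<le> n ^ (a + b)"
        using card_blocks_containing[OF fin, of "{}" "{}" a b] that(2) by simp
      finally show ?thesis .
    qed
    have finM: "finite ?M"
      by (rule finite_subset[of _ "{..n ^ (a + b)}"]) (use bounded in auto)
    \<comment> \<open>The edgeless graph shows that the maximum is taken over a nonempty set.\<close>
    define G0 :: "nat graph" where "G0 = graph_of {..<n} (\<lambda>x y. False)"
    have adj0: "adjacency (\<lambda>x y :: nat. False)" by (simp add: adjacency_def symp_def irreflp_def)
    have G0: "simple_graph G0" unfolding G0_def by (rule simple_graph_graph_of[OF _ adj0]) simp
    have "\<not> graph_adj G0 x y" for x y unfolding G0_def graph_adj_graph_of[OF adj0] by simp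
    then have "free_of B31 G0" unfolding free_of_B31_iff[OF G0] bowtie_free_def by simp
    moreover have "card (verts G0) = n" by (simp add: G0_def graph_of_def)
    ultimately have neM: "?M \<noteq> {}" using G0 by blast
    have "Max ?M \<in> ?M" by (rule Max_in[OF finM neM])
    then obtain G :: "nat graph" where G: "simple_graph G" "card (verts G) = n" "free_of B31 G"
      and exG: "Max ?M = num_copies (K a b) G" by blast
    define V where "V = verts G"
    define E where "E = graph_adj G"
    have V: "finite V" "card V = n" using G by (simp_all add: V_def simple_graph_def)
    have E: "adjacency E" "bowtie_free E"
      using adjacency_graph_adj[OF G(1)] free_of_B31_iff[OF G(1)] G(3) by (simp_all add: E_def)
    have max: "card (bicliques a b V F) \<le> card (bicliques a b V E)" if F: "adjacency F" "bowtie_free F" for F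
    proof -
      let ?H = "graph_of V F"
      have H: "simple_graph ?H" by (rule simple_graph_graph_of[OF V(1) F(1)])
      have adjH: "graph_adj ?H x y \<longleftrightarrow> x \<in> V \<and> y \<in> V \<and> F x y" for x y
        by (rule graph_adj_graph_of[OF F(1)])
      have "bowtie_free (graph_adj ?H)"
        unfolding bowtie_free_def adjH using F(2) unfolding bowtie_free_def by blast
      then have "free_of B31 ?H" by (simp add: free_of_B31_iff[OF H])
      moreover have vH: "verts ?H = V" by (simp add: graph_of_def)
      ultimately have "num_copies (K a b) ?H \<in> ?M"
        using H V(2) by (intro CollectI exI[of _ ?H]) simp
      from Max_ge[OF finM this] have "num_copies (K a b) ?H \<le> num_copies (K a b) G"
        unfolding exG .
      then have "\<mu> * num_copies (K a b) ?H \<le> \<mu> * num_copies (K a b) G" by (rule mult_le_mono2)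
      then have "card (bicliques a b V (graph_adj ?H)) \<le> card (bicliques a b V E)"
        unfolding count[OF H] count[OF G(1)] vH V_def[symmetric] E_def[symmetric] .
      moreover have "card (bicliques a b V F) \<le> card (bicliques a b V (graph_adj ?H))"
        by (rule card_bicliques_mono[OF V(1)]) (simp add: adjH)
      ultimately show ?thesis by linarith
    qed
    have "c * real n ^ (a + b) \<le> real (card (bicliques a b V E))"
    proof -
      obtain P Q where PQ: "P \<inter> Q = {}"
        "c * real (card V) ^ (a + b) \<le> real (card (bicliques a b V (complete_bip P Q)))"
        using many_bicliques_in_balanced[OF ab V(1)] n V(2) unfolding c_def by auto
      have "card (bicliques a b V (complete_bip P Q)) \<le> card (bicliques a b V E)"
        by (rule max[OF adjacency_complete_bip[OF PQ(1)]
              triangle_free_imp_bowtie_free[OF triangle_free_complete_bip[OF PQ(1)]]])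
      then show ?thesis using PQ(2) V(2) by simp
    qed
    moreover have "n1 \<le> n" using n by simp
    ultimately have "\<exists>P Q d. P \<union> Q = V \<and> P \<inter> Q = {} \<and> 0 \<le> d \<and> almost_complete d E P Q
       \<and> 4 * d + 4 < real (card P) \<and> 4 * d + 4 < real (card Q)"
      using extremal V E max by blast
    then obtain P Q d where PQ: "P \<union> Q = V" "P \<inter> Q = {}" "0 \<le> d" "almost_complete d E P Q"
      "4 * d + 4 < real (card P)" "4 * d + 4 < real (card Q)" by blast
    obtain A B u v where AB: "A \<union> B = V" "A \<inter> B = {}" "B \<noteq> {}" and uv: "u \<in> A" "v \<in> A" "u \<noteq> v"
      and best: "card (bicliques a b V E) \<le> card (bicliques a b V (plus_edge A B u v))"
      using le_plus_edge[OF V(1) PQ(1,2) E assms PQ(3-6)] by blast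
    define T where "T = (A \<union> B, insert {u, v} (edges (complete_bipartite A B)))"
    have finAB: "finite A" "finite B" using AB(1) V(1) by (metis finite_Un)+
    have new: "{u, v} \<notin> edges (complete_bipartite A B)"
      using uv AB(2) by (auto simp: edges_complete_bipartite_iff complete_bip_def)
    have shape: "complete_bipartite_plus_edge T"
      unfolding complete_bipartite_plus_edge_def T_def
      using finAB AB(2,3) uv new by blast
    have vT: "verts T = V" by (simp add: T_def AB(1))
    have simpT: "simple_graph T"
      using simple_complete_bipartite[OF finAB AB(2)] uv
      by (auto simp: simple_graph_def T_def complete_bipartite_def)
    have adjT: "graph_adj T = plus_edge A B u v"
    proof (intro ext)
      fix x y
      have "{x, y} \<in> edges T \<longleftrightarrow> {x, y} = {u, v} \<or> complete_bip A B x y"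
        by (simp add: T_def edges_complete_bipartite_iff)
      then show "graph_adj T x y \<longleftrightarrow> plus_edge A B u v x y"
        by (auto simp: graph_adj_def plus_edge_def doubleton_eq_iff)
    qed
    have "free_of B31 T"
      unfolding free_of_B31_iff[OF simpT] adjT by (rule bowtie_free_plus_edge[OF AB(2) uv])
    then have "num_copies (K a b) T \<in> ?M"
      using simpT vT V(2) by (intro CollectI exI[of _ T]) simp
    from Max_ge[OF finM this] have "num_copies (K a b) T \<le> num_copies (K a b) G"
      unfolding exG .
    moreover have "\<mu> * num_copies (K a b) G \<le> \<mu> * num_copies (K a b) T"
      unfolding count[OF G(1)] count[OF simpT] vT adjT using best by (simp add: V_def E_def)
    ultimately have "ex_num n (K a b) B31 = num_copies (K a b) T"
      using exG mu by (simp add: ex_num_def)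
    then show "\<exists>T :: nat graph. complete_bipartite_plus_edge T \<and> card (verts T) = n \<and>
           ex_num n (K a b) B31 = num_copies (K a b) T"
      using shape vT V(2) by blast
  qed
qed

end
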